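(* Let $A,B$ be $A_\infty$-algebras, and let $F=(F^{(m)})_{m\geqslant1}$ be an $A_\infty$-morphism from $A$ to $B$, seen as a vertex of the Kan complex $\mathrm{HOM}(A,B)_\bullet$ whose $n$-simplices are the $n$-morphisms from $A$ to $B$. (i) For $n\geqslant 1$, the set $\pi_n(\mathrm{HOM}(A,B)_\bullet,F)$ corresponds to the equivalence classes of collections of degree $-n$ maps $F_{\Delta^n}^{(m)}:(sA)^{\otimes m}\to sB$, $m\geqslant1$, satisfying for all $m\geqslant 1$ $$(-1)^n\sum_{i_1+i_2+i_3=m}F_{\Delta^n}^{(i_1+1+i_3)}(\mathrm{id}^{\otimes i_1}\otimes b_{i_2}\otimes\mathrm{id}^{\otimes i_3})=\sum_{i_1+\cdots+i_s+l+j_1+\cdots+j_t=m}b_{s+1+t}\big(F^{(i_1)}\otimes\cdots\otimes F^{(i_s)}\otimes F^{(l)}_{\Delta^n}\otimes F^{(j_1)}\otimes\cdots\otimes F^{(j_t)}\big),$$ where two such collections $(F_{\Delta^n}^{(m)})^{m\geqslant1}$ and $(G_{\Delta^n}^{(m)})^{m\geqslant1}$ are equivalent if and only if there exists a collection of degree $-(n+1)$ maps $H^{(m)}:(sA)^{\otimes m}\to sB$, $m\geqslant 1$, such that for all $m\geqslant 1$ $$G_{\Delta^n}^{(m)}-F_{\Delta^n}^{(m)}+(-1)^{n+1}\sum_{i_1+i_2+i_3=m}H^{(i_1+1+i_3)}(\mathrm{id}^{\otimes i_1}\otimes b_{i_2}\otimes\mathrm{id}^{\otimes i_3})=\sum_{i_1+\cdots+i_s+l+j_1+\cdots+j_t=m}b_{s+1+t}\big(F^{(i_1)}\otimes\cdots\otimes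 F^{(i_s)}\otimes H^{(l)}\otimes F^{(j_1)}\otimes\cdots\otimes F^{(j_t)}\big).$$ (ii) For $n=1$, given two such collections $(F_{\Delta^1}^{(m)})^{m\geqslant1}$ and $(G_{\Delta^1}^{(m)})^{m\geqslant1}$, the composition law on $\pi_1(\mathrm{HOM}(A,B)_\bullet,F)$ is given by the formula $$G_{\Delta^1}^{(m)}+F_{\Delta^1}^{(m)}-\sum b_{s+t+u+2}\big(F^{(i_1)}\otimes\cdots\otimes F^{(i_s)}\otimes F_{\Delta^1}^{(l_1)}\otimes F^{(j_1)}\otimes\cdots\otimes F^{(j_t)}\otimes G_{\Delta^1}^{(l_2)}\otimes F^{(k_1)}\otimes\cdots\otimes F^{(k_u)}\big),$$ the sum running over $i_1+\cdots+i_s+l_1+j_1+\cdots+j_t+l_2+k_1+\cdots+k_u=m$. (iii) If $n\geqslant2$, given two such collections $(F_{\Delta^n}^{(m)})^{m\geqslant1}$ and $(G_{\Delta^n}^{(m)})^{m\geqslant1}$, the composition law on $\pi_n(\mathrm{HOM}(A,B)_\bullet,F)$ is given by the formula $G_{\Delta^n}^{(m)}+F_{\Delta^n}^{(m)}$.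
   Context: Everything is over $\mathbb{Z}$, cohomologically graded, with the Koszul sign rule; $(sA)^i:=A^{i+1}$. In sums over $i_1+i_2+i_3=m$ one has $i_2\geqslant 1$ and $i_1,i_3\geqslant 0$; in the other sums $s,t,u\geqslant0$ and all indices $i_a,j_a,k_a,l,l_1,l_2$ are $\geqslant1$. An $A_\infty$-algebra is a graded module $A$ with degree $+1$ maps $b_m:(sA)^{\otimes m}\to sA$, $m\geqslant1$, such that $\sum_{i_1+i_2+i_3=m}b_{i_1+1+i_3}(\mathrm{id}^{\otimes i_1}\otimes b_{i_2}\otimes\mathrm{id}^{\otimes i_3})=0$. An overlapping partition $I_1\cup\dots\cup I_s=I$ of a face $I$ of the standard simplex $\Delta^n$ is a sequence of faces of $I$ with union $I$ and $\max(I_\ell)=\min(I_{\ell+1})$ for $1\leqslant\ell<s$. An $n$-morphism from $A$ to $B$ is a family of maps $F_I^{(m)}:(sA)^{\otimes m}\to sB$ of degree $|I|=-\dim I$, for all faces $I\subset\Delta^n$ and $m\geqslant1$, such that $$\sum_{j=0}^{\dim I}(-1)^jF^{(m)}_{\partial_jI}+(-1)^{|I|}\sum_{i_1+i_2+i_3=m}F_I^{(i_1+1+i_3)}(\mathrm{id}^{\otimes i_1}\otimes b_{i_2}\otimes\mathrm{id}^{\otimes i_3})=\sum_{i_1+\dots+i_s=m,\ I_1\cup\dots\cup I_s=I}b_s(F^{(i_1)}_{I_1}\otimes\dots\otimes F^{(i_s)}_{I_s}),$$ the last sum being over overlapping partitions (the first sum is absent if $\dim I=0$). Equivalently it is a morphism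 of dg-coalgebras $\pmb\Delta^n\otimes\overline T(sA)\to\overline T(sB)$, where $\pmb\Delta^n$ is the dg-coalgebra of faces of $\Delta^n$ with simplicial differential and Alexander–Whitney coproduct. An $A_\infty$-morphism is a $0$-morphism. Simplicial structure of $\mathrm{HOM}(A,B)_\bullet$: faces are restrictions to faces of $\Delta^n$; the $i$-th degeneracy sends $(F_I)$ to the family indexed by faces $J\subset\Delta^{n+1}$ equal to $F_{\sigma_i(J)}$ if $J\not\supset[i<i+1]$ and to $0$ otherwise, $\sigma_i$ being the map on vertices collapsing $i$ and $i+1$. For a Kan complex $X$ and a vertex $x$, $\pi_n(X,x)$ is the set of simplicial maps $\Delta^n\to X$ sending $\partial\Delta^n$ to $x$, modulo simplicial homotopies $\Delta^1\times\Delta^n\to X$ sending $\Delta^1\times\partial\Delta^n$ to $x$. The composition $[f]\cdot[g]$ of two classes is defined as the class of the $n$-th face of a filler $\Delta^{n+1}\to X$ of the horn $\mathsf\Lambda^n_{n+1}\to X$ which sends the $i$-th face to $x$ for $i=0,\dots,n-2$, the $(n-1)$-th face to $f$ and the $(n+1)$-th face to $g$. A simplicial map $\Delta^n\to\mathrm{HOM}(A,B)_\bullet$ sending $\partial\Delta^n$ to $F$ is an $n$-morphism with $F_I=F$ if $\dim I=0$ and $F_I=0$ if $0<\dim I<n$; it is identified with its components $F_{\Delta^n}^{(m)}$. *)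

theory Defs
  imports Main "HOL-Library.FuncSet"
begin

section \<open>Graded abelian groups and homogeneous multilinear maps\<close>

text \<open>
  A graded \<open>\<int>\<close>-module is an abelian group (a type of class \<^class>\<open>ab_group_add\<close>) that is the
  internal direct sum of subgroups \<open>A i\<close>, \<open>i \<in> \<int>\<close>.
\<close>

definition grading :: "(int \<Rightarrow> 'a::ab_group_add set) \<Rightarrow> bool" where
  "grading A \<longleftrightarrow>
     (\<forall>i. 0 \<in> A i \<and> (\<forall>x\<in>A i. \<forall>y\<in>A i. x + y \<in> A i) \<and> (\<forall>x\<in>A i. - x \<in> A i)) \<and>
     (\<forall>x. \<exists>!c. (\<forall>i. c i \<in> A i) \<and> finite {i. c i \<noteq> 0} \<and> x = (\<Sum>i\<in>{i. c i \<noteq> 0}. c i))"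

definition susp :: "(int \<Rightarrow> 'a set) \<Rightarrow> int \<Rightarrow> 'a set" where
  "susp A i = A (i + 1)"

text \<open>\<open>xs = [x\<^sub>1, \<dots>, x\<^sub>m]\<close> stands for the pure tensor of homogeneous elements with degrees
  \<open>es = [e\<^sub>1, \<dots>, e\<^sub>m]\<close>. The degrees are carried separately because \<open>0\<close> lies in every degree.\<close>

definition homog :: "(int \<Rightarrow> 'a set) \<Rightarrow> int list \<Rightarrow> 'a list \<Rightarrow> bool" where
  "homog A es xs \<longleftrightarrow> list_all2 (\<lambda>e x. x \<in> A e) es xs"

text \<open>
  A family of degree \<open>d\<close> linear maps \<open>f\<^sup>m : A\<^sup>\<otimes>\<^sup>m \<rightarrow> B\<close>, \<open>m \<ge> 1\<close>, is encoded by one function on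
  lists: its restriction to lists of length \<open>m\<close> is the multilinear map corresponding to \<open>f\<^sup>m\<close>
  (over \<open>\<int>\<close>, linear means additive). The value at the empty list carries no information and is
  normalised to \<open>0\<close>, so that equal families are equal functions.
\<close>

definition multimap ::
  "(int \<Rightarrow> 'a::ab_group_add set) \<Rightarrow> (int \<Rightarrow> 'b::ab_group_add set) \<Rightarrow> int \<Rightarrow> ('a list \<Rightarrow> 'b) \<Rightarrow> bool"
where
  "multimap A B d f \<longleftrightarrow>
     f [] = 0 \<and>
     (\<forall>us vs x y. f (us @ (x + y) # vs) = f (us @ x # vs) + f (us @ y # vs)) \<and>
     (\<forall>es xs. xs \<noteq> [] \<longrightarrow> homog A es xs \<longrightarrow> f xs \<in> B (sum_list es + d))"

definition with_sign :: "int \<Rightarrow> 'a::ab_group_add \<Rightarrow> 'a" where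
  "with_sign k x = (if even k then x else - x)"

text \<open>
  A triple \<open>(d, i, f)\<close> is a map of degree \<open>d\<close> with \<open>i\<close> inputs. The tensor product of a list of such
  maps, evaluated at the pure tensor \<open>xs\<close> of degrees \<open>es\<close>, is \<open>(-1)\<^sup>k\<close> times the pure tensor \<open>ys\<close>,
  where \<open>(k, ys)\<close> is the result of \<open>koszul_tensor\<close>. The exponent comes from the Koszul rule
  \<open>(f \<otimes> g) (x \<otimes> y) = (-1)\<^bsup>|g| |x|\<^esup> f x \<otimes> g y\<close>, with \<open>g\<close> the tensor product of the remaining maps.
\<close>

fun koszul_tensor ::
  "(int \<times> nat \<times> ('a list \<Rightarrow> 'b)) list \<Rightarrow> int list \<Rightarrow> 'a list \<Rightarrow> int \<times> 'b list"
where
  "koszul_tensor [] es xs = (0, [])"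
| "koszul_tensor ((d, i, f) # fs) es xs =
     (case koszul_tensor fs (drop i es) (drop i xs) of (k, ys) \<Rightarrow>
       (k + sum_list (map fst fs) * sum_list (take i es), f (take i xs) # ys))"

text \<open>The value of the composite \<open>g \<circ> (f\<^sub>1 \<otimes> \<dots> \<otimes> f\<^sub>s)\<close> at \<open>xs\<close>.\<close>

definition after_tensor ::
  "('b list \<Rightarrow> 'c::ab_group_add) \<Rightarrow> (int \<times> nat \<times> ('a list \<Rightarrow> 'b)) list \<Rightarrow> int list \<Rightarrow> 'a list \<Rightarrow> 'c"
where
  "after_tensor g fs es xs = (case koszul_tensor fs es xs of (k, ys) \<Rightarrow> with_sign k (g ys))"

definition id_factor :: "int \<times> nat \<times> ('a list \<Rightarrow> 'a)" where
  "id_factor = (0, 1, hd)"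

section \<open>A-infinity algebras and n-morphisms\<close>

record 'a ainf =
  comps :: "int \<Rightarrow> 'a set"
  ops :: "'a list \<Rightarrow> 'a"

text \<open>\<open>\<Sum> f (id\<^sup>\<otimes>\<^sup>i\<^sup>1 \<otimes> b\<^sub>i\<^sub>2 \<otimes> id\<^sup>\<otimes>\<^sup>i\<^sup>3)\<close> over \<open>i\<^sub>1 + i\<^sub>2 + i\<^sub>3 = m\<close>, at \<open>xs\<close> of length \<open>m\<close>:\<close>

definition pre_sum :: "'a ainf \<Rightarrow> ('a list \<Rightarrow> 'b::ab_group_add) \<Rightarrow> int list \<Rightarrow> 'a list \<Rightarrow> 'b" where
  "pre_sum A f es xs =
     (\<Sum>(i1, i2, i3) \<in> {(i1, i2, i3). i1 + i2 + i3 = length xs \<and> i2 \<ge> 1}.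
        after_tensor f
          (replicate i1 id_factor @ [(1, i2, ops A)] @ replicate i3 id_factor) es xs)"

definition ainf_algebra :: "'a::ab_group_add ainf \<Rightarrow> bool" where
  "ainf_algebra A \<longleftrightarrow>
     grading (comps A) \<and>
     multimap (susp (comps A)) (susp (comps A)) 1 (ops A) \<and>
     (\<forall>es xs. xs \<noteq> [] \<longrightarrow> homog (susp (comps A)) es xs \<longrightarrow> pre_sum A (ops A) es xs = 0)"

text \<open>Faces of \<open>\<Delta>\<^sup>n\<close> are identified with their vertex sets.\<close>

definition is_face :: "nat \<Rightarrow> nat set \<Rightarrow> bool" where
  "is_face n I \<longleftrightarrow> I \<noteq> {} \<and> I \<subseteq> {0..n}"

definition face_dim :: "nat set \<Rightarrow> nat" where
  "face_dim I = card I - 1"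

definition bd_face :: "nat \<Rightarrow> nat set \<Rightarrow> nat set" where
  "bd_face j I = I - {sorted_list_of_set I ! j}"

definition overlapping_partition :: "nat set \<Rightarrow> nat set list \<Rightarrow> bool" where
  "overlapping_partition I Js \<longleftrightarrow>
     (\<forall>J\<in>set Js. J \<noteq> {} \<and> J \<subseteq> I) \<and> \<Union>(set Js) = I \<and>
     (\<forall>l. Suc l < length Js \<longrightarrow> Max (Js ! l) = Min (Js ! Suc l))"

text \<open>
  An element of the index set below is a list \<open>[(i\<^sub>1, I\<^sub>1), \<dots>, (i\<^sub>s, I\<^sub>s)]\<close> with \<open>i\<^sub>a \<ge> 1\<close>,
  \<open>i\<^sub>1 + \<dots> + i\<^sub>s = m\<close> and \<open>I\<^sub>1 \<union> \<dots> \<union> I\<^sub>s = I\<close> an overlapping partition; \<open>s \<le> m\<close> makes it finite.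
\<close>

definition partition_sum ::
  "'b ainf \<Rightarrow> (nat set \<Rightarrow> 'a list \<Rightarrow> 'b::ab_group_add) \<Rightarrow> nat set \<Rightarrow> int list \<Rightarrow> 'a list \<Rightarrow> 'b"
where
  "partition_sum B F I es xs =
     (\<Sum>ps \<in> {ps. 0 \<notin> set (map fst ps) \<and> sum_list (map fst ps) = length xs \<and>
                 overlapping_partition I (map snd ps)}.
        after_tensor (ops B) (map (\<lambda>(i, J). (- int (face_dim J), i, F J)) ps) es xs)"

text \<open>An \<open>n\<close>-morphism is a family indexed by the faces of \<open>\<Delta>\<^sup>n\<close>; it is extended by \<open>0\<close> to all other
  sets of naturals.\<close>

definition n_morphism ::
  "'a::ab_group_add ainf \<Rightarrow> 'b::ab_group_add ainf \<Rightarrow> nat \<Rightarrow> (nat set \<Rightarrow> 'a list \<Rightarrow> 'b) \<Rightarrow> bool"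
where
  "n_morphism A B n F \<longleftrightarrow>
     (\<forall>I. \<not> is_face n I \<longrightarrow> F I = (\<lambda>_. 0)) \<and>
     (\<forall>I. is_face n I \<longrightarrow>
        multimap (susp (comps A)) (susp (comps B)) (- int (face_dim I)) (F I) \<and>
        (\<forall>es xs. xs \<noteq> [] \<longrightarrow> homog (susp (comps A)) es xs \<longrightarrow>
           (if face_dim I = 0 then 0 else \<Sum>j\<in>{0..face_dim I}. with_sign (int j) (F (bd_face j I) xs))
           + with_sign (- int (face_dim I)) (pre_sum A (F I) es xs)
           = partition_sum B F I es xs))"

definition vertex :: "('a list \<Rightarrow> 'b::zero) \<Rightarrow> nat set \<Rightarrow> 'a list \<Rightarrow> 'b" where
  "vertex F I = (if I = {0} then F else (\<lambda>_. 0))"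

definition ainf_morphism ::
  "'a::ab_group_add ainf \<Rightarrow> 'b::ab_group_add ainf \<Rightarrow> ('a list \<Rightarrow> 'b) \<Rightarrow> bool" where
  "ainf_morphism A B F \<longleftrightarrow> n_morphism A B 0 (vertex F)"

section \<open>Simplicial sets and homotopy groups\<close>

text \<open>\<open>face X n i : X\<^sub>n \<rightarrow> X\<^sub>n\<^sub>-\<^sub>1\<close> and \<open>degen X n i : X\<^sub>n \<rightarrow> X\<^sub>n\<^sub>+\<^sub>1\<close>.\<close>

record 's sset =
  simplices :: "nat \<Rightarrow> 's set"
  face :: "nat \<Rightarrow> nat \<Rightarrow> 's \<Rightarrow> 's"
  degen :: "nat \<Rightarrow> nat \<Rightarrow> 's \<Rightarrow> 's"

definition simplicial_map :: "'s sset \<Rightarrow> 't sset \<Rightarrow> (nat \<Rightarrow> 's \<Rightarrow> 't) \<Rightarrow> bool" where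
  "simplicial_map X Y f \<longleftrightarrow>
     (\<forall>k. f k \<in> simplices X k \<rightarrow>\<^sub>E simplices Y k) \<and>
     (\<forall>k. \<forall>i\<le>Suc k. \<forall>x\<in>simplices X (Suc k).
        f k (face X (Suc k) i x) = face Y (Suc k) i (f (Suc k) x)) \<and>
     (\<forall>k. \<forall>i\<le>k. \<forall>x\<in>simplices X k.
        f (Suc k) (degen X k i x) = degen Y k i (f k x))"

text \<open>The \<open>k\<close>-simplices of \<open>\<Delta>\<^sup>n\<close> are the weakly increasing maps \<open>[k] \<rightarrow> [n]\<close>, written as lists of
  their \<open>k + 1\<close> values.\<close>

definition std_simplex :: "nat \<Rightarrow> nat list sset" where
  "std_simplex n = \<lparr>
     simplices = (\<lambda>k. {xs. length xs = Suc k \<and> sorted xs \<and> set xs \<subseteq> {0..n}}),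
     face = (\<lambda>k i xs. take i xs @ drop (Suc i) xs),
     degen = (\<lambda>k i xs. take (Suc i) xs @ drop i xs)\<rparr>"

definition in_boundary :: "nat \<Rightarrow> nat list \<Rightarrow> bool" where
  "in_boundary n xs \<longleftrightarrow> set xs \<noteq> {0..n}"

definition sset_prod :: "'s sset \<Rightarrow> 't sset \<Rightarrow> ('s \<times> 't) sset" where
  "sset_prod X Y = \<lparr>
     simplices = (\<lambda>k. simplices X k \<times> simplices Y k),
     face = (\<lambda>k i (x, y). (face X k i x, face Y k i y)),
     degen = (\<lambda>k i (x, y). (degen X k i x, degen Y k i y))\<rparr>"

text \<open>The totally degenerate \<open>k\<close>-simplex on a vertex, i.e. the constant map at that vertex.\<close>

fun const_simplex :: "'s sset \<Rightarrow> 's \<Rightarrow> nat \<Rightarrow> 's" where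
  "const_simplex X x 0 = x"
| "const_simplex X x (Suc k) = degen X k 0 (const_simplex X x k)"

definition spheres :: "'s sset \<Rightarrow> 's \<Rightarrow> nat \<Rightarrow> (nat \<Rightarrow> nat list \<Rightarrow> 's) set" where
  "spheres X x n = {f. simplicial_map (std_simplex n) X f \<and>
     (\<forall>k. \<forall>v\<in>simplices (std_simplex n) k. in_boundary n v \<longrightarrow> f k v = const_simplex X x k)}"

definition homotopy_rel ::
  "'s sset \<Rightarrow> 's \<Rightarrow> nat \<Rightarrow> ((nat \<Rightarrow> nat list \<Rightarrow> 's) \<times> (nat \<Rightarrow> nat list \<Rightarrow> 's)) set"
where
  "homotopy_rel X x n = {(f, g). f \<in> spheres X x n \<and> g \<in> spheres X x n \<and>
     (\<exists>h. simplicial_map (sset_prod (std_simplex 1) (std_simplex n)) X h \<and>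
        (\<forall>k. \<forall>u\<in>simplices (std_simplex 1) k. \<forall>v\<in>simplices (std_simplex n) k.
           in_boundary n v \<longrightarrow> h k (u, v) = const_simplex X x k) \<and>
        (\<forall>k. \<forall>v\<in>simplices (std_simplex n) k.
           h k (replicate (Suc k) 0, v) = f k v \<and> h k (replicate (Suc k) 1, v) = g k v))}"

definition homotopy_set :: "'s sset \<Rightarrow> 's \<Rightarrow> nat \<Rightarrow> (nat \<Rightarrow> nat list \<Rightarrow> 's) set set" where
  "homotopy_set X x n = spheres X x n // homotopy_rel X x n"

definition coface :: "nat \<Rightarrow> nat \<Rightarrow> nat" where
  "coface i j = (if j < i then j else Suc j)"

definition codegen :: "nat \<Rightarrow> nat \<Rightarrow> nat" where
  "codegen i j = (if j \<le> i then j else j - 1)"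

text \<open>The \<open>i\<close>-th face \<open>\<Delta>\<^sup>n \<rightarrow> X\<close> of a map \<open>w : \<Delta>\<^sup>n\<^sup>+\<^sup>1 \<rightarrow> X\<close>.\<close>

definition map_face :: "nat \<Rightarrow> nat \<Rightarrow> (nat \<Rightarrow> nat list \<Rightarrow> 's) \<Rightarrow> nat \<Rightarrow> nat list \<Rightarrow> 's" where
  "map_face n i w = (\<lambda>k. \<lambda>v\<in>simplices (std_simplex n) k. w k (map (coface i) v))"

definition const_map :: "'s sset \<Rightarrow> 's \<Rightarrow> nat \<Rightarrow> nat \<Rightarrow> nat list \<Rightarrow> 's" where
  "const_map X x n = (\<lambda>k. \<lambda>v\<in>simplices (std_simplex n) k. const_simplex X x k)"

text \<open>\<open>w : \<Delta>\<^sup>n\<^sup>+\<^sup>1 \<rightarrow> X\<close> restricts to the horn \<open>\<Lambda>\<^sup>n\<^sub>n\<^sub>+\<^sub>1 \<rightarrow> X\<close> (all faces but the \<open>n\<close>-th) which is \<open>x\<close> on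
  the faces \<open>0, \<dots>, n - 2\<close>, \<open>f\<close> on the face \<open>n - 1\<close> and \<open>g\<close> on the face \<open>n + 1\<close>; used for \<open>n \<ge> 1\<close>.\<close>

definition horn_filler ::
  "'s sset \<Rightarrow> 's \<Rightarrow> nat \<Rightarrow> (nat \<Rightarrow> nat list \<Rightarrow> 's) \<Rightarrow> (nat \<Rightarrow> nat list \<Rightarrow> 's) \<Rightarrow>
   (nat \<Rightarrow> nat list \<Rightarrow> 's) \<Rightarrow> bool"
where
  "horn_filler X x n f g w \<longleftrightarrow>
     simplicial_map (std_simplex (Suc n)) X w \<and>
     (\<forall>i. i + 1 < n \<longrightarrow> map_face n i w = const_map X x n) \<and>
     map_face n (n - 1) w = f \<and> map_face n (n + 1) w = g"

definition is_composite ::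
  "'s sset \<Rightarrow> 's \<Rightarrow> nat \<Rightarrow> (nat \<Rightarrow> nat list \<Rightarrow> 's) set \<Rightarrow> (nat \<Rightarrow> nat list \<Rightarrow> 's) set \<Rightarrow>
   (nat \<Rightarrow> nat list \<Rightarrow> 's) set \<Rightarrow> bool"
where
  "is_composite X x n p q r \<longleftrightarrow>
     (\<exists>f\<in>p. \<exists>g\<in>q. \<exists>w. horn_filler X x n f g w \<and> r = homotopy_rel X x n `` {map_face n n w})"

definition composite ::
  "'s sset \<Rightarrow> 's \<Rightarrow> nat \<Rightarrow> (nat \<Rightarrow> nat list \<Rightarrow> 's) set \<Rightarrow> (nat \<Rightarrow> nat list \<Rightarrow> 's) set \<Rightarrow>
   (nat \<Rightarrow> nat list \<Rightarrow> 's) set"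
where
  "composite X x n p q = (THE r. is_composite X x n p q r)"

section \<open>The simplicial set HOM(A, B)\<close>

definition HOM ::
  "'a::ab_group_add ainf \<Rightarrow> 'b::ab_group_add ainf \<Rightarrow> (nat set \<Rightarrow> 'a list \<Rightarrow> 'b) sset" where
  "HOM A B = \<lparr>
     simplices = (\<lambda>n. {F. n_morphism A B n F}),
     face = (\<lambda>n i F J. if is_face (n - 1) J then F (coface i ` J) else (\<lambda>_. 0)),
     degen = (\<lambda>n i F J. if is_face (Suc n) J \<and> \<not> {i, Suc i} \<subseteq> J
                         then F (codegen i ` J) else (\<lambda>_. 0))\<rparr>"

text \<open>The component \<open>F\<^sub>\<Delta>\<^sub>n\<close> of the \<open>n\<close>-morphism corresponding to a simplicial map \<open>\<Delta>\<^sup>n \<rightarrow> HOM(A, B)\<close>.\<close>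

definition top_component ::
  "nat \<Rightarrow> (nat \<Rightarrow> nat list \<Rightarrow> nat set \<Rightarrow> 'a list \<Rightarrow> 'b) \<Rightarrow> 'a list \<Rightarrow> 'b" where
  "top_component n f = f n [0..<Suc n] {0..n}"

text \<open>\<open>\<Sum> b (F \<otimes> \<dots> \<otimes> F \<otimes> G \<otimes> F \<otimes> \<dots> \<otimes> F)\<close> with \<open>G\<close> of degree \<open>d\<close>:\<close>

definition one_sum ::
  "'b::ab_group_add ainf \<Rightarrow> ('a list \<Rightarrow> 'b) \<Rightarrow> int \<Rightarrow> ('a list \<Rightarrow> 'b) \<Rightarrow> int list \<Rightarrow> 'a list \<Rightarrow> 'b"
where
  "one_sum B F d G es xs =
     (\<Sum>(is, l, js) \<in> {(is, l, js). 0 \<notin> set (is @ [l] @ js) \<and>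
                          sum_list (is @ [l] @ js) = length xs}.
        after_tensor (ops B)
          (map (\<lambda>i. (0, i, F)) is @ [(d, l, G)] @ map (\<lambda>j. (0, j, F)) js) es xs)"

text \<open>\<open>\<Sum> b (F \<otimes> \<dots> \<otimes> F \<otimes> G \<otimes> F \<otimes> \<dots> \<otimes> F \<otimes> H \<otimes> F \<otimes> \<dots> \<otimes> F)\<close> with \<open>G\<close> and \<open>H\<close> of degree \<open>-1\<close>.
  In a \<open>2\<close>-morphism \<open>G\<close> sits on the edge \<open>01\<close> (the face \<open>n + 1\<close> of \<open>horn_filler\<close>, \<open>n = 1\<close>) and \<open>H\<close> on
  the edge \<open>12\<close> (the face \<open>n - 1\<close>), so \<open>H + G - two_sum\<close> represents the composite of \<open>[H]\<close> with \<open>[G]\<close>,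
  in this order.\<close>

definition two_sum ::
  "'b::ab_group_add ainf \<Rightarrow> ('a list \<Rightarrow> 'b) \<Rightarrow> ('a list \<Rightarrow> 'b) \<Rightarrow> ('a list \<Rightarrow> 'b) \<Rightarrow>
   int list \<Rightarrow> 'a list \<Rightarrow> 'b"
where
  "two_sum B F G H es xs =
     (\<Sum>(is, l1, js, l2, ks) \<in> {(is, l1, js, l2, ks).
          0 \<notin> set (is @ [l1] @ js @ [l2] @ ks) \<and>
          sum_list (is @ [l1] @ js @ [l2] @ ks) = length xs}.
        after_tensor (ops B)
          (map (\<lambda>i. (0, i, F)) is @ [(-1, l1, G)] @ map (\<lambda>j. (0, j, F)) js @
           [(-1, l2, H)] @ map (\<lambda>k. (0, k, F)) ks) es xs)"

definition collections ::
  "'a::ab_group_add ainf \<Rightarrow> 'b::ab_group_add ainf \<Rightarrow> ('a list \<Rightarrow> 'b) \<Rightarrow> nat \<Rightarrow> ('a list \<Rightarrow> 'b) set"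
where
  "collections A B F n = {G.
     multimap (susp (comps A)) (susp (comps B)) (- int n) G \<and>
     (\<forall>es xs. xs \<noteq> [] \<longrightarrow> homog (susp (comps A)) es xs \<longrightarrow>
        with_sign (int n) (pre_sum A G es xs) = one_sum B F (- int n) G es xs)}"

definition coll_rel ::
  "'a::ab_group_add ainf \<Rightarrow> 'b::ab_group_add ainf \<Rightarrow> ('a list \<Rightarrow> 'b) \<Rightarrow> nat \<Rightarrow>
   (('a list \<Rightarrow> 'b) \<times> ('a list \<Rightarrow> 'b)) set"
where
  "coll_rel A B F n = {(F', G'). F' \<in> collections A B F n \<and> G' \<in> collections A B F n \<and>
     (\<exists>H. multimap (susp (comps A)) (susp (comps B)) (- int (n + 1)) H \<and>
        (\<forall>es xs. xs \<noteq> [] \<longrightarrow> homog (susp (comps A)) es xs \<longrightarrow>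
           G' xs - F' xs + with_sign (int (n + 1)) (pre_sum A H es xs)
           = one_sum B F (- int (n + 1)) H es xs))}"

end

theory Submission
  imports Defs
begin

text \<open>
  Call \<open>F\<close> the given morphism and let \<open>D H = \<Sum> b (F \<otimes> \<dots> \<otimes> H \<otimes> \<dots> \<otimes> F) - (-1)\<^sup>d \<Sum> H (id \<otimes> \<dots> \<otimes> b \<otimes> \<dots> \<otimes> id)\<close>
  for a family \<open>H\<close> of degree \<open>d\<close> maps (\<open>defect\<close> below). The collections of the theorem are the
  cycles \<open>D G = 0\<close>, and two of them are equivalent if they differ by some \<open>D H\<close>.

  The link with simplices is a count of overlapping partitions. If a family indexed by the faces of a
  simplex is \<open>F\<close> on vertices and \<open>0\<close> in the dimensions \<open>1, \<dots>, n - 1\<close>, then a partition of a face of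
  dimension \<open>n\<close> or \<open>n + 1\<close> contributes only if one of its parts is the whole face and all other
  parts are copies of the end vertices, because the dimensions of the parts add up to the dimension
  of the face. The only exception is the triangle: for \<open>n = 1\<close> the partitions through its edges \<open>01\<close>
  and \<open>12\<close> contribute as well. So an \<open>n\<close>-simplex of this kind is an \<open>n\<close>-morphism iff its top component
  is a cycle (\<open>n_morphism_low\<close>), and an \<open>(n + 1)\<close>-simplex of this kind with codimension one components
  \<open>w\<^sub>0, \<dots>, w\<^sub>n\<^sub>+\<^sub>1\<close> and top component \<open>H\<close> is an \<open>(n + 1)\<close>-morphism iff all \<open>w\<^sub>j\<close> are cycles and
  \<open>\<Sum> (-1)\<^sup>j w\<^sub>j = D H\<close>, with an additional product \<open>cup w\<^sub>2 w\<^sub>0\<close> on the right for \<open>n = 1\<close>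
  (\<open>n_morphism_top\<close>).

  All parts of the theorem are instances of this equation. A simplicial map from \<open>\<Delta>\<^sup>n\<close> to HOM is
  determined by one \<open>n\<close>-morphism (\<open>yoneda\<close>), so spheres are the same as cycles. A homotopy of spheres
  cuts the prism into \<open>n + 1\<close> simplices whose equations telescope (\<open>coll_rel_of_homotopy\<close>); conversely
  a single \<open>(n + 1)\<close>-simplex with faces \<open>G'\<close>, \<open>G\<close> and \<open>0\<close> is pulled back along a collapse of the prism
  (\<open>homotopy_of_coll_rel\<close>). For a horn filler with faces \<open>f\<close> and \<open>g\<close> the equation says that the
  missing face is \<open>f + g\<close>, respectively \<open>f + g - cup g f\<close>, up to \<open>D H\<close> (\<open>horn_filler_face\<close>), and
  the filler with \<open>H = 0\<close> exists as soon as this expression is a cycle (\<open>horn_filler_exists\<close>).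

  For \<open>n = 1\<close> two algebraic facts remain: \<open>f + g - cup g f\<close> is a cycle, and its class depends only on
  the classes of \<open>f\<close> and \<open>g\<close>. Both follow from a Leibniz rule
  \<open>D (cup g f) = - cup (D g) f - (-1)\<^sup>|\<^sup>g\<^sup>| cup g (D f)\<close> (\<open>defect_product\<close>), which comes from
  computing how a tensor word \<open>\<Sum> F \<otimes> \<dots> \<otimes> g \<otimes> \<dots> \<otimes> f \<otimes> \<dots> \<otimes> F\<close> commutes with the bar differentials and
  then composing with \<open>b\<close>, using \<open>b b = 0\<close>.

  Two devices keep this computation short. Maps \<open>\<Theta>\<close> into the tensor coalgebra are represented by their
  action \<open>\<phi> \<mapsto> \<phi> \<circ> \<Theta>\<close> on multiadditive functions, so that no formal sums of tensors occur. Koszul signs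
  are produced by the involution that is \<open>(-1)\<^sup>e\<close> in degree \<open>e\<close> (\<open>parity\<close>), so that all functions are
  multiadditive on arbitrary lists and no degrees have to be carried along; this also extends the
  product, which is prescribed only on homogeneous elements, to a multilinear map.
\<close>

section \<open>Signs and multiadditive functions\<close>

lemma with_sign_simps [simp]:
  "with_sign 0 x = x" "with_sign 1 x = - x" "with_sign (-1) x = - x" "with_sign k 0 = 0"
  "with_sign (- k) x = with_sign k x"
  by (auto simp: with_sign_def)

lemma with_sign_add: "with_sign k (x + y) = with_sign k x + with_sign k y"
  by (auto simp: with_sign_def)

lemma with_sign_uminus: "with_sign k (- x) = - with_sign k x"
  by (auto simp: with_sign_def)

lemma with_sign_diff: "with_sign k (x - y) = with_sign k x - with_sign k y"
  by (auto simp: with_sign_def)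

lemma with_sign_with_sign [simp]: "with_sign k (with_sign l x) = with_sign (k + l) x"
  by (auto simp: with_sign_def)

lemma with_sign_self [simp]: "with_sign (k + k) x = x"
  by (auto simp: with_sign_def)

lemma with_sign_even [simp]:
  "with_sign (k * 2) x = x" "with_sign (2 * k) x = x" "with_sign (k * 2 + l * 2) x = x"
  by (auto simp: with_sign_def)

lemma with_sign_succ: "with_sign (k + 1) x = - with_sign k x"
  by (auto simp: with_sign_def)

lemma with_sign_cong_parity: "even k = even l \<Longrightarrow> with_sign k x = with_sign l x"
  by (auto simp: with_sign_def)

definition additive :: "('a::ab_group_add \<Rightarrow> 'b::ab_group_add) \<Rightarrow> bool" where
  "additive f \<longleftrightarrow> (\<forall>x y. f (x + y) = f x + f y)"

lemma additiveD: "additive f \<Longrightarrow> f (x + y) = f x + f y"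
  by (simp add: additive_def)

lemma additive_zero: "additive f \<Longrightarrow> f 0 = 0"
  by (metis add_cancel_right_right additive_def)

lemma additive_uminus: "additive f \<Longrightarrow> f (- x) = - f x"
  by (metis add.right_inverse add_eq_0_iff additiveD additive_zero)

lemma additive_with_sign: "additive f \<Longrightarrow> f (with_sign k x) = with_sign k (f x)"
  by (simp add: with_sign_def additive_uminus)

lemma additive_sum: "additive f \<Longrightarrow> f (sum g S) = (\<Sum>i\<in>S. f (g i))"
  by (induction S rule: infinite_finite_induct) (auto simp: additive_zero additiveD)

text \<open>
  Additivity in every entry, for all lengths at once: the linearity clause of \<open>multimap\<close>.
\<close>

definition multiadditive :: "('a::ab_group_add list \<Rightarrow> 'b::ab_group_add) \<Rightarrow> bool" where
  "multiadditive f \<longleftrightarrow> (\<forall>us vs x y. f (us @ (x + y) # vs) = f (us @ x # vs) + f (us @ y # vs))"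

lemma multiadditive_slot: "multiadditive f \<Longrightarrow> additive (\<lambda>x. f (us @ x # vs))"
  by (simp add: multiadditive_def additive_def)

lemma multiadditive_head: "multiadditive f \<Longrightarrow> additive (\<lambda>x. f (x # vs))"
  using multiadditive_slot[of f "[]"] by simp

lemma multiadditive_Cons: "multiadditive f \<Longrightarrow> multiadditive (\<lambda>xs. f (x # xs))"
  by (simp add: multiadditive_def flip: append_Cons)

lemma multiadditive_zero: "multiadditive (\<lambda>_. 0)"
  by (simp add: multiadditive_def)

lemma multiadditive_add:
  "multiadditive f \<Longrightarrow> multiadditive g \<Longrightarrow> multiadditive (\<lambda>xs. f xs + g xs)"
  by (simp add: multiadditive_def algebra_simps)

lemma multiadditive_uminus: "multiadditive f \<Longrightarrow> multiadditive (\<lambda>xs. - f xs)"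
  by (simp add: multiadditive_def)

lemma multiadditive_diff:
  "multiadditive f \<Longrightarrow> multiadditive g \<Longrightarrow> multiadditive (\<lambda>xs. f xs - g xs)"
  by (simp add: multiadditive_def algebra_simps)

lemma multiadditive_with_sign: "multiadditive f \<Longrightarrow> multiadditive (\<lambda>xs. with_sign k (f xs))"
  by (simp add: multiadditive_def with_sign_add)

lemma multiadditive_map: "multiadditive f \<Longrightarrow> additive s \<Longrightarrow> multiadditive (\<lambda>xs. f (map s xs))"
  by (simp add: multiadditive_def additive_def)

lemma multiadditive_comp: "additive h \<Longrightarrow> multiadditive f \<Longrightarrow> multiadditive (\<lambda>xs. h (f xs))"
  by (simp add: multiadditive_def additive_def)

section \<open>Sums over splittings of a list\<close>

text \<open>
  The sum of \<open>f us vs\<close> over all splittings \<open>us @ vs = xs\<close>, and (\<open>cut_sum\<close>) the same with \<open>us\<close> nonempty: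
  the deconcatenation coproduct, full and reduced on the left, composed with \<open>f\<close>. Recursion on \<open>xs\<close>
  makes coassociativity a routine induction.
\<close>

fun split_sum :: "('a list \<Rightarrow> 'a list \<Rightarrow> 'c::ab_group_add) \<Rightarrow> 'a list \<Rightarrow> 'c" where
  "split_sum f [] = f [] []"
| "split_sum f (x # xs) = f [] (x # xs) + split_sum (\<lambda>us vs. f (x # us) vs) xs"

fun cut_sum :: "('a list \<Rightarrow> 'a list \<Rightarrow> 'c::ab_group_add) \<Rightarrow> 'a list \<Rightarrow> 'c" where
  "cut_sum f [] = 0"
| "cut_sum f (x # xs) = split_sum (\<lambda>us vs. f (x # us) vs) xs"

lemma split_sum_eq_cut_sum: "split_sum f xs = f [] xs + cut_sum f xs"
  by (cases xs) auto

lemma split_sum_cong [fundef_cong]: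
  assumes "xs = ys" "\<And>us vs. us @ vs = ys \<Longrightarrow> f us vs = g us vs"
  shows "split_sum f xs = split_sum g ys"
  unfolding assms(1) using assms(2)
proof (induction ys arbitrary: f g)
  case (Cons y ys)
  have "split_sum (\<lambda>us. f (y # us)) ys = split_sum (\<lambda>us. g (y # us)) ys"
    by (rule Cons.IH) (simp add: Cons.prems)
  then show ?case by (simp add: Cons.prems)
qed auto

lemma cut_sum_cong:
  assumes "\<And>us vs. us @ vs = xs \<Longrightarrow> us \<noteq> [] \<Longrightarrow> f us vs = g us vs"
  shows "cut_sum f xs = cut_sum g xs"
  using assms by (cases xs) (auto intro: split_sum_cong)

lemma split_sum_zero [simp]: "split_sum (\<lambda>_ _. 0) xs = 0"
  by (induction xs) auto

lemma cut_sum_zero [simp]: "cut_sum (\<lambda>_ _. 0) xs = 0"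
  by (cases xs) auto

lemma split_sum_add: "split_sum (\<lambda>us vs. f us vs + g us vs) xs = split_sum f xs + split_sum g xs"
  by (induction xs arbitrary: f g) (auto simp: algebra_simps)

lemma cut_sum_add: "cut_sum (\<lambda>us vs. f us vs + g us vs) xs = cut_sum f xs + cut_sum g xs"
  by (cases xs) (auto simp: split_sum_add)

lemma split_sum_additive: "additive h \<Longrightarrow> split_sum (\<lambda>us vs. h (f us vs)) xs = h (split_sum f xs)"
  by (induction xs arbitrary: f) (auto simp: additiveD)

lemma cut_sum_additive: "additive h \<Longrightarrow> cut_sum (\<lambda>us vs. h (f us vs)) xs = h (cut_sum f xs)"
  by (cases xs) (auto simp: split_sum_additive[of h] additive_zero)

lemma additive_neg: "additive uminus"
  by (simp add: additive_def)

lemma additive_sign: "additive (with_sign k)"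
  by (simp add: additive_def with_sign_add)

lemmas cut_sum_with_sign = cut_sum_additive[OF additive_sign]

lemma split_sum_map: "split_sum f (map s xs) = split_sum (\<lambda>us vs. f (map s us) (map s vs)) xs"
  by (induction xs arbitrary: f) auto

lemma cut_sum_map: "cut_sum f (map s xs) = cut_sum (\<lambda>us vs. f (map s us) (map s vs)) xs"
  by (cases xs) (auto simp: split_sum_map)

lemma split_sum_coassoc:
  "split_sum (\<lambda>us vs. split_sum (h us) vs) xs
   = split_sum (\<lambda>us ws. split_sum (\<lambda>us vs. h us vs ws) us) xs"
  by (induction xs arbitrary: h) (auto simp: split_sum_add algebra_simps)

lemma cut_sum_coassoc:
  "cut_sum (\<lambda>us vs. split_sum (h us) vs) xs
   = cut_sum (\<lambda>us ws. cut_sum (\<lambda>us vs. h us vs ws) us) xs"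
  by (cases xs) (auto simp: split_sum_coassoc)

lemma split_sum_swap:
  "split_sum (\<lambda>us vs. split_sum (\<lambda>p r. h us vs p r) ys) xs
   = split_sum (\<lambda>p r. split_sum (\<lambda>us vs. h us vs p r) xs) ys"
proof (induction xs arbitrary: h)
  case (Cons x xs)
  show ?case
    unfolding split_sum.simps(2)[of _ x xs] split_sum_add Cons.IH ..
qed simp

lemma split_cut_sum_swap:
  "cut_sum (\<lambda>us vs. split_sum (\<lambda>p r. h us vs p r) ys) xs
   = split_sum (\<lambda>p r. cut_sum (\<lambda>us vs. h us vs p r) xs) ys"
proof (cases xs)
  case (Cons x xs')
  show ?thesis
    unfolding Cons cut_sum.simps(2) by (rule split_sum_swap)
qed simp

lemma cut_sum_eq_sum:
  fixes f :: "'a list \<Rightarrow> 'a list \<Rightarrow> 'b::ab_group_add"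
  shows "cut_sum f xs = (\<Sum>i=1..length xs. f (take i xs) (drop i xs))"
proof -
  have *: "split_sum f xs = (\<Sum>i\<le>length xs. f (take i xs) (drop i xs))" for f :: "'a list \<Rightarrow> 'a list \<Rightarrow> 'b" and xs
    by (induction xs arbitrary: f) (auto simp: sum.atMost_Suc_shift simp del: sum.atMost_Suc)
  have "(\<Sum>i\<le>length xs. f (take i xs) (drop i xs)) = f [] xs + (\<Sum>i=1..length xs. f (take i xs) (drop i xs))"
    by (simp add: atMost_atLeast0 sum.atLeast_Suc_atMost)
  then show ?thesis
    using split_sum_eq_cut_sum[of f xs] *[of f xs] by simp
qed

lemma split_sum_slot:
  assumes "\<And>vs. multiadditive (\<lambda>us. f us vs)" "\<And>us. multiadditive (f us)"
  shows "multiadditive (split_sum f)"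
proof -
  have "split_sum f (us @ (x + y) # vs) = split_sum f (us @ x # vs) + split_sum f (us @ y # vs)" for us vs x y
    using assms
  proof (induction us arbitrary: f)
    case Nil
    have "f [] ((x + y) # vs) = f [] (x # vs) + f [] (y # vs)"
      using additiveD[OF multiadditive_head[OF Nil(2)]] .
    moreover have "f ((x + y) # us) = (\<lambda>ws. f (x # us) ws + f (y # us) ws)" for us
      using additiveD[OF multiadditive_head[OF Nil(1)]] by (rule ext)
    ultimately show ?case by (simp add: split_sum_add algebra_simps)
  next
    case (Cons u us)
    have "f [] ((u # us) @ (x + y) # vs) = f [] ((u # us) @ x # vs) + f [] ((u # us) @ y # vs)"
      using additiveD[OF multiadditive_slot[OF Cons(3)]] .
    moreover have "split_sum (\<lambda>us. f (u # us)) (us @ (x + y) # vs)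
      = split_sum (\<lambda>us. f (u # us)) (us @ x # vs) + split_sum (\<lambda>us. f (u # us)) (us @ y # vs)"
      by (rule Cons.IH) (use Cons.prems multiadditive_Cons in blast)+
    ultimately show ?case by (simp add: algebra_simps)
  qed
  then show ?thesis by (simp add: multiadditive_def)
qed

section \<open>Tensor words with insertions and the bar differential\<close>

text \<open>
  For \<open>s\<close> the parity involution this is the sign \<open>(-1)\<^bsup>k |us|\<^esup>\<close>, spread over the entries of \<open>us\<close>.
\<close>

definition twist :: "('a \<Rightarrow> 'a) \<Rightarrow> int \<Rightarrow> 'a list \<Rightarrow> 'a list" where
  "twist s k us = (if even k then us else map s us)"

lemma twist_Nil [simp]: "twist s k [] = []"
  by (simp add: twist_def)

lemma twist_0 [simp]: "twist s 0 xs = xs"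
  by (simp add: twist_def)

lemma twist_eq_Nil [simp]: "twist s k us = [] \<longleftrightarrow> us = []"
  by (simp add: twist_def)

lemma cut_sum_twist: "cut_sum f (twist s k xs) = cut_sum (\<lambda>us vs. f (twist s k us) (twist s k vs)) xs"
  by (simp add: twist_def cut_sum_map)

abbreviation deg_sum :: "(int \<times> 'f) list \<Rightarrow> int" where
  "deg_sum gs \<equiv> sum_list (map fst gs)"

text \<open>
  \<open>spread s F [(d\<^sub>1, g\<^sub>1), \<dots>, (d\<^sub>r, g\<^sub>r)] \<phi> xs\<close> is
  \<open>\<Sum> \<phi> (F \<otimes> \<dots> \<otimes> F \<otimes> g\<^sub>1 \<otimes> F \<otimes> \<dots> \<otimes> F \<otimes> g\<^sub>r \<otimes> F \<otimes> \<dots> \<otimes> F) xs\<close>, the sum over all decompositions of \<open>xs\<close> into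
  nonempty blocks. The first block goes to \<open>F\<close> or to \<open>g\<^sub>1\<close>, and it is twisted by the degree of the
  maps to its right, as the Koszul rule demands.
\<close>

function spread :: "('a \<Rightarrow> 'a) \<Rightarrow> ('a list \<Rightarrow> 'b) \<Rightarrow> (int \<times> ('a list \<Rightarrow> 'b)) list
    \<Rightarrow> ('b list \<Rightarrow> 'c::ab_group_add) \<Rightarrow> 'a list \<Rightarrow> 'c" where
  "spread s F gs \<phi> [] = (if gs = [] then \<phi> [] else 0)"
| "spread s F gs \<phi> (x # xs) =
     split_sum (\<lambda>us vs.
       spread s F gs (\<lambda>ys. \<phi> (F (twist s (deg_sum gs) (x # us)) # ys)) vs
       + (case gs of [] \<Rightarrow> 0 | c # gs' \<Rightarrow>
            spread s F gs' (\<lambda>ys. \<phi> (snd c (twist s (deg_sum gs') (x # us)) # ys)) vs)) xs"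
  by pat_completeness auto
termination
  by (relation "measure (\<lambda>(s, F, gs, \<phi>, xs). length xs)") auto

text \<open>
  Both defining equations in one: for the empty list the sum over nonempty first blocks vanishes.
\<close>

lemma spread_rec:
  "spread s F gs \<phi> xs = (if gs = [] \<and> xs = [] then \<phi> [] else 0) +
     cut_sum (\<lambda>us vs.
       spread s F gs (\<lambda>ys. \<phi> (F (twist s (deg_sum gs) us) # ys)) vs
       + (case gs of [] \<Rightarrow> 0 | c # gs' \<Rightarrow>
            spread s F gs' (\<lambda>ys. \<phi> (snd c (twist s (deg_sum gs') us) # ys)) vs)) xs"
  by (cases xs) auto

lemma spread_add:
  fixes \<phi> \<psi> :: "'b list \<Rightarrow> 'c::ab_group_add" and F :: "'a list \<Rightarrow> 'b"
  shows "spread s F gs (\<lambda>ys. \<phi> ys + \<psi> ys) xs = spread s F gs \<phi> xs + spread s F gs \<psi> xs"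
proof (induction xs arbitrary: gs \<phi> \<psi> rule: length_induct)
  case (1 xs)
  show ?case
  proof (cases xs)
    case (Cons x xs')
    have IH: "spread s F gs (\<lambda>ys. \<phi> ys + \<psi> ys) vs = spread s F gs \<phi> vs + spread s F gs \<psi> vs"
      if "length vs \<le> length xs'" for gs vs and \<phi> \<psi> :: "'b list \<Rightarrow> 'c"
      using 1 that by (simp add: Cons)
    show ?thesis
      unfolding Cons spread.simps split_sum_add[symmetric]
      by (rule split_sum_cong[OF refl]) (auto simp: IH algebra_simps split: list.splits)
  qed auto
qed

lemma spread_zero: "spread s F gs (\<lambda>_. 0) xs = 0"
  using spread_add[of s F gs "\<lambda>_. 0" "\<lambda>_. 0" xs] by simp

lemma spread_additive:
  fixes \<phi> :: "'b list \<Rightarrow> 'c::ab_group_add" and F :: "'a list \<Rightarrow> 'b" and h :: "'c \<Rightarrow> 'd::ab_group_add"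
  assumes "additive h"
  shows "spread s F gs (\<lambda>ys. h (\<phi> ys)) xs = h (spread s F gs \<phi> xs)"
proof (induction xs arbitrary: gs \<phi> rule: length_induct)
  case (1 xs)
  show ?case
  proof (cases xs)
    case Nil then show ?thesis by (simp add: additive_zero assms)
  next
    case (Cons x xs')
    have IH: "spread s F gs (\<lambda>ys. h (\<phi> ys)) vs = h (spread s F gs \<phi> vs)"
      if "length vs \<le> length xs'" for gs vs and \<phi> :: "'b list \<Rightarrow> 'c"
      using 1 that by (simp add: Cons)
    show ?thesis
      unfolding Cons spread.simps split_sum_additive[OF assms, symmetric]
      by (rule split_sum_cong[OF refl])
        (auto simp: IH additiveD[OF assms] additive_zero[OF assms] split: list.splits)
  qed
qed

lemmas spread_with_sign = spread_additive[OF additive_sign]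
lemmas spread_uminus = spread_additive[OF additive_neg]

text \<open>
  Tensor words are compatible with coproducts: splitting the output between two blocks splits the
  input \<open>xs\<close> and the list \<open>gs\<close> of insertions. The maps in the right half move past the inputs of the left
  half, whence the twist. Splitting before the first output block gives the terms with empty \<open>us\<close>.
\<close>

lemma spread_split_sum:
  fixes \<psi> :: "'b list \<Rightarrow> 'b list \<Rightarrow> 'c::ab_group_add" and F :: "'a list \<Rightarrow> 'b"
  assumes s: "\<And>x. s (s x) = x"
  shows "spread s F gs (split_sum \<psi>) xs
    = split_sum (\<lambda>p r. split_sum (\<lambda>us vs.
        spread s F p (\<lambda>as. spread s F r (\<psi> as) vs) (twist s (deg_sum r) us)) xs) gs"
proof (induction xs arbitrary: gs \<psi> rule: length_induct)
  case (1 xs)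
  have tw: "twist s k (twist s l us) = twist s (k + l) us" for k l us
    by (auto simp: twist_def s map_idI)
  define X :: "(int \<times> ('a list \<Rightarrow> 'b)) list \<Rightarrow> (int \<times> ('a list \<Rightarrow> 'b)) list \<Rightarrow> 'a list \<Rightarrow> 'a list \<Rightarrow> 'c"
    where "X = (\<lambda>p r us vs. cut_sum (\<lambda>u1 u2.
      spread s F p (\<lambda>as. spread s F r (\<psi> (F (twist s (deg_sum p + deg_sum r) u1) # as)) vs)
        (twist s (deg_sum r) u2)) us)"
  define Y :: "int \<times> ('a list \<Rightarrow> 'b) \<Rightarrow> (int \<times> ('a list \<Rightarrow> 'b)) list \<Rightarrow> (int \<times> ('a list \<Rightarrow> 'b)) list \<Rightarrow> 'a list \<Rightarrow> 'a list \<Rightarrow> 'c"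
    where "Y = (\<lambda>c p' r us vs. cut_sum (\<lambda>u1 u2.
      spread s F p' (\<lambda>as. spread s F r (\<psi> (snd c (twist s (deg_sum p' + deg_sum r) u1) # as)) vs)
        (twist s (deg_sum r) u2)) us)"
  have nil: "split_sum (\<lambda>p r. spread s F p (\<lambda>as. spread s F r (\<psi> as) xs) []) gs = spread s F gs (\<psi> []) xs"
    by (cases gs) auto
  have sp: "spread s F p (\<lambda>as. spread s F r (\<psi> as) vs) (twist s (deg_sum r) us)
      = X p r us vs + (case p of [] \<Rightarrow> 0 | c # p' \<Rightarrow> Y c p' r us vs)" if "us \<noteq> []" for p r us vs
    unfolding X_def Y_def
    by (subst spread_rec) (use that in \<open>auto simp: cut_sum_twist tw cut_sum_add split: list.splits\<close>)
  have Ysum: "split_sum (\<lambda>p r. cut_sum (\<lambda>us vs. (case p of [] \<Rightarrow> 0 | c # p' \<Rightarrow> Y c p' r us vs)) xs) gs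
     = (case gs of [] \<Rightarrow> 0 | c # gs' \<Rightarrow> split_sum (\<lambda>p r. cut_sum (\<lambda>us vs. Y c p r us vs) xs) gs')"
    by (cases gs) auto
  have rhs: "split_sum (\<lambda>p r. split_sum (\<lambda>us vs.
        spread s F p (\<lambda>as. spread s F r (\<psi> as) vs) (twist s (deg_sum r) us)) xs) gs
     = spread s F gs (\<psi> []) xs + split_sum (\<lambda>p r. cut_sum (\<lambda>us vs. X p r us vs) xs) gs
       + (case gs of [] \<Rightarrow> 0 | c # gs' \<Rightarrow> split_sum (\<lambda>p r. cut_sum (\<lambda>us vs. Y c p r us vs) xs) gs')"
  proof -
    have "split_sum (\<lambda>us vs.
        spread s F p (\<lambda>as. spread s F r (\<psi> as) vs) (twist s (deg_sum r) us)) xs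
      = spread s F p (\<lambda>as. spread s F r (\<psi> as) xs) [] + cut_sum (\<lambda>us vs. X p r us vs) xs
        + cut_sum (\<lambda>us vs. (case p of [] \<Rightarrow> 0 | c # p' \<Rightarrow> Y c p' r us vs)) xs" for p r
    proof -
      have "cut_sum (\<lambda>us vs.
        spread s F p (\<lambda>as. spread s F r (\<psi> as) vs) (twist s (deg_sum r) us)) xs
       = cut_sum (\<lambda>us vs. X p r us vs + (case p of [] \<Rightarrow> 0 | c # p' \<Rightarrow> Y c p' r us vs)) xs"
        by (rule cut_sum_cong) (simp add: sp)
      then show ?thesis
        by (simp add: split_sum_eq_cut_sum cut_sum_add)
    qed
    then show ?thesis
      by (simp only: split_sum_add nil Ysum)
  qed
  have IH: "spread s F gs (split_sum \<psi>) vs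
    = split_sum (\<lambda>p r. split_sum (\<lambda>us vs.
        spread s F p (\<lambda>as. spread s F r (\<psi> as) vs) (twist s (deg_sum r) us)) vs) gs"
    if "length vs < length xs" for gs vs and \<psi> :: "'b list \<Rightarrow> 'b list \<Rightarrow> 'c"
    using 1 that by blast
  have gsd: "split_sum (\<lambda>p r. f (deg_sum gs) p r) gs = split_sum (\<lambda>p r. f (deg_sum p + deg_sum r) p r) gs"
    for f :: "int \<Rightarrow> (int \<times> ('a list \<Rightarrow> 'b)) list \<Rightarrow> (int \<times> ('a list \<Rightarrow> 'b)) list \<Rightarrow> 'c" and gs
    by (rule split_sum_cong[OF refl]) auto
  have lhs1: "cut_sum (\<lambda>us vs. spread s F gs (\<lambda>ys. split_sum (\<lambda>as. \<psi> (F (twist s (deg_sum gs) us) # as)) ys) vs) xs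
     = split_sum (\<lambda>p r. cut_sum (\<lambda>us vs. X p r us vs) xs) gs"
  proof -
    have "cut_sum (\<lambda>us vs. spread s F gs (\<lambda>ys. split_sum (\<lambda>as. \<psi> (F (twist s (deg_sum gs) us) # as)) ys) vs) xs
      = cut_sum (\<lambda>us vs. split_sum (\<lambda>p r. split_sum (\<lambda>v1 v2.
        spread s F p (\<lambda>as. spread s F r (\<psi> (F (twist s (deg_sum gs) us) # as)) v2) (twist s (deg_sum r) v1)) vs) gs) xs"
      by (rule cut_sum_cong, rule IH) auto
    also have "\<dots> = split_sum (\<lambda>p r. cut_sum (\<lambda>us vs. split_sum (\<lambda>v1 v2.
        spread s F p (\<lambda>as. spread s F r (\<psi> (F (twist s (deg_sum gs) us) # as)) v2) (twist s (deg_sum r) v1)) vs) xs) gs"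
      by (rule split_cut_sum_swap)
    also have "\<dots> = split_sum (\<lambda>p r. cut_sum (\<lambda>us vs. X p r us vs) xs) gs"
      unfolding cut_sum_coassoc X_def by (rule gsd)
    finally show ?thesis .
  qed
  have lhs2: "cut_sum (\<lambda>us vs. spread s F gs' (\<lambda>ys. split_sum (\<lambda>as. \<psi> (snd c (twist s (deg_sum gs') us) # as)) ys) vs) xs
     = split_sum (\<lambda>p r. cut_sum (\<lambda>us vs. Y c p r us vs) xs) gs'" for c gs'
  proof -
    have "cut_sum (\<lambda>us vs. spread s F gs' (\<lambda>ys. split_sum (\<lambda>as. \<psi> (snd c (twist s (deg_sum gs') us) # as)) ys) vs) xs
      = cut_sum (\<lambda>us vs. split_sum (\<lambda>p r. split_sum (\<lambda>v1 v2.
        spread s F p (\<lambda>as. spread s F r (\<psi> (snd c (twist s (deg_sum gs') us) # as)) v2) (twist s (deg_sum r) v1)) vs) gs') xs"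
      by (rule cut_sum_cong, rule IH) auto
    also have "\<dots> = split_sum (\<lambda>p r. cut_sum (\<lambda>us vs. split_sum (\<lambda>v1 v2.
        spread s F p (\<lambda>as. spread s F r (\<psi> (snd c (twist s (deg_sum gs') us) # as)) v2) (twist s (deg_sum r) v1)) vs) xs) gs'"
      by (rule split_cut_sum_swap)
    also have "\<dots> = split_sum (\<lambda>p r. cut_sum (\<lambda>us vs. Y c p r us vs) xs) gs'"
      unfolding cut_sum_coassoc Y_def by (rule gsd)
    finally show ?thesis .
  qed
  have "spread s F gs (split_sum \<psi>) xs = spread s F gs (\<psi> []) xs
      + cut_sum (\<lambda>us vs. spread s F gs (\<lambda>ys. split_sum (\<lambda>as. \<psi> (F (twist s (deg_sum gs) us) # as)) ys) vs) xs
      + (case gs of [] \<Rightarrow> 0 | c # gs' \<Rightarrow>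
         cut_sum (\<lambda>us vs. spread s F gs' (\<lambda>ys. split_sum (\<lambda>as. \<psi> (snd c (twist s (deg_sum gs') us) # as)) ys) vs) xs)"
    unfolding spread_rec[of s F gs "split_sum \<psi>" xs] spread_rec[of s F gs "\<psi> []" xs]
    by (cases gs) (simp_all add: spread_add cut_sum_add algebra_simps)
  then show ?case
    unfolding rhs lhs1 lhs2 .
qed

text \<open>
  \<open>\<Sum> \<phi> (id \<otimes> \<dots> \<otimes> b \<otimes> \<dots> \<otimes> id)\<close>: the codifferential of the bar construction, acting on functions.
  Moving the degree one map \<open>b\<close> past \<open>x\<close> costs the sign \<open>s x\<close>.
\<close>

fun bar :: "('a \<Rightarrow> 'a) \<Rightarrow> ('a list \<Rightarrow> 'a) \<Rightarrow> ('a list \<Rightarrow> 'c::ab_group_add) \<Rightarrow> 'a list \<Rightarrow> 'c" where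
  "bar s b \<phi> [] = 0"
| "bar s b \<phi> (x # xs) =
     split_sum (\<lambda>us vs. \<phi> (b (x # us) # vs)) xs + bar s b (\<lambda>ys. \<phi> (s x # ys)) xs"

lemma bar_add: "bar s b (\<lambda>ys. \<phi> ys + \<psi> ys) xs = bar s b \<phi> xs + bar s b \<psi> xs"
  by (induction xs arbitrary: \<phi> \<psi>) (auto simp: split_sum_add algebra_simps)

lemma bar_zero: "bar s b (\<lambda>_. 0) xs = 0"
  using bar_add[of s b "\<lambda>_. 0" "\<lambda>_. 0" xs] by simp

lemma bar_additive:
  assumes "additive h" shows "bar s b (\<lambda>ys. h (\<phi> ys)) xs = h (bar s b \<phi> xs)"
  by (induction xs arbitrary: \<phi>)
    (auto simp: split_sum_additive[OF assms] additiveD[OF assms] additive_zero[OF assms])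

lemmas bar_with_sign = bar_additive[OF additive_sign]
lemmas bar_uminus = bar_additive[OF additive_neg]

lemma bar_cong: "(\<And>ys. ys \<noteq> [] \<Longrightarrow> \<phi> ys = \<psi> ys) \<Longrightarrow> bar s b \<phi> xs = bar s b \<psi> xs"
  by (cases xs) (auto intro!: arg_cong2[where f="(+)"] split_sum_cong arg_cong[where f="\<lambda>f. bar s b f _"])

text \<open>
  The bar differential is a coderivation.
\<close>

lemma bar_split_sum:
  "bar s b (split_sum \<psi>) xs
   = split_sum (\<lambda>us vs. bar s b (\<lambda>us'. \<psi> us' vs) us + bar s b (\<psi> (map s us)) vs) xs"
proof (induction xs arbitrary: \<psi>)
  case (Cons x xs)
  have "bar s b (split_sum \<psi>) (x # xs)
    = split_sum (\<lambda>us vs. \<psi> [] (b (x # us) # vs)) xs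
      + split_sum (\<lambda>us vs. split_sum (\<lambda>as. \<psi> (b (x # us) # as)) vs) xs
      + bar s b (\<lambda>ys. \<psi> [] (s x # ys)) xs + bar s b (split_sum (\<lambda>us. \<psi> (s x # us))) xs"
    by (simp add: split_sum_add bar_add)
  also have "\<dots> = bar s b (\<psi> []) (x # xs)
     + split_sum (\<lambda>us vs. split_sum (\<lambda>us vs'. \<psi> (b (x # us) # vs') vs) us) xs
     + split_sum (\<lambda>us vs. bar s b (\<lambda>us'. \<psi> (s x # us') vs) us + bar s b (\<psi> (s x # map s us)) vs) xs"
    by (simp add: Cons.IH split_sum_coassoc algebra_simps)
  finally show ?case
    by (simp add: split_sum_add algebra_simps)
qed simp

lemma bar_cut_sum:
  fixes s :: "'a \<Rightarrow> 'a" and \<psi> :: "'a list \<Rightarrow> 'a list \<Rightarrow> 'c::ab_group_add"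
  shows "bar s b (cut_sum \<psi>) xs
   = cut_sum (\<lambda>us vs. bar s b (\<lambda>us'. \<psi> us' vs) us + bar s b (\<psi> (map s us)) vs) xs"
proof -
  \<comment> \<open>The reduced sum as a full one: \<open>b\<close> turns nonempty pieces into nonempty pieces.\<close>
  define \<psi>' :: "'a list \<Rightarrow> 'a list \<Rightarrow> 'c" where "\<psi>' = (\<lambda>us vs. if us = [] then 0 else \<psi> us vs)"
  have *: "cut_sum \<psi> = split_sum \<psi>'"
  proof
    show "cut_sum \<psi> ys = split_sum \<psi>' ys" for ys
      by (cases ys) (auto simp: \<psi>'_def)
  qed
  have "bar s b (cut_sum \<psi>) xs
     = cut_sum (\<lambda>us vs. bar s b (\<lambda>us'. \<psi>' us' vs) us + bar s b (\<psi>' (map s us)) vs) xs"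
    unfolding * bar_split_sum unfolding split_sum_eq_cut_sum by (simp add: \<psi>'_def bar_zero)
  also have "\<dots> = cut_sum (\<lambda>us vs. bar s b (\<lambda>us'. \<psi> us' vs) us + bar s b (\<psi> (map s us)) vs) xs"
  proof (rule cut_sum_cong)
    fix us vs :: "'a list" assume "us \<noteq> []"
    have "bar s b (\<lambda>us'. \<psi>' us' vs) us = bar s b (\<lambda>us'. \<psi> us' vs) us"
      by (rule bar_cong) (simp add: \<psi>'_def)
    moreover have "\<psi>' (map s us) = \<psi> (map s us)"
      using \<open>us \<noteq> []\<close> by (auto simp: \<psi>'_def)
    ultimately show "bar s b (\<lambda>us'. \<psi>' us' vs) us + bar s b (\<psi>' (map s us)) vs
       = bar s b (\<lambda>us'. \<psi> us' vs) us + bar s b (\<psi> (map s us)) vs" by simp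
  qed
  finally show ?thesis .
qed

section \<open>The Leibniz rule for products of insertions\<close>

lemma spread_with_sign_fun:
  "spread s F gs (\<lambda>ys. with_sign k (\<phi> ys)) = (\<lambda>xs. with_sign k (spread s F gs \<phi> xs))"
  by (rule ext) (rule spread_with_sign)

lemma bar_spread_swap:
  "bar s b (\<lambda>us'. spread s' F gs (f us') vs) us = spread s' F gs (\<lambda>ys. bar s b (\<lambda>us'. f us' ys) us) vs"
proof (induction us arbitrary: f)
  case (Cons x us)
  have *: "split_sum (\<lambda>us ws. spread s' F gs (h us ws) vs) xs
      = spread s' F gs (\<lambda>ys. split_sum (\<lambda>us ws. h us ws ys) xs) vs" for h xs
    by (induction xs arbitrary: h) (auto simp: spread_add)
  show ?case by (simp add: spread_add Cons.IH *)
qed (simp add: spread_zero)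

text \<open>
  The induction is on a bound for the length of the list. Truncating at that length keeps the induction
  hypothesis a statement about functions on all lists, to which \<open>split_sum_slot\<close> applies.
\<close>

lemma spread_multiadditive:
  fixes \<phi> :: "'b::ab_group_add list \<Rightarrow> 'c::ab_group_add" and s :: "'a::ab_group_add \<Rightarrow> 'a"
  assumes additive_s: "additive s" and F_multiadditive: "multiadditive F"
    and \<phi>: "multiadditive \<phi>" and gs: "\<forall>c\<in>set gs. multiadditive (snd c)"
  shows "multiadditive (spread s F gs \<phi>)"
proof -
  have tw: "multiadditive (\<lambda>us. f (twist s k us))" if "multiadditive f" for f :: "'a list \<Rightarrow> 'b" and k
    using that multiadditive_map[OF that additive_s] by (cases "even k") (simp_all add: twist_def)
  have *: "multiadditive (\<lambda>xs. if length xs > n then 0 else spread s F gs \<phi> xs)"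
    if "multiadditive \<phi>" "\<forall>c\<in>set gs. multiadditive (snd c)"
    for n gs and \<phi> :: "'b list \<Rightarrow> 'c"
    using that
  proof (induction n arbitrary: gs \<phi>)
    case 0
    then show ?case by (simp add: multiadditive_def)
  next
    case (Suc n)
    have head: "additive (\<lambda>x. \<phi> (x # ys))" for ys
      using multiadditive_head[OF Suc.prems(1)] .
    \<comment> \<open>The terms of the recursion, cut off at the length where the induction hypothesis ends.\<close>
    define X where "X = (\<lambda>gs f k us vs. if us = [] \<or> length vs > n then 0
       else spread s F gs (\<lambda>ys. \<phi> (f (twist s k us) # ys)) vs)"
    have X: "multiadditive (split_sum (X gs f k))"
      if "multiadditive f" "\<forall>c\<in>set gs. multiadditive (snd c)" for gs f k
    proof (rule split_sum_slot)
      have "additive (\<lambda>x. spread s F gs (\<lambda>ys. \<phi> (x # ys)) vs)" for vs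
        by (simp add: additive_def additiveD[OF head] spread_add)
      from multiadditive_comp[OF this tw[OF that(1)]] show "multiadditive (\<lambda>us. X gs f k us vs)" for vs
        by (simp add: X_def multiadditive_def)
      show "multiadditive (X gs f k us)" for us
        using Suc.IH[OF multiadditive_Cons[OF Suc.prems(1)] that(2), of "f (twist s k us)"]
        by (cases "us = []") (simp_all add: X_def[abs_def] multiadditive_zero)
    qed
    have eq: "spread s F gs \<phi> xs = split_sum (X gs F (deg_sum gs)) xs
       + (case gs of [] \<Rightarrow> 0 | c # gs' \<Rightarrow> split_sum (X gs' (snd c) (deg_sum gs')) xs)"
      if "xs \<noteq> []" "length xs \<le> Suc n" for xs
    proof -
      have "split_sum (X g f k) xs = cut_sum (\<lambda>us vs. spread s F g (\<lambda>ys. \<phi> (f (twist s k us) # ys)) vs) xs" for g f k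
        unfolding split_sum_eq_cut_sum
        using that by (auto simp: X_def neq_Nil_conv intro!: cut_sum_cong)
      then show ?thesis
        by (subst spread_rec) (use that in \<open>simp add: cut_sum_add split: list.splits\<close>)
    qed
    have "multiadditive (\<lambda>xs. split_sum (X gs F (deg_sum gs)) xs
       + (case gs of [] \<Rightarrow> 0 | c # gs' \<Rightarrow> split_sum (X gs' (snd c) (deg_sum gs')) xs))"
      using Suc.prems(2)
      by (cases gs) (auto intro!: multiadditive_add X F_multiadditive multiadditive_zero)
    then show ?case
      by (auto simp: multiadditive_def eq)
  qed
  show ?thesis
    unfolding multiadditive_def
  proof (intro allI)
    fix us vs x y
    show "spread s F gs \<phi> (us @ (x + y) # vs) = spread s F gs \<phi> (us @ x # vs) + spread s F gs \<phi> (us @ y # vs)"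
      using *[OF \<phi> gs, of "Suc (length us + length vs)"] unfolding multiadditive_def
      by (elim allE[of _ us] allE[of _ vs] allE[of _ x] allE[of _ y]) simp
  qed
qed

text \<open>
  The differential either acts on an initial piece \<open>us\<close> of its argument or fixes the first entry. An empty
  \<open>us\<close> contributes nothing as \<open>b [] = 0\<close>, so the first kind is a full \<open>split_sum\<close> and can be
  moved through \<open>spread\<close>.
\<close>

lemma bar_tail:
  assumes "b [] = 0" "multiadditive \<phi>"
  shows "bar s b \<phi> ys = split_sum (\<lambda>us vs. \<phi> (b us # vs)) ys +
     (case ys of [] \<Rightarrow> 0 | y # ys' \<Rightarrow> bar s b (\<lambda>zs. \<phi> (s y # zs)) ys')"
  using additive_zero[OF multiadditive_head[OF assms(2)]] assms(1) by (cases ys) auto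

text \<open>
  The data of two A-infinity algebras and a morphism between them, with all signs absorbed in the
  involutions \<open>sA\<close> and \<open>sB\<close>; only the relations \<open>b b = 0\<close> in the target and \<open>b F = F b\<close> enter.
\<close>

locale bar_setting =
  fixes sA :: "'a::ab_group_add \<Rightarrow> 'a" and sB :: "'b::ab_group_add \<Rightarrow> 'b"
    and bA :: "'a list \<Rightarrow> 'a" and bB :: "'b list \<Rightarrow> 'b" and F :: "'a list \<Rightarrow> 'b"
  assumes additive_sA: "additive sA" and sA_sA [simp]: "sA (sA x) = x"
    and bA_twist: "bA (map sA us) = - sA (bA us)"
    and bB_Nil [simp]: "bB [] = 0" and bB_multiadditive: "multiadditive bB"
    and F_multiadditive: "multiadditive F" and F_twist: "F (map sA us) = sB (F us)"
    and F_morphism: "spread sA F [] bB us = bar sA bA F us"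
    and bB_bB: "bar sB bB bB ys = 0"
begin

abbreviation "T \<equiv> spread sA F"
abbreviation "dA \<equiv> bar sA bA"
abbreviation "dB \<equiv> bar sB bB"
abbreviation "tw \<equiv> twist sA"

text \<open>
  A pair \<open>(d, g)\<close> with \<open>g\<close> homogeneous of degree \<open>d\<close> modulo \<open>2\<close>.
\<close>

definition letter :: "int \<times> ('a list \<Rightarrow> 'b) \<Rightarrow> bool" where
  "letter c \<longleftrightarrow> multiadditive (snd c) \<and> (\<forall>us. snd c (map sA us) = with_sign (fst c) (sB (snd c us)))"

text \<open>
  The differential of \<open>g\<close> in the complex of maps along \<open>F\<close>: it vanishes on collections and
  describes their equivalence.
\<close>

definition defect :: "int \<times> ('a list \<Rightarrow> 'b) \<Rightarrow> 'a list \<Rightarrow> 'b" where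
  "defect c us = T [c] bB us - with_sign (fst c) (dA (snd c) us)"

lemma tw_sA: "tw k (map sA us) = tw (k + 1) us" "map sA (tw k us) = tw (k + 1) us"
  by (auto simp: twist_def map_idI)

lemma bar_map_sA:
  assumes "multiadditive f"
  shows "dA f (map sA us) = - dA (\<lambda>us. f (map sA us)) us"
  using assms
proof (induction us arbitrary: f)
  case (Cons x us)
  have "f (bA (map sA us) # vs) = - f (sA (bA us) # vs)" for us vs
    unfolding bA_twist by (rule additive_uminus[OF multiadditive_head[OF Cons.prems]])
  from this[of "x # _"] have *: "f (bA (sA x # map sA us) # vs) = - f (sA (bA (x # us)) # vs)" for us vs
    by simp
  show ?case
    using Cons.IH[OF multiadditive_Cons[OF Cons.prems]] by (simp add: split_sum_map * split_sum_additive[OF additive_neg])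
qed simp

lemma dA_tw: "multiadditive f \<Longrightarrow> dA (\<lambda>us. f (tw k us)) us = with_sign k (dA f (tw k us))"
  by (simp add: twist_def with_sign_def bar_map_sA)

text \<open>
  Differentiate after the word. In the first sum \<open>b\<close> involves the first output block: the inputs of that
  \<open>b\<close> carry the insertions \<open>p\<close>, the rest of the word carries \<open>r\<close>. In the second sum the differential
  leaves the first output block alone and only contributes a sign.
\<close>

lemma spread_bar_rec:
  assumes \<phi>: "multiadditive \<phi>"
  shows "T gs (dB \<phi>) xs =
     split_sum (\<lambda>p r. cut_sum (\<lambda>us vs. T r (\<lambda>ys. \<phi> (T p bB (tw (deg_sum r) us) # ys)) vs) xs) gs
     + cut_sum (\<lambda>us vs. T gs (dB (\<lambda>ys. \<phi> (sB (F (tw (deg_sum gs) us)) # ys))) vs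
         + (case gs of [] \<Rightarrow> 0 | c # gs' \<Rightarrow>
              T gs' (dB (\<lambda>ys. \<phi> (sB (snd c (tw (deg_sum gs') us)) # ys))) vs)) xs"
proof -
  define tl where "tl = (\<lambda>ys. case ys of [] \<Rightarrow> 0 | y # ys' \<Rightarrow> dB (\<lambda>zs. \<phi> (sB y # zs)) ys')"
  have head: "additive (\<lambda>x. \<phi> (x # ys))" for ys
    using multiadditive_head[OF \<phi>] .
  have "T gs (dB \<phi>) xs = T gs (split_sum (\<lambda>us vs. \<phi> (bB us # vs))) xs + T gs tl xs"
  proof -
    have "dB \<phi> = (\<lambda>ys. split_sum (\<lambda>us vs. \<phi> (bB us # vs)) ys + tl ys)"
      unfolding tl_def by (rule ext) (rule bar_tail, rule bB_Nil, rule \<phi>)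
    then show ?thesis by (simp add: spread_add)
  qed
  moreover have "T gs (split_sum (\<lambda>us vs. \<phi> (bB us # vs))) xs
    = split_sum (\<lambda>p r. cut_sum (\<lambda>us vs. T r (\<lambda>ys. \<phi> (T p bB (tw (deg_sum r) us) # ys)) vs) xs) gs"
  proof -
    have *: "T p (\<lambda>as. T r (\<lambda>bs. \<phi> (bB as # bs)) vs) us = T r (\<lambda>ys. \<phi> (T p bB us # ys)) vs" for p r us vs
      by (rule spread_additive[of "\<lambda>x. T r (\<lambda>bs. \<phi> (x # bs)) vs" _ _ _ bB])
        (simp add: additive_def additiveD[OF head] spread_add)
    have "T p bB [] = 0" for p by simp
    then have "T r (\<lambda>ys. \<phi> (T p bB [] # ys)) vs = 0" for p r vs
      by (simp only: additive_zero[OF head] spread_zero)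
    then show ?thesis
      unfolding spread_split_sum[OF sA_sA] * unfolding split_sum_eq_cut_sum[of _ xs] by simp
  qed
  moreover have "T gs tl xs = cut_sum (\<lambda>us vs. T gs (dB (\<lambda>ys. \<phi> (sB (F (tw (deg_sum gs) us)) # ys))) vs
         + (case gs of [] \<Rightarrow> 0 | c # gs' \<Rightarrow>
              T gs' (dB (\<lambda>ys. \<phi> (sB (snd c (tw (deg_sum gs') us)) # ys))) vs)) xs"
    by (subst spread_rec, cases gs) (simp_all add: tl_def)
  ultimately show ?thesis by simp
qed

text \<open>
  Differentiate before the word. The differential acts inside the first block, where it produces
  \<open>dA F\<close> or \<open>dA g\<close>, or to the right of it.
\<close>

lemma bar_spread_rec:
  assumes \<phi>: "multiadditive \<phi>" and gs: "\<forall>c\<in>set gs. letter c"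
  shows "dA (T gs \<phi>) xs = cut_sum (\<lambda>us vs.
      with_sign (deg_sum gs) (T gs (\<lambda>ys. \<phi> (dA F (tw (deg_sum gs) us) # ys)) vs)
      + dA (T gs (\<lambda>ys. \<phi> (F (tw (deg_sum gs + 1) us) # ys))) vs
      + (case gs of [] \<Rightarrow> 0 | c # gs' \<Rightarrow>
           with_sign (deg_sum gs') (T gs' (\<lambda>ys. \<phi> (dA (snd c) (tw (deg_sum gs') us) # ys)) vs)
           + dA (T gs' (\<lambda>ys. \<phi> (snd c (tw (deg_sum gs' + 1) us) # ys))) vs)) xs"
proof -
  define \<psi> where "\<psi> = (\<lambda>us vs.
       T gs (\<lambda>ys. \<phi> (F (tw (deg_sum gs) us) # ys)) vs
       + (case gs of [] \<Rightarrow> 0 | c # gs' \<Rightarrow> T gs' (\<lambda>ys. \<phi> (snd c (tw (deg_sum gs') us) # ys)) vs))"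
  have head: "additive (\<lambda>x. \<phi> (x # ys))" for ys
    using multiadditive_head[OF \<phi>] .
  have *: "dA (\<lambda>us'. T g (\<lambda>ys. \<phi> (f (tw k us') # ys)) vs) us
      = with_sign k (T g (\<lambda>ys. \<phi> (dA f (tw k us) # ys)) vs)" if "multiadditive f" for f k g us vs
    unfolding bar_spread_swap bar_additive[OF head] dA_tw[OF that]
    by (simp add: additive_with_sign[OF head] spread_with_sign)
  have swap: "dA (\<lambda>us'. T g (\<lambda>ys. \<phi> (f us' # ys)) vs) us = T g (\<lambda>ys. \<phi> (dA f us # ys)) vs" for f g us vs
    unfolding bar_spread_swap bar_additive[OF head] ..
  have "dA (T gs \<phi>) xs = dA (cut_sum \<psi>) xs"
    unfolding \<psi>_def by (rule bar_cong, subst spread_rec) simp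
  also have "\<dots> = cut_sum (\<lambda>us vs. dA (\<lambda>us'. \<psi> us' vs) us + dA (\<psi> (map sA us)) vs) xs"
    by (rule bar_cut_sum)
  finally have coder: "dA (T gs \<phi>) xs = cut_sum (\<lambda>us vs. dA (\<lambda>us'. \<psi> us' vs) us + dA (\<psi> (map sA us)) vs) xs" .
  show ?thesis
  proof (cases gs)
    case Nil
    then show ?thesis
      using coder twist_def[of sA 1] by (simp add: \<psi>_def bar_add swap)
  next
    case (Cons c gs')
    then show ?thesis
      using coder gs
      by (simp add: \<psi>_def bar_add * F_multiadditive letter_def tw_sA algebra_simps)
  qed
qed

lemma letter_sB: "letter c \<Longrightarrow> sB (snd c (tw k us)) = with_sign (fst c) (snd c (tw (k + 1) us))"
  unfolding letter_def by (metis tw_sA(2) with_sign_with_sign with_sign_self)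

lemma F_sB: "sB (F (tw k us)) = F (tw (k + 1) us)"
  by (simp add: F_twist flip: tw_sA(2))

text \<open>
  \<open>F\<close> induces a morphism of dg-coalgebras: in the two recursions the terms \<open>\<Sum> b (F \<otimes> \<dots> \<otimes> F)\<close> and
  \<open>dA F\<close> agree.
\<close>

lemma spread_bar_0:
  fixes \<phi> :: "'b list \<Rightarrow> 'c::ab_group_add"
  assumes "multiadditive \<phi>" shows "T [] (dB \<phi>) xs = dA (T [] \<phi>) xs"
  using assms
proof (induction xs arbitrary: \<phi> rule: length_induct)
  case (1 xs)
  have IH: "T [] (dB (\<lambda>ys. \<phi> (x # ys))) vs = dA (T [] (\<lambda>ys. \<phi> (x # ys))) vs"
    if "length vs < length xs" for vs x
    using 1(1) that multiadditive_Cons[OF 1(2)] by blast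
  have "T [] (dB \<phi>) xs = cut_sum (\<lambda>us vs. T [] (\<lambda>ys. \<phi> (dA F us # ys)) vs
      + T [] (dB (\<lambda>ys. \<phi> (F (tw 1 us) # ys))) vs) xs"
    by (subst spread_bar_rec[OF 1(2)]) (use F_sB[of 0] in \<open>simp add: F_morphism cut_sum_add\<close>)
  also have "\<dots> = cut_sum (\<lambda>us vs. T [] (\<lambda>ys. \<phi> (dA F us # ys)) vs
      + dA (T [] (\<lambda>ys. \<phi> (F (tw 1 us) # ys))) vs) xs"
    by (rule cut_sum_cong) (auto simp: IH)
  also have "\<dots> = dA (T [] \<phi>) xs"
    by (subst bar_spread_rec[OF 1(2)]) auto
  finally show ?case .
qed

text \<open>
  For one insertion the terms where \<open>b\<close> takes only copies of \<open>F\<close> cancel as for \<open>F\<close> itself; those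
  where it takes \<open>g\<close> combine with \<open>dA g\<close> to the defect of \<open>g\<close>.
\<close>

lemma spread_bar_1:
  fixes \<phi> :: "'b list \<Rightarrow> 'c::ab_group_add"
  assumes "multiadditive \<phi>" and c: "letter c"
  shows "T [c] (dB \<phi>) xs = with_sign (fst c) (dA (T [c] \<phi>) xs) + T [(fst c + 1, defect c)] \<phi> xs"
  using assms(1)
proof (induction xs arbitrary: \<phi> rule: length_induct)
  case (1 xs)
  have IH: "T [c] (dB (\<lambda>ys. \<phi> (x # ys))) vs = with_sign (fst c) (dA (T [c] (\<lambda>ys. \<phi> (x # ys))) vs)
      + T [(fst c + 1, defect c)] (\<lambda>ys. \<phi> (x # ys)) vs"
    if "length vs < length xs" for vs x
    using 1(1) that multiadditive_Cons[OF 1(2)] by blast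
  have head: "additive (\<lambda>x. \<phi> (x # ys))" for ys
    using multiadditive_head[OF 1(2)] .
  have B: "T [c] (dB \<phi>) xs = cut_sum (\<lambda>us vs. T [c] (\<lambda>ys. \<phi> (dA F (tw (fst c) us) # ys)) vs
      + T [] (\<lambda>ys. \<phi> (T [c] bB us # ys)) vs
      + T [c] (dB (\<lambda>ys. \<phi> (F (tw (fst c + 1) us) # ys))) vs
      + with_sign (fst c) (dA (T [] (\<lambda>ys. \<phi> (snd c (tw 1 us) # ys))) vs)) xs"
    by (subst spread_bar_rec[OF 1(2)])
      (use letter_sB[OF c, of 0] in \<open>simp add: F_morphism cut_sum_add F_sB additive_with_sign[OF head]
         bar_with_sign spread_with_sign_fun spread_bar_0 multiadditive_Cons 1(2) multiadditive_with_sign\<close>)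
  have A: "with_sign (fst c) (dA (T [c] \<phi>) xs) = cut_sum (\<lambda>us vs.
        T [c] (\<lambda>ys. \<phi> (dA F (tw (fst c) us) # ys)) vs
      + with_sign (fst c) (dA (T [c] (\<lambda>ys. \<phi> (F (tw (fst c + 1) us) # ys))) vs)
      + with_sign (fst c) (T [] (\<lambda>ys. \<phi> (dA (snd c) us # ys)) vs)
      + with_sign (fst c) (dA (T [] (\<lambda>ys. \<phi> (snd c (tw 1 us) # ys))) vs)) xs"
    by (subst bar_spread_rec[OF 1(2)]) (use c in \<open>auto simp: with_sign_add algebra_simps simp flip: cut_sum_with_sign\<close>)
  have D: "T [(fst c + 1, defect c)] \<phi> xs = cut_sum (\<lambda>us vs.
      T [(fst c + 1, defect c)] (\<lambda>ys. \<phi> (F (tw (fst c + 1) us) # ys)) vs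
      + T [] (\<lambda>ys. \<phi> (defect c us # ys)) vs) xs"
    by (subst spread_rec) simp
  have def: "T [] (\<lambda>ys. \<phi> (defect c us # ys)) vs = T [] (\<lambda>ys. \<phi> (T [c] bB us # ys)) vs
      - with_sign (fst c) (T [] (\<lambda>ys. \<phi> (dA (snd c) us # ys)) vs)" for us vs
    unfolding defect_def diff_conv_add_uminus additiveD[OF head] additive_uminus[OF head]
      additive_with_sign[OF head] spread_add spread_uminus spread_with_sign ..
  show ?case
    unfolding A D B cut_sum_add[symmetric]
    by (rule cut_sum_cong) (auto simp: IH def algebra_simps)
qed

text \<open>
  For two insertions there is one new term, in which \<open>b\<close> takes both of them.
\<close>

lemma spread_bar_2:
  fixes \<phi> :: "'b list \<Rightarrow> 'c::ab_group_add"
  assumes "multiadditive \<phi>" and c: "letter c" and e: "letter e"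
  shows "T [c, e] (dB \<phi>) xs = with_sign (fst c + fst e) (dA (T [c, e] \<phi>) xs)
     + T [(fst c + fst e + 1, T [c, e] bB)] \<phi> xs
     + T [(fst c + 1, defect c), e] \<phi> xs + with_sign (fst c) (T [c, (fst e + 1, defect e)] \<phi> xs)"
  using assms(1)
proof (induction xs arbitrary: \<phi> rule: length_induct)
  case (1 xs)
  have IH: "T [c, e] (dB (\<lambda>ys. \<phi> (x # ys))) vs = with_sign (fst c + fst e) (dA (T [c, e] (\<lambda>ys. \<phi> (x # ys))) vs)
     + T [(fst c + fst e + 1, T [c, e] bB)] (\<lambda>ys. \<phi> (x # ys)) vs
     + T [(fst c + 1, defect c), e] (\<lambda>ys. \<phi> (x # ys)) vs
     + with_sign (fst c) (T [c, (fst e + 1, defect e)] (\<lambda>ys. \<phi> (x # ys)) vs)"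
    if "length vs < length xs" for vs x
    using 1(1) that multiadditive_Cons[OF 1(2)] by blast
  have head: "additive (\<lambda>x. \<phi> (x # ys))" for ys
    using multiadditive_head[OF 1(2)] .
  have T1: "T [e] (dB (\<lambda>ys. \<phi> (x # ys))) vs = with_sign (fst e) (dA (T [e] (\<lambda>ys. \<phi> (x # ys))) vs)
      + T [(fst e + 1, defect e)] (\<lambda>ys. \<phi> (x # ys)) vs" for x vs
    using spread_bar_1[OF multiadditive_Cons[OF 1(2)] e] .
  have sc: "\<phi> (sB (snd c (tw k us)) # ys) = with_sign (fst c) (\<phi> (snd c (tw (k + 1) us) # ys))" for k us ys
    unfolding letter_sB[OF c] by (rule additive_with_sign[OF head])
  have B: "T [c, e] (dB \<phi>) xs = cut_sum (\<lambda>us vs.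
        T [c, e] (\<lambda>ys. \<phi> (dA F (tw (fst c + fst e) us) # ys)) vs
      + T [e] (\<lambda>ys. \<phi> (T [c] bB (tw (fst e) us) # ys)) vs
      + T [] (\<lambda>ys. \<phi> (T [c, e] bB us # ys)) vs
      + T [c, e] (dB (\<lambda>ys. \<phi> (F (tw (fst c + fst e + 1) us) # ys))) vs
      + with_sign (fst c) (T [e] (dB (\<lambda>ys. \<phi> (snd c (tw (fst e + 1) us) # ys))) vs)) xs"
    by (subst spread_bar_rec[OF 1(2)])
      (simp add: F_morphism cut_sum_add F_sB sc bar_with_sign[abs_def] bar_with_sign spread_with_sign)
  have A: "with_sign (fst c + fst e) (dA (T [c, e] \<phi>) xs) = cut_sum (\<lambda>us vs.
        T [c, e] (\<lambda>ys. \<phi> (dA F (tw (fst c + fst e) us) # ys)) vs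
      + with_sign (fst c + fst e) (dA (T [c, e] (\<lambda>ys. \<phi> (F (tw (fst c + fst e + 1) us) # ys))) vs)
      + with_sign (fst c) (T [e] (\<lambda>ys. \<phi> (dA (snd c) (tw (fst e) us) # ys)) vs)
      + with_sign (fst c + fst e) (dA (T [e] (\<lambda>ys. \<phi> (snd c (tw (fst e + 1) us) # ys))) vs)) xs"
  proof -
    have "with_sign (fst c + fst e + fst e) x = with_sign (fst c) x" for x :: 'c
      by (rule with_sign_cong_parity) auto
    then show ?thesis
      by (subst bar_spread_rec[OF 1(2)]) (use c e in \<open>auto simp: with_sign_add algebra_simps simp flip: cut_sum_with_sign\<close>)
  qed
  have D1: "T [(fst c + fst e + 1, T [c, e] bB)] \<phi> xs = cut_sum (\<lambda>us vs.
      T [(fst c + fst e + 1, T [c, e] bB)] (\<lambda>ys. \<phi> (F (tw (fst c + fst e + 1) us) # ys)) vs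
      + T [] (\<lambda>ys. \<phi> (T [c, e] bB us # ys)) vs) xs"
    by (subst spread_rec) simp
  have D2: "T [(fst c + 1, defect c), e] \<phi> xs = cut_sum (\<lambda>us vs.
      T [(fst c + 1, defect c), e] (\<lambda>ys. \<phi> (F (tw (fst c + fst e + 1) us) # ys)) vs
      + T [e] (\<lambda>ys. \<phi> (defect c (tw (fst e) us) # ys)) vs) xs"
    by (subst spread_rec) (simp add: algebra_simps)
  have D3: "with_sign (fst c) (T [c, (fst e + 1, defect e)] \<phi> xs) = cut_sum (\<lambda>us vs.
      with_sign (fst c) (T [c, (fst e + 1, defect e)] (\<lambda>ys. \<phi> (F (tw (fst c + fst e + 1) us) # ys)) vs)
      + with_sign (fst c) (T [(fst e + 1, defect e)] (\<lambda>ys. \<phi> (snd c (tw (fst e + 1) us) # ys)) vs)) xs"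
    by (subst spread_rec) (simp add: algebra_simps with_sign_add flip: cut_sum_with_sign)
  have def: "T [e] (\<lambda>ys. \<phi> (defect c us # ys)) vs = T [e] (\<lambda>ys. \<phi> (T [c] bB us # ys)) vs
      - with_sign (fst c) (T [e] (\<lambda>ys. \<phi> (dA (snd c) us # ys)) vs)" for us vs
    unfolding defect_def diff_conv_add_uminus additiveD[OF head] additive_uminus[OF head]
      additive_with_sign[OF head] spread_add spread_uminus spread_with_sign ..
  show ?case
    unfolding A B D1 D2 D3 cut_sum_add[symmetric]
    by (rule cut_sum_cong) (auto simp: IH def T1 with_sign_add algebra_simps)
qed

text \<open>
  Composing the commutator formula for two insertions with \<open>b\<close> kills its left hand side.
\<close>

theorem defect_product:
  assumes "letter c" "letter e"
  shows "defect (fst c + fst e + 1, T [c, e] bB) xs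
    = - T [(fst c + 1, defect c), e] bB xs - with_sign (fst c) (T [c, (fst e + 1, defect e)] bB xs)"
proof -
  have "T [c, e] (dB bB) xs = 0"
    using spread_zero bB_bB by (metis ext)
  then have "0 = with_sign (fst c + fst e) (dA (T [c, e] bB) xs)
     + T [(fst c + fst e + 1, T [c, e] bB)] bB xs
     + T [(fst c + 1, defect c), e] bB xs + with_sign (fst c) (T [c, (fst e + 1, defect e)] bB xs)"
    using spread_bar_2[OF bB_multiadditive assms, of xs] by simp
  moreover have "b - - a = - c' - d" if "0 = a + b + c' + d" for a b c' d :: 'b
  proof -
    have "b - - a = (a + b + c' + d) - c' - d" by simp
    then show ?thesis unfolding that[symmetric] by simp
  qed
  ultimately show ?thesis
    unfolding defect_def[of "(fst c + fst e + 1, _)"] fst_conv snd_conv with_sign_succ by blast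
qed

lemma T_letter_add:
  fixes \<phi> :: "'b list \<Rightarrow> 'c::ab_group_add"
  assumes "multiadditive \<phi>"
  shows "T (p @ (d, \<lambda>us. g us + h us) # r) \<phi> xs = T (p @ (d, g) # r) \<phi> xs + T (p @ (d, h) # r) \<phi> xs"
  using assms
proof (induction xs arbitrary: p \<phi> rule: length_induct)
  case (1 xs)
  have IH: "T (p @ (d, \<lambda>us. g us + h us) # r) (\<lambda>ys. \<phi> (x # ys)) vs
      = T (p @ (d, g) # r) (\<lambda>ys. \<phi> (x # ys)) vs + T (p @ (d, h) # r) (\<lambda>ys. \<phi> (x # ys)) vs"
    if "length vs < length xs" for vs x p
    using 1(1) that multiadditive_Cons[OF 1(2)] by blast
  have head: "additive (\<lambda>x. \<phi> (x # ys))" for ys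
    using multiadditive_head[OF 1(2)] .
  show ?case
    unfolding spread_rec[of _ _ _ _ xs]
    by (simp add: cut_sum_add[symmetric], rule cut_sum_cong, cases p)
      (auto simp: IH[of _ "[]", simplified] IH[of _ "_ # _", simplified] IH additiveD[OF head] spread_add algebra_simps)
qed

end

section \<open>Parity of homogeneous elements and the defining sums\<close>

lemma gradingD:
  assumes "grading G"
  shows "0 \<in> G i" "x \<in> G i \<Longrightarrow> y \<in> G i \<Longrightarrow> x + y \<in> G i" "x \<in> G i \<Longrightarrow> - x \<in> G i"
    "x \<in> G i \<Longrightarrow> y \<in> G i \<Longrightarrow> x - y \<in> G i" "x \<in> G i \<Longrightarrow> with_sign k x \<in> G i"
proof -
  have "0 \<in> G i \<and> (\<forall>x\<in>G i. \<forall>y\<in>G i. x + y \<in> G i) \<and> (\<forall>x\<in>G i. - x \<in> G i)"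
    using assms unfolding grading_def by simp
  then have z: "0 \<in> G i" and a: "\<And>x y. x \<in> G i \<Longrightarrow> y \<in> G i \<Longrightarrow> x + y \<in> G i" and u: "\<And>x. x \<in> G i \<Longrightarrow> - x \<in> G i"
    by simp_all
  show "0 \<in> G i" by (rule z)
  show "x \<in> G i \<Longrightarrow> y \<in> G i \<Longrightarrow> x + y \<in> G i" by (rule a)
  show "x \<in> G i \<Longrightarrow> - x \<in> G i" by (rule u)
  show "x \<in> G i \<Longrightarrow> y \<in> G i \<Longrightarrow> x - y \<in> G i" using a[of x "- y"] u[of y] by simp
  show "x \<in> G i \<Longrightarrow> with_sign k x \<in> G i" using u[of x] by (simp add: with_sign_def)
qed

lemma grading_sum:
  assumes "grading G" "\<And>s. s \<in> S \<Longrightarrow> f s \<in> G i" shows "sum f S \<in> G i"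
  using assms(2) by (induction S rule: infinite_finite_induct) (auto intro: gradingD[OF assms(1)])

definition components :: "(int \<Rightarrow> 'a::ab_group_add set) \<Rightarrow> 'a \<Rightarrow> int \<Rightarrow> 'a" where
  "components G x = (THE c. (\<forall>i. c i \<in> G i) \<and> finite {i. c i \<noteq> 0} \<and> x = (\<Sum>i\<in>{i. c i \<noteq> 0}. c i))"

lemma components:
  assumes "grading G"
  shows "components G x i \<in> G i" "finite {i. components G x i \<noteq> 0}"
    "(\<Sum>i\<in>{i. components G x i \<noteq> 0}. components G x i) = x"
proof -
  have "\<exists>!c. (\<forall>i. c i \<in> G i) \<and> finite {i. c i \<noteq> 0} \<and> x = (\<Sum>i\<in>{i. c i \<noteq> 0}. c i)"
    using assms unfolding grading_def by blast
  from theI'[OF this] show "components G x i \<in> G i" "finite {i. components G x i \<noteq> 0}"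
    "(\<Sum>i\<in>{i. components G x i \<noteq> 0}. components G x i) = x"
    unfolding components_def by auto
qed

lemma components_unique:
  assumes "grading G" "\<And>i. c i \<in> G i" "finite S" "\<And>i. i \<notin> S \<Longrightarrow> c i = 0" "x = sum c S"
  shows "components G x = c"
proof -
  have sub: "{i. c i \<noteq> 0} \<subseteq> S" using assms(4) by blast
  have "x = (\<Sum>i\<in>{i. c i \<noteq> 0}. c i)"
    unfolding assms(5) by (rule sum.mono_neutral_right[OF assms(3) sub]) simp
  moreover have "finite {i. c i \<noteq> 0}"
    using sub assms(3) finite_subset by blast
  moreover have "\<exists>!c. (\<forall>i. c i \<in> G i) \<and> finite {i. c i \<noteq> 0} \<and> x = (\<Sum>i\<in>{i. c i \<noteq> 0}. c i)"
    using assms(1) unfolding grading_def by blast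
  ultimately show ?thesis
    unfolding components_def using assms(2) by (intro the1_equality) auto
qed

text \<open>
  The shift by one makes this the sign of the degree in the suspension.
\<close>

definition parity :: "(int \<Rightarrow> 'a::ab_group_add set) \<Rightarrow> 'a \<Rightarrow> 'a" where
  "parity G x = (\<Sum>i\<in>{i. components G x i \<noteq> 0}. with_sign (i - 1) (components G x i))"

lemma parity_homog:
  assumes "grading G" "x \<in> susp G e" shows "parity G x = with_sign e x"
proof -
  have "components G x = (\<lambda>i. if i = e + 1 then x else 0)"
    by (rule components_unique[OF assms(1), where S = "{e + 1}"])
      (use assms gradingD[OF assms(1)] in \<open>auto simp: susp_def\<close>)
  then show ?thesis
    by (cases "x = 0") (auto simp: parity_def)
qed

lemma additive_parity:
  assumes "grading G" shows "additive (parity G)"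
  unfolding additive_def
proof (intro allI)
  fix x y
  let ?S = "{i. components G x i \<noteq> 0} \<union> {i. components G y i \<noteq> 0}"
  have fin: "finite ?S" using components(2)[OF assms] by blast
  have self: "sum (components G z) ?S = z" if "{i. components G z i \<noteq> 0} \<subseteq> ?S" for z
    using sum.mono_neutral_left[OF fin that, of "components G z"] components(3)[OF assms, of z] by auto
  have par: "parity G z = (\<Sum>i\<in>?S. with_sign (i - 1) (components G z i))"
    if "{i. components G z i \<noteq> 0} \<subseteq> ?S" for z
    unfolding parity_def by (rule sum.mono_neutral_left[OF fin that]) auto
  have c: "components G (x + y) = (\<lambda>i. components G x i + components G y i)"
  proof (rule components_unique[OF assms _ fin])
    show "components G x i + components G y i \<in> G i" for i
      by (rule gradingD(2)[OF assms components(1)[OF assms] components(1)[OF assms]])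
    show "x + y = (\<Sum>i\<in>?S. components G x i + components G y i)"
      unfolding sum.distrib self[of x, OF Un_upper1] self[of y, OF Un_upper2] ..
  qed auto
  have sub: "{i. components G (x + y) i \<noteq> 0} \<subseteq> ?S" unfolding c by auto
  show "parity G (x + y) = parity G x + parity G y"
    unfolding par[of x, OF Un_upper1] par[of y, OF Un_upper2] par[OF sub]
    by (simp add: c with_sign_add sum.distrib)
qed

text \<open>
  Identities between additive functions may be checked on homogeneous elements; \<open>multiadditive_ext\<close>
  is the corresponding statement for lists.
\<close>

lemma additive_eq_zero_grading:
  assumes "grading G" "additive h" "\<And>e x. x \<in> susp G e \<Longrightarrow> h x = 0" shows "h x = 0"
proof -
  have "h (components G x i) = 0" for i
    using assms(3)[of _ "i - 1"] components(1)[OF assms(1)] by (simp add: susp_def)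
  then show ?thesis
    by (subst components(3)[OF assms(1), of x, symmetric]) (simp add: additive_sum[OF assms(2)])
qed

lemma parity_parity:
  assumes "grading G" shows "parity G (parity G x) = x"
proof -
  have "parity G (parity G x) - x = 0"
  proof (rule additive_eq_zero_grading[OF assms, where h = "\<lambda>x. parity G (parity G x) - x"])
    show "additive (\<lambda>x. parity G (parity G x) - x)"
      using additive_parity[OF assms] by (simp add: additive_def algebra_simps)
    show "parity G (parity G y) - y = 0" if "y \<in> susp G e" for e y
      using that by (simp add: parity_homog[OF assms, of _ e] additive_with_sign[OF additive_parity[OF assms]])
  qed
  then show ?thesis by simp
qed

lemma multiadditive_ext:
  assumes G: "grading G" and f: "multiadditive f" and g: "multiadditive g" and "f [] = g []"
    and "\<And>es xs. xs \<noteq> [] \<Longrightarrow> homog (susp G) es xs \<Longrightarrow> f xs = g xs"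
  shows "f xs = g xs"
proof -
  have "f (us @ vs) = g (us @ vs)" if "homog (susp G) es us" for es us vs
    using that
  proof (induction vs arbitrary: es us)
    case Nil
    then show ?case using assms(4,5) by (cases "us = []") auto
  next
    case (Cons v vs)
    have "f (us @ v # vs) - g (us @ v # vs) = 0"
    proof (rule additive_eq_zero_grading[OF G, where h = "\<lambda>v. f (us @ v # vs) - g (us @ v # vs)"])
      show "additive (\<lambda>v. f (us @ v # vs) - g (us @ v # vs))"
        using f g by (simp add: multiadditive_def additive_def algebra_simps)
      fix e x assume "x \<in> susp G e"
      then have "homog (susp G) (es @ [e]) (us @ [x])"
        using Cons.prems by (simp add: homog_def list_all2_appendI)
      from Cons.IH[OF this] show "f (us @ x # vs) - g (us @ x # vs) = 0" by simp
    qed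
    then show ?case by simp
  qed
  from this[of "[]" "[]" xs] show ?thesis by (simp add: homog_def)
qed

lemma multimapD:
  assumes "multimap S T d f"
  shows "f [] = 0" "multiadditive f" "xs \<noteq> [] \<Longrightarrow> homog S es xs \<Longrightarrow> f xs \<in> T (sum_list es + d)"
  using assms by (auto simp: multimap_def multiadditive_def)

lemma multimapI:
  assumes "f [] = 0" "multiadditive f" "\<And>es xs. xs \<noteq> [] \<Longrightarrow> homog S es xs \<Longrightarrow> f xs \<in> T (sum_list es + d)"
  shows "multimap S T d f"
  using assms by (auto simp: multimap_def multiadditive_def)

lemma multiadditive_parity:
  assumes "grading G" "multiadditive f" "homog (susp G) es xs"
  shows "f (map (parity G) xs) = with_sign (sum_list es) (f xs)"
  using assms(3,2)
proof (induction xs arbitrary: f es)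
  case (Cons x xs)
  then obtain e es' where es: "es = e # es'" "x \<in> susp G e" "homog (susp G) es' xs"
    by (auto simp: homog_def list_all2_Cons2)
  show ?case
    using Cons.IH[OF es(3) multiadditive_Cons[OF Cons.prems(2), of "with_sign e x"]]
      additive_with_sign[OF multiadditive_head[OF Cons.prems(2)], of e x]
    by (simp add: es parity_homog[OF assms(1) es(2)] add.commute)
qed (simp add: homog_def)

text \<open>
  Both sides are multiadditive, so homogeneous lists suffice; there the two signs differ by \<open>(-1)\<^sup>d\<close>.
\<close>

lemma multimap_parity:
  assumes "grading G" "grading G'" and f: "multimap (susp G) (susp G') d f"
  shows "f (map (parity G) xs) = with_sign d (parity G' (f xs))"
proof (rule multiadditive_ext[OF assms(1)])
  show "multiadditive (\<lambda>xs. f (map (parity G) xs))"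
    by (rule multiadditive_map[OF multimapD(2)[OF f] additive_parity[OF assms(1)]])
  show "multiadditive (\<lambda>xs. with_sign d (parity G' (f xs)))"
    by (rule multiadditive_with_sign[OF multiadditive_comp[OF additive_parity[OF assms(2)] multimapD(2)[OF f]]])
  show "f (map (parity G) []) = with_sign d (parity G' (f []))"
    by (simp add: multimapD(1)[OF f] additive_zero[OF additive_parity[OF assms(2)]])
  fix es xs assume xs: "xs \<noteq> []" "homog (susp G) es xs"
  have "with_sign (d + (sum_list es + d)) (f xs) = with_sign (sum_list es) (f xs)"
    by (rule with_sign_cong_parity) auto
  then show "f (map (parity G) xs) = with_sign d (parity G' (f xs))"
    using parity_homog[OF assms(2) multimapD(3)[OF f xs]] multiadditive_parity[OF assms(1) multimapD(2)[OF f] xs(2)]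
    by simp
qed

text \<open>
  The value of \<open>\<phi> \<circ> (f\<^sub>1 \<otimes> \<dots> \<otimes> f\<^sub>s)\<close> with twists in place of the Koszul sign.
\<close>

fun apply_word :: "('a \<Rightarrow> 'a) \<Rightarrow> ('b list \<Rightarrow> 'c) \<Rightarrow> (int \<times> nat \<times> ('a list \<Rightarrow> 'b)) list \<Rightarrow> 'a list \<Rightarrow> 'c" where
  "apply_word s \<phi> [] xs = \<phi> []"
| "apply_word s \<phi> ((d, i, f) # fs) xs =
     apply_word s (\<lambda>ys. \<phi> (f (twist s (deg_sum fs) (take i xs)) # ys)) fs (drop i xs)"

text \<open>
  On homogeneous inputs the twists produce exactly the Koszul sign. The condition on the letters is
  restricted to \<open>length us \<le> i\<close> so that it also covers \<open>id_factor\<close>, whose function \<open>hd\<close> is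
  multiadditive only on lists of length one.
\<close>

lemma after_tensor_eq_apply_word:
  assumes G: "grading G" and "homog (susp G) es xs" and "multiadditive \<phi>"
    and "\<forall>(d, i, f)\<in>set fs. \<forall>es us. homog (susp G) es us \<longrightarrow> length us \<le> i \<longrightarrow>
           f (map (parity G) us) = with_sign (sum_list es) (f us)"
  shows "after_tensor \<phi> fs es xs = apply_word (parity G) \<phi> fs xs"
  using assms(2-)
proof (induction fs arbitrary: es xs \<phi>)
  case (Cons w fs)
  obtain d i f where w: "w = (d, i, f)" by (cases w) auto
  obtain k ys where k: "koszul_tensor fs (drop i es) (drop i xs) = (k, ys)" by (cases "koszul_tensor fs (drop i es) (drop i xs)") auto
  have h: "homog (susp G) (drop i es) (drop i xs)" "homog (susp G) (take i es) (take i xs)"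
    using Cons.prems(1) by (auto simp: homog_def list_all2_dropI list_all2_takeI)
  have "f (twist (parity G) n (take i xs)) = with_sign (n * sum_list (take i es)) (f (take i xs))" for n
    using Cons.prems(3) h(2) by (auto simp: w twist_def with_sign_def)
  then have "apply_word (parity G) \<phi> (w # fs) xs
     = after_tensor (\<lambda>ys. \<phi> (with_sign (deg_sum fs * sum_list (take i es)) (f (take i xs)) # ys)) fs (drop i es) (drop i xs)"
    using Cons.IH[OF h(1) multiadditive_Cons[OF Cons.prems(2)]] Cons.prems(3) by (simp add: w)
  also have "\<dots> = after_tensor \<phi> (w # fs) es xs"
    by (simp add: w after_tensor_def k additive_with_sign[OF multiadditive_head[OF Cons.prems(2)]])
  finally show ?case ..
qed (simp add: after_tensor_def)

definition compositions :: "nat \<Rightarrow> nat list set" where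
  "compositions m = {is. 0 \<notin> set is \<and> sum_list is = m}"

definition marked_compositions :: "nat \<Rightarrow> (nat list \<times> nat \<times> nat list) set" where
  "marked_compositions m = {(is, l, js). 0 \<notin> set (is @ [l] @ js) \<and> sum_list (is @ [l] @ js) = m}"

definition bimarked_compositions :: "nat \<Rightarrow> (nat list \<times> nat \<times> nat list \<times> nat \<times> nat list) set" where
  "bimarked_compositions m = {(is, l1, js, l2, ks).
          0 \<notin> set (is @ [l1] @ js @ [l2] @ ks) \<and> sum_list (is @ [l1] @ js @ [l2] @ ks) = m}"

lemma length_le_sum_list: "0 \<notin> set (is :: nat list) \<Longrightarrow> length is \<le> sum_list is"
  by (induction "is") auto

lemma finite_compositions_le: "finite {is. 0 \<notin> set is \<and> sum_list is \<le> (m::nat)}"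
proof (rule finite_subset)
  show "{is. 0 \<notin> set is \<and> sum_list is \<le> m} \<subseteq> {is. set is \<subseteq> {..m} \<and> length is \<le> m}"
    by (auto intro: member_le_sum_list[THEN order_trans] length_le_sum_list[THEN order_trans])
  show "finite {is::nat list. set is \<subseteq> {..m} \<and> length is \<le> m}"
    by (rule finite_lists_length_le) simp
qed

lemma finite_compositions: "finite (compositions m)"
  by (rule finite_subset[OF _ finite_compositions_le[of m]]) (auto simp: compositions_def)

lemma finite_marked: "finite (marked_compositions m)"
proof (rule finite_subset)
  let ?C = "{is. 0 \<notin> set is \<and> sum_list is \<le> m}"
  show "marked_compositions m \<subseteq> ?C \<times> {..m} \<times> ?C" by (auto simp: marked_compositions_def bimarked_compositions_def)
  show "finite (?C \<times> {..m} \<times> ?C)" using finite_compositions_le by blast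
qed

lemma finite_bimarked: "finite (bimarked_compositions m)"
proof (rule finite_subset)
  let ?C = "{is. 0 \<notin> set is \<and> sum_list is \<le> m}"
  show "bimarked_compositions m \<subseteq> ?C \<times> {..m} \<times> ?C \<times> {..m} \<times> ?C" by (auto simp: marked_compositions_def bimarked_compositions_def)
  show "finite (?C \<times> {..m} \<times> ?C \<times> {..m} \<times> ?C)" using finite_compositions_le by blast
qed

text \<open>
  The common step of the recursions below: an index set whose elements have a first part \<open>i\<close>, with the
  remaining data ranging over an index set for \<open>m - i\<close>.
\<close>

lemma sum_first_part:
  fixes S :: "nat \<Rightarrow> 'x set" and f :: "'y \<Rightarrow> 'c::ab_group_add"
  assumes "\<And>i. finite (S i)" "inj (\<lambda>(i, x). h i x)"
    and "T = (\<Union>i\<in>{1..m}. h i ` S (m - i))"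
  shows "sum f T = (\<Sum>i=1..m. \<Sum>x\<in>S (m - i). f (h i x))"
proof -
  have inj: "inj_on (h i) A" for i A
    using assms(2) by (auto simp: inj_on_def)
  have "sum f T = (\<Sum>i=1..m. sum f (h i ` S (m - i)))"
    unfolding assms(3)
    by (rule sum.UNION_disjoint) (use assms(1,2) in \<open>auto simp: inj_on_def\<close>)
  also have "\<dots> = (\<Sum>i=1..m. \<Sum>x\<in>S (m - i). f (h i x))"
    by (simp add: sum.reindex[OF inj])
  finally show ?thesis .
qed

lemma sum_compositions:
  fixes f :: "nat list \<Rightarrow> 'c::ab_group_add"
  shows "sum f (compositions m) = (if m = 0 then f [] else 0) + (\<Sum>i=1..m. \<Sum>is\<in>compositions (m - i). f (i # is))"
proof -
  let ?R = "\<Union>i\<in>{1..m}. (#) i ` compositions (m - i)"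
  have split: "compositions m = (if m = 0 then {[]} else {}) \<union> ?R"
  proof (intro equalityI subsetI)
    fix x assume "x \<in> compositions m"
    then show "x \<in> (if m = 0 then {[]} else {}) \<union> ?R"
      by (cases x) (auto simp: compositions_def image_iff)
  qed (auto simp: compositions_def split: if_splits)
  have "sum f ?R = (\<Sum>i=1..m. \<Sum>is\<in>compositions (m - i). f (i # is))"
    by (rule sum_first_part[OF finite_compositions]) (auto simp: inj_def)
  moreover have "sum f (compositions m) = sum f (if m = 0 then {[]} else {}) + sum f ?R"
    unfolding split by (rule sum.union_disjoint) (auto simp: finite_compositions)
  ultimately show ?thesis by simp
qed

text \<open>
  The first part is the marked one or precedes it. The two cases match the recursion of \<open>spread\<close>.
\<close>

lemma sum_marked:
  fixes f :: "nat list \<Rightarrow> nat \<Rightarrow> nat list \<Rightarrow> 'c::ab_group_add"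
  shows "(\<Sum>(is, l, js)\<in>marked_compositions m. f is l js)
    = (\<Sum>i=1..m. (\<Sum>(is, l, js)\<in>marked_compositions (m - i). f (i # is) l js) + (\<Sum>js\<in>compositions (m - i). f [] i js))"
proof -
  let ?R = "\<Union>i\<in>{1..m}. (\<lambda>js. ([], i, js)) ` compositions (m - i)"
  let ?Q = "\<Union>i\<in>{1..m}. (\<lambda>(is, l, js). (i # is, l, js)) ` marked_compositions (m - i)"
  have split: "marked_compositions m = ?R \<union> ?Q"
  proof (intro equalityI subsetI)
    fix x assume "x \<in> marked_compositions m"
    then obtain "is" l js where x: "x = (is, l, js)" "0 \<notin> set (is @ [l] @ js)" "sum_list (is @ [l] @ js) = m"
      by (auto simp: marked_compositions_def)
    show "x \<in> ?R \<union> ?Q"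
    proof (cases "is")
      case Nil
      then have "x \<in> (\<lambda>js. ([], l, js)) ` compositions (m - l)" "l \<in> {1..m}"
        using x by (auto simp: compositions_def)
      then show ?thesis by blast
    next
      case (Cons i is')
      then have "(is', l, js) \<in> marked_compositions (m - i)" "i \<in> {1..m}"
        using x by (auto simp: marked_compositions_def bimarked_compositions_def)
      then show ?thesis unfolding x Cons by force
    qed
  qed (auto simp: compositions_def marked_compositions_def)
  let ?f = "\<lambda>(is, l, js). f is l js"
  have "sum ?f ?R = (\<Sum>i=1..m. \<Sum>js\<in>compositions (m - i). f [] i js)"
    by (subst sum_first_part[OF finite_compositions _ refl]) (auto simp: inj_def)
  moreover have "sum ?f ?Q = (\<Sum>i=1..m. \<Sum>(is, l, js)\<in>marked_compositions (m - i). f (i # is) l js)"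
    by (subst sum_first_part[OF finite_marked _ refl]) (auto simp: inj_def intro!: sum.cong)
  moreover have "sum ?f (marked_compositions m) = sum ?f ?R + sum ?f ?Q"
    unfolding split by (rule sum.union_disjoint) (auto simp: finite_compositions intro!: finite_imageI finite_marked)
  ultimately show ?thesis by (simp add: sum.distrib add.commute)
qed

lemma sum_bimarked:
  fixes f :: "nat list \<Rightarrow> nat \<Rightarrow> nat list \<Rightarrow> nat \<Rightarrow> nat list \<Rightarrow> 'c::ab_group_add"
  shows "(\<Sum>(is, l1, js, l2, ks)\<in>bimarked_compositions m. f is l1 js l2 ks)
    = (\<Sum>i=1..m. (\<Sum>(is, l1, js, l2, ks)\<in>bimarked_compositions (m - i). f (i # is) l1 js l2 ks)
        + (\<Sum>(js, l2, ks)\<in>marked_compositions (m - i). f [] i js l2 ks))"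
proof -
  let ?R = "\<Union>i\<in>{1..m}. (\<lambda>(js, l2, ks). ([], i, js, l2, ks)) ` marked_compositions (m - i)"
  let ?Q = "\<Union>i\<in>{1..m}. (\<lambda>(is, l1, js, l2, ks). (i # is, l1, js, l2, ks)) ` bimarked_compositions (m - i)"
  have split: "bimarked_compositions m = ?R \<union> ?Q"
  proof (intro equalityI subsetI)
    fix x assume "x \<in> bimarked_compositions m"
    then obtain "is" l1 js l2 ks where x: "x = (is, l1, js, l2, ks)" "0 \<notin> set (is @ [l1] @ js @ [l2] @ ks)"
      "sum_list (is @ [l1] @ js @ [l2] @ ks) = m" by (auto simp: bimarked_compositions_def)
    show "x \<in> ?R \<union> ?Q"
    proof (cases "is")
      case Nil
      then have "(js, l2, ks) \<in> marked_compositions (m - l1)" "l1 \<in> {1..m}"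
        using x by (auto simp: marked_compositions_def bimarked_compositions_def)
      then show ?thesis unfolding x Nil by force
    next
      case (Cons i is')
      then have "(is', l1, js, l2, ks) \<in> bimarked_compositions (m - i)" "i \<in> {1..m}"
        using x by (auto simp: marked_compositions_def bimarked_compositions_def)
      then show ?thesis unfolding x Cons by force
    qed
  qed (auto simp: marked_compositions_def bimarked_compositions_def)
  let ?f = "\<lambda>(is, l1, js, l2, ks). f is l1 js l2 ks"
  have "sum ?f ?R = (\<Sum>i=1..m. \<Sum>(js, l2, ks)\<in>marked_compositions (m - i). f [] i js l2 ks)"
    by (subst sum_first_part[OF finite_marked _ refl]) (auto simp: inj_def intro!: sum.cong)
  moreover have "sum ?f ?Q = (\<Sum>i=1..m. \<Sum>(is, l1, js, l2, ks)\<in>bimarked_compositions (m - i). f (i # is) l1 js l2 ks)"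
    by (subst sum_first_part[OF finite_bimarked _ refl]) (auto simp: inj_def intro!: sum.cong)
  moreover have "sum ?f (bimarked_compositions m) = sum ?f ?R + sum ?f ?Q"
    unfolding split by (rule sum.union_disjoint) (auto intro!: finite_imageI finite_marked finite_bimarked)
  ultimately show ?thesis by (simp add: sum.distrib add.commute)
qed

lemma deg_sum_const [simp]: "sum_list (map (fst \<circ> (\<lambda>i. (0::int, i, F))) is) = 0" "deg_sum (map (\<lambda>i. (0, i, F)) is @ ws) = deg_sum ws"
  "deg_sum (map (\<lambda>i. (0, i, F)) is) = 0"
  by (induction "is") auto

lemma spread_0_eq_sum:
  "spread s F [] \<phi> xs = (\<Sum>is\<in>compositions (length xs). apply_word s \<phi> (map (\<lambda>i. (0, i, F)) is) xs)"
proof (induction xs arbitrary: \<phi> rule: length_induct)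
  case (1 xs)
  show ?case
    by (subst spread_rec, subst sum_compositions)
      (auto simp: cut_sum_eq_sum 1 intro!: sum.cong)
qed

lemma spread_1_eq_sum:
  "spread s F [(d, g)] \<phi> xs = (\<Sum>(is, l, js)\<in>marked_compositions (length xs).
      apply_word s \<phi> (map (\<lambda>i. (0, i, F)) is @ [(d, l, g)] @ map (\<lambda>j. (0, j, F)) js) xs)"
proof (induction xs arbitrary: \<phi> rule: length_induct)
  case (1 xs)
  show ?case
    by (subst spread_rec, subst sum_marked)
      (auto simp: cut_sum_eq_sum 1 spread_0_eq_sum intro!: sum.cong arg_cong2[where f="(+)"])
qed

lemma spread_2_eq_sum:
  "spread s F [(d, g), (d', g')] \<phi> xs = (\<Sum>(is, l1, js, l2, ks)\<in>bimarked_compositions (length xs).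
      apply_word s \<phi> (map (\<lambda>i. (0, i, F)) is @ [(d, l1, g)] @ map (\<lambda>j. (0, j, F)) js
         @ [(d', l2, g')] @ map (\<lambda>k. (0, k, F)) ks) xs)"
proof (induction xs arbitrary: \<phi> rule: length_induct)
  case (1 xs)
  show ?case
    by (subst spread_rec, subst sum_bimarked)
      (auto simp: cut_sum_eq_sum 1 spread_1_eq_sum intro!: sum.cong arg_cong2[where f="(+)"])
qed

lemma sum_triples:
  fixes h :: "nat \<Rightarrow> nat \<Rightarrow> nat \<Rightarrow> 'c::ab_group_add"
  shows "(\<Sum>(i1, i2, i3)\<in>{(i1, i2, i3). i1 + i2 + i3 = Suc m \<and> i2 \<ge> 1}. h i1 i2 i3)
   = (\<Sum>i=1..Suc m. h 0 i (Suc m - i))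
     + (\<Sum>(i1, i2, i3)\<in>{(i1, i2, i3). i1 + i2 + i3 = m \<and> i2 \<ge> 1}. h (Suc i1) i2 i3)"
proof -
  let ?P = "\<lambda>m. {(i1, i2, i3). i1 + i2 + i3 = m \<and> i2 \<ge> (1::nat)}"
  let ?R = "(\<lambda>i. (0::nat, i, Suc m - i)) ` {1..Suc m}"
  let ?Q = "(\<lambda>(i1, i2, i3). (Suc i1, i2, i3)) ` ?P m"
  let ?h = "\<lambda>(i1, i2, i3). h i1 i2 i3"
  have fin: "finite (?P m)" by (rule finite_subset[of _ "{..m} \<times> {..m} \<times> {..m}"]) auto
  have "?P (Suc m) = ?R \<union> ?Q"
  proof (intro equalityI subsetI)
    fix x assume "x \<in> ?P (Suc m)"
    then obtain i1 i2 i3 where x: "x = (i1, i2, i3)" "i1 + i2 + i3 = Suc m" "i2 \<ge> 1" by auto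
    show "x \<in> ?R \<union> ?Q"
    proof (cases i1)
      case 0
      then have "x = (0, i2, Suc m - i2)" "i2 \<in> {1..Suc m}" using x by auto
      then show ?thesis by blast
    next
      case (Suc k)
      then have "(k, i2, i3) \<in> ?P m" using x by (auto simp: marked_compositions_def bimarked_compositions_def)
      then show ?thesis unfolding x Suc by force
    qed
  qed auto
  then have "sum ?h (?P (Suc m)) = sum ?h ?R + sum ?h ?Q"
    by (simp only:) (rule sum.union_disjoint, use fin in auto)
  moreover have "sum ?h ?R = (\<Sum>i=1..Suc m. h 0 i (Suc m - i))"
    by (subst sum.reindex) (auto simp: inj_on_def)
  moreover have "sum ?h ?Q = (\<Sum>(i1, i2, i3)\<in>?P m. h (Suc i1) i2 i3)"
    by (subst sum.reindex) (auto simp: inj_on_def intro!: sum.cong)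
  ultimately show ?thesis by simp
qed

lemma apply_word_ids:
  fixes s :: "'a \<Rightarrow> 'a"
  shows "length xs = i \<Longrightarrow> apply_word s \<phi> (replicate i id_factor) xs = \<phi> xs"
proof (induction i arbitrary: xs \<phi>)
  case (Suc i)
  have "deg_sum (replicate i (id_factor :: int \<times> nat \<times> ('a list \<Rightarrow> 'a))) = 0" by (induction i) (auto simp: id_factor_def)
  with Suc show ?case by (cases xs) (auto simp: id_factor_def)
qed simp

lemma bar_eq_sum:
  fixes s :: "'a \<Rightarrow> 'a" and \<phi> :: "'a list \<Rightarrow> 'c::ab_group_add"
  shows "bar s b \<phi> xs = (\<Sum>(i1, i2, i3) \<in> {(i1, i2, i3). i1 + i2 + i3 = length xs \<and> i2 \<ge> 1}.
        apply_word s \<phi> (replicate i1 id_factor @ [(1, i2, b)] @ replicate i3 id_factor) xs)"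
proof (induction xs arbitrary: \<phi>)
  case Nil
  have "{(i1, i2, i3). i1 + i2 + i3 = (0::nat) \<and> i2 \<ge> (1::nat)} = {}" by auto
  then show ?case by (simp only: list.size sum.empty bar.simps)
next
  case (Cons x xs)
  have ds: "deg_sum (replicate i (id_factor :: int \<times> nat \<times> ('a list \<Rightarrow> 'a))) = 0" for i
    by (induction i) (auto simp: id_factor_def)
  have id: "(id_factor :: int \<times> nat \<times> ('a list \<Rightarrow> 'a)) = (0, 1, hd)"
    by (simp add: id_factor_def)
  have "apply_word s \<phi> (replicate (Suc i1) id_factor @ [(1, i2, b)] @ replicate i3 id_factor) (x # xs)
      = apply_word s (\<lambda>ys. \<phi> (s x # ys)) (replicate i1 id_factor @ [(1, i2, b)] @ replicate i3 id_factor) xs" for i1 i2 i3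
    using ds[of i1] ds[of i3] by (simp add: id twist_def)
  moreover have "apply_word s \<phi> (replicate 0 id_factor @ [(1, i, b)] @ replicate (length (x # xs) - i) id_factor) (x # xs)
      = \<phi> (b (take i (x # xs)) # drop i (x # xs))" for i
    using ds by (simp add: apply_word_ids)
  moreover have "split_sum (\<lambda>us vs. \<phi> (b (x # us) # vs)) xs = cut_sum (\<lambda>us vs. \<phi> (b us # vs)) (x # xs)"
    by simp
  ultimately show ?case
    unfolding length_Cons sum_triples bar.simps Cons.IH cut_sum_eq_sum by simp
qed

section \<open>Overlapping partitions of a face\<close>

text \<open>
  Cutting off the first part \<open>I \<inter> {..m}\<close> leaves a partition of \<open>I \<inter> {m..}\<close>. When all parts are cut off,
  the last vertex of \<open>I\<close> is left over; hence \<open>card I = 1\<close> for the empty list.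
\<close>

fun chain_partition :: "nat set \<Rightarrow> nat set list \<Rightarrow> bool" where
  "chain_partition I [] \<longleftrightarrow> card I = 1"
| "chain_partition I (J # Js) \<longleftrightarrow> (\<exists>m\<in>I. J = I \<inter> {..m} \<and> chain_partition (I \<inter> {m..}) Js)"

text \<open>
  For consecutive parts \<open>J\<close> and \<open>J'\<close> one has \<open>Min J \<le> Max J = Min J'\<close>.
\<close>

lemma overlapping_partition_Min:
  assumes "\<forall>J\<in>set Js. J \<noteq> {} \<and> finite J" "\<forall>l. Suc l < length Js \<longrightarrow> Max (Js ! l) = Min (Js ! Suc l)"
    and "K \<in> set Js"
  shows "Min (hd Js) \<le> Min K"
  using assms
proof (induction Js)
  case (Cons J Js)
  show ?case
  proof (cases "Js = [] \<or> K = J")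
    case False
    then have K: "K \<in> set Js" and ne: "Js \<noteq> []" using Cons.prems(3) by auto
    have "\<forall>l. Suc l < length Js \<longrightarrow> Max (Js ! l) = Min (Js ! Suc l)"
      using Cons.prems(2) by (metis Suc_less_eq length_Cons nth_Cons_Suc)
    with Cons.IH K Cons.prems(1) have "Min (hd Js) \<le> Min K" by simp
    moreover have "Max J = Min (hd Js)"
      using Cons.prems(2)[rule_format, of 0] ne by (simp add: hd_conv_nth)
    moreover have "Min J \<le> Max J" using Cons.prems(1) by simp
    ultimately show ?thesis by simp
  qed (use Cons.prems in auto)
qed simp

text \<open>
  Consecutive parts meet in one vertex \<open>m\<close> and the parts cover \<open>I\<close>; so the first one contains all
  vertices up to \<open>m\<close> and the others cover the vertices from \<open>m\<close> on.
\<close>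

lemma overlapping_partition_iff_chain_partition:
  assumes "finite I" "Js \<noteq> []"
  shows "overlapping_partition I Js \<longleftrightarrow> chain_partition I Js"
  using assms
proof (induction Js arbitrary: I)
  case (Cons J Js)
  note fin = Cons.prems(1)
  show ?case
  proof (cases Js)
    case Nil
    have "overlapping_partition I [J] \<longleftrightarrow> J = I \<and> I \<noteq> {}" by (auto simp: overlapping_partition_def)
    also have "\<dots> \<longleftrightarrow> chain_partition I [J]"
    proof
      assume J: "J = I \<and> I \<noteq> {}"
      then have M: "Max I \<in> I" "I \<inter> {..Max I} = I" "I \<inter> {Max I..} = {Max I}"
        using fin by (auto intro: antisym Max_in)
      then have "card (I \<inter> {Max I..}) = 1" by simp
      with M J show "chain_partition I [J]" unfolding chain_partition.simps by blast
    next
      assume "chain_partition I [J]"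
      then obtain m where m: "m \<in> I" "J = I \<inter> {..m}" "card (I \<inter> {m..}) = 1" by auto
      have "I \<inter> {m..} = {m}"
        using m(1,3) by (metis IntI atLeast_iff card_1_singletonE order_refl singletonD)
      then have "x \<le> m" if "x \<in> I" for x
        using that by (metis IntI atLeast_iff nat_le_linear singletonD)
      then show "J = I \<and> I \<noteq> {}" using m(1,2) by blast
    qed
    finally show ?thesis unfolding Nil .
  next
    case (Cons J' Js')
    have IH: "overlapping_partition (I \<inter> {m..}) Js \<longleftrightarrow> chain_partition (I \<inter> {m..}) Js" for m
      using Cons.IH fin Cons by simp
    have tail: "Min J' \<le> Min K" if "overlapping_partition I' Js" "finite I'" "K \<in> set Js" for I' K
    proof -
      have "\<forall>J\<in>set Js. J \<noteq> {} \<and> finite J"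
        using that finite_subset unfolding overlapping_partition_def by blast
      then have "Min (hd Js) \<le> Min K"
        using that unfolding overlapping_partition_def by (intro overlapping_partition_Min) auto
      then show ?thesis by (simp add: Cons)
    qed
    show ?thesis
    proof
      assume op: "overlapping_partition I (J # Js)"
      then have parts: "K \<noteq> {}" "K \<subseteq> I" "finite K" if "K \<in> set (J # Js)" for K
        using that fin finite_subset unfolding overlapping_partition_def by blast+
      have un: "\<Union>(set (J # Js)) = I" using op unfolding overlapping_partition_def by blast
      have adj: "Max ((J # Js) ! l) = Min ((J # Js) ! Suc l)" if "Suc l < length (J # Js)" for l
        using op that unfolding overlapping_partition_def by blast
      have m: "Max J = Min J'" using adj[of 0] by (simp add: Cons)
      have op': "overlapping_partition (\<Union>(set Js)) Js"
        using parts adj[of "Suc _"] unfolding overlapping_partition_def by auto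
      have ge: "Max J \<le> x" if "x \<in> K" "K \<in> set Js" for x K
      proof -
        have "Min J' \<le> Min K" using tail[OF op' _ that(2)] parts by auto
        then show ?thesis using parts[of K] that by (metis Min_le list.set_intros(2) m order_trans)
      qed
      have pJ: "J \<noteq> {}" "J \<subseteq> I" "finite J" "J' \<noteq> {}" "finite J'"
        using parts[of J] parts[of J'] unfolding Cons by simp_all
      have MJ: "Max J \<in> J" "Max J \<in> J'" using Max_in[of J] Min_in[of J'] pJ m by simp_all
      have le: "x \<le> Max J" if "x \<in> J" for x using that pJ by simp
      have J: "J = I \<inter> {..Max J}"
      proof (intro equalityI subsetI)
        fix x assume x: "x \<in> I \<inter> {..Max J}"
        then obtain K where "K \<in> set (J # Js)" "x \<in> K" using un by auto
        then show "x \<in> J" using ge[of x K] x MJ(1) le by (cases "K = J") (auto dest: antisym)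
      qed (use le pJ in auto)
      have U: "\<Union>(set Js) = I \<inter> {Max J..}"
      proof (intro equalityI subsetI)
        fix x assume x: "x \<in> I \<inter> {Max J..}"
        then obtain K where "K \<in> set (J # Js)" "x \<in> K" using un by auto
        then show "x \<in> \<Union>(set Js)" using x MJ(2) le[of x] by (cases "K = J") (auto simp: Cons dest: antisym)
      qed (use ge un in auto)
      have "chain_partition (I \<inter> {Max J..}) Js" using op' unfolding U IH .
      then show "chain_partition I (J # Js)"
        unfolding chain_partition.simps using J MJ(1) pJ by blast
    next
      assume "chain_partition I (J # Js)"
      then obtain m where m: "m \<in> I" "J = I \<inter> {..m}" and c: "overlapping_partition (I \<inter> {m..}) Js"
        unfolding chain_partition.simps IH by blast
      have Mx: "Max J = m" unfolding m(2) by (rule Max_eqI) (use m(1) fin in auto)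
      have un: "\<Union>(set Js) = I \<inter> {m..}" using c unfolding overlapping_partition_def by blast
      obtain K where K: "K \<in> set Js" "m \<in> K" using un m(1) by auto
      have sub: "K' \<noteq> {} \<and> K' \<subseteq> I \<inter> {m..} \<and> finite K'" if "K' \<in> set Js" for K'
        using c that fin finite_subset[of _ "I \<inter> {m..}"] unfolding overlapping_partition_def by blast
      have "Min J' \<le> m" using tail[OF c _ K(1)] K(2) sub[OF K(1)] fin by (meson Min_le finite_Int order_trans)
      moreover have "Min J' \<in> J'" "J' \<subseteq> {m..}" using sub[of J'] by (auto simp: Cons)
      ultimately have Mn: "Min J' = m" by auto
      have "Max ((J # Js) ! l) = Min ((J # Js) ! Suc l)" if "Suc l < length (J # Js)" for l
      proof (cases l)
        case 0 then show ?thesis using Mx Mn by (simp add: Cons)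
      next
        case (Suc l') then show ?thesis using that c unfolding overlapping_partition_def by simp
      qed
      moreover have "\<Union>(set (J # Js)) = I"
      proof -
        have "\<Union>(set (J # Js)) = (I \<inter> {..m}) \<union> (I \<inter> {m..})" using un m(2) by simp
        then show ?thesis by auto
      qed
      moreover have "K \<noteq> {} \<and> K \<subseteq> I" if "K \<in> set (J # Js)" for K
        using that sub[of K] m by (cases "K = J") auto
      ultimately show "overlapping_partition I (J # Js)"
        unfolding overlapping_partition_def by blast
    qed
  qed
qed simp

lemma chain_partition_parts:
  "chain_partition I Js \<Longrightarrow> J \<in> set Js \<Longrightarrow> J \<subseteq> I"
  by (induction Js arbitrary: I) auto

lemma chain_partition_parts_nonempty:
  "chain_partition I Js \<Longrightarrow> J \<in> set Js \<Longrightarrow> J \<noteq> {}"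
  by (induction Js arbitrary: I) auto

lemma chain_partition_singleton: "chain_partition {a} Js \<longleftrightarrow> set Js \<subseteq> {{a}}"
proof (induction Js)
  case (Cons J Js)
  have "{a} \<inter> {..a} = {a}" "{a} \<inter> {a..} = {a}" by auto
  then show ?case using Cons by (auto simp: Cons.IH)
qed simp

lemma chain_partition_singletonD: "chain_partition {a} Js \<Longrightarrow> Js = replicate (length Js) {a}"
  unfolding chain_partition_singleton by (intro replicate_eqI) auto

text \<open>
  A cut happens at a vertex, so two neighbouring vertices are never separated.
\<close>

lemma chain_partition_adjacent:
  assumes "chain_partition I Js" "x \<in> I" "y \<in> I" "x < y" "\<And>z. z \<in> I \<Longrightarrow> z \<le> x \<or> y \<le> z"
  shows "\<exists>J\<in>set Js. x \<in> J \<and> y \<in> J"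
  using assms
proof (induction Js arbitrary: I)
  case Nil
  then show ?case by (auto simp: card_1_singleton_iff)
next
  case (Cons J Js)
  then obtain m where m: "m \<in> I" "J = I \<inter> {..m}" "chain_partition (I \<inter> {m..}) Js" by auto
  show ?case
  proof (cases "y \<le> m")
    case True then show ?thesis using m Cons.prems by auto
  next
    case False
    then have "m \<le> x" using Cons.prems(5)[OF m(1)] by simp
    then show ?thesis using Cons.IH[OF m(3)] Cons.prems by auto
  qed
qed

lemma adjacent_above:
  fixes I :: "nat set"
  assumes "finite I" "x \<in> I" "b \<in> I" "x < b"
  obtains y where "y \<in> I" "x < y" "y \<le> b" "\<And>z. z \<in> I \<Longrightarrow> z \<le> x \<or> y \<le> z"
proof
  let ?S = "{z \<in> I. x < z}"
  have "finite ?S" "b \<in> ?S" using assms by auto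
  then have "Min ?S \<in> ?S" using Min_in by blast
  then show "Min ?S \<in> I" "x < Min ?S" by auto
  show "Min ?S \<le> b" using \<open>finite ?S\<close> \<open>b \<in> ?S\<close> by simp
  show "z \<le> x \<or> Min ?S \<le> z" if "z \<in> I" for z
    using that \<open>finite ?S\<close> by (cases "z \<le> x") auto
qed

lemma chain_partition_card_ge_2:
  assumes "chain_partition I Js" "card I \<ge> 2"
  shows "\<exists>J\<in>set Js. card J \<ge> 2"
proof -
  have fin: "finite I" using assms(2) card.infinite by fastforce
  obtain x b where "x \<in> I" "b \<in> I" "x < b"
  proof -
    have "\<not> card I \<le> Suc 0" using assms(2) by simp
    then obtain x y where "x \<in> I" "y \<in> I" "x \<noteq> y" by (auto simp: card_le_Suc0_iff_eq[OF fin])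
    then show ?thesis using that[of x y] that[of y x] by (cases "x < y") auto
  qed
  then obtain y where y: "y \<in> I" "x < y" "\<And>z. z \<in> I \<Longrightarrow> z \<le> x \<or> y \<le> z"
    using adjacent_above[OF fin] by metis
  obtain J where J: "J \<in> set Js" "x \<in> J" "y \<in> J"
    using chain_partition_adjacent[OF assms(1) \<open>x \<in> I\<close> y(1,2,3)] by blast
  have "card {x, y} \<le> card J"
    using J chain_partition_parts[OF assms(1) J(1)] fin finite_subset by (intro card_mono) auto
  then show ?thesis using J(1) y(2) by (auto simp: numeral_2_eq_2)
qed

lemma chain_partition_replicate_Cons:
  assumes "finite I" "chain_partition I Js"
  shows "chain_partition I (replicate s {Min I} @ Js)"
proof (induction s)
  case (Suc s)
  have "I \<noteq> {}" using assms(2) by (cases Js) auto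
  then have M: "Min I \<in> I" "I \<inter> {..Min I} = {Min I}" "I \<inter> {Min I..} = I"
    using assms(1) by (auto intro: antisym Max_in Min_in)
  then show ?case
    using Suc unfolding replicate_Suc append_Cons chain_partition.simps by metis
qed (simp add: assms)

lemma chain_partition_full:
  assumes "finite I" "I \<noteq> {}"
  shows "chain_partition I (I # replicate t {Max I})"
proof -
  have M: "Max I \<in> I" "I \<inter> {..Max I} = I" "I \<inter> {Max I..} = {Max I}"
    using assms by (auto intro: antisym Max_in Min_in)
  have "chain_partition {Max I} (replicate t {Max I})"
    by (auto simp: chain_partition_singleton)
  with M show ?thesis
    unfolding chain_partition.simps by metis
qed

lemma first_part_cases:
  assumes "finite I" "m \<in> (I :: nat set)"
  shows "card (I \<inter> {..m}) = 1 \<longleftrightarrow> m = Min I" "I \<inter> {..m} = I \<longleftrightarrow> m = Max I"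
    "card (I \<inter> {..m}) + card (I \<inter> {m..}) = card I + 1"
    "I \<inter> {..Min I} = {Min I}" "I \<inter> {Min I..} = I" "I \<inter> {Max I..} = {Max I}"
proof -
  have ne: "I \<noteq> {}" using assms by auto
  show mn: "I \<inter> {..Min I} = {Min I}" "I \<inter> {Min I..} = I" "I \<inter> {Max I..} = {Max I}"
    using assms ne by (auto intro: antisym Max_in Min_in)
  show "card (I \<inter> {..m}) = 1 \<longleftrightarrow> m = Min I"
  proof
    assume "card (I \<inter> {..m}) = 1"
    moreover have "Min I \<in> I \<inter> {..m}" "m \<in> I \<inter> {..m}" using assms ne by auto
    ultimately show "m = Min I" by (metis card_1_singletonE singletonD)
  qed (simp add: mn)
  show "I \<inter> {..m} = I \<longleftrightarrow> m = Max I"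
  proof
    assume "I \<inter> {..m} = I"
    then have "x \<le> m" if "x \<in> I" for x using that by auto
    then show "m = Max I" using assms by (intro Max_eqI[symmetric]) auto
  qed (use assms in auto)
  have "card (I \<inter> {..m}) + card (I \<inter> {m..}) = card ((I \<inter> {..m}) \<union> (I \<inter> {m..})) + card ((I \<inter> {..m}) \<inter> (I \<inter> {m..}))"
    by (rule card_Un_Int) (use assms in auto)
  also have "(I \<inter> {..m}) \<union> (I \<inter> {m..}) = I" by auto
  also have "(I \<inter> {..m}) \<inter> (I \<inter> {m..}) = {m}" using assms by auto
  finally show "card (I \<inter> {..m}) + card (I \<inter> {m..}) = card I + 1" by simp
qed

text \<open>
  The parts other than vertices have at least \<open>k\<close> elements, and \<open>2 * k > card I + 1\<close> leaves no room
  for two of them: their dimensions would add up to more than the dimension of \<open>I\<close>. Nor can a large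
  proper part be completed by vertices alone, as these do not cover an interval.
\<close>

lemma chain_partition_one_large_part:
  assumes "chain_partition I Js" "finite I" "card I \<ge> 2" "2 * k > card I + 1"
    and "\<And>J. J \<in> set Js \<Longrightarrow> card J = 1 \<or> card J \<ge> k"
  shows "\<exists>s t. Js = replicate s {Min I} @ [I] @ replicate t {Max I}"
  using assms(1,5)
proof (induction Js)
  case Nil
  then show ?case using assms(3) by simp
next
  case (Cons J Js)
  then obtain m where m: "m \<in> I" "J = I \<inter> {..m}" "chain_partition (I \<inter> {m..}) Js" by auto
  note fp = first_part_cases[OF assms(2) m(1)]
  show ?case
  proof (cases "card J = 1")
    case True
    then have "m = Min I" using fp m by simp
    then have "J = {Min I}" "chain_partition I Js" using fp m by simp_all
    then obtain s t where "Js = replicate s {Min I} @ [I] @ replicate t {Max I}"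
      using Cons by (auto dest: Cons.IH)
    then show ?thesis using \<open>J = {Min I}\<close> by (metis append_Cons replicate_Suc)
  next
    case False
    then have k: "card J \<ge> k" using Cons.prems(2)[of J] by simp
    have "m = Max I"
    proof (rule ccontr)
      assume "m \<noteq> Max I"
      then have "J \<noteq> I" using fp m by simp
      then have "card J < card I" using m(2) assms(2) by (simp add: psubset_card_mono psubset_eq)
      then have "card (I \<inter> {m..}) \<ge> 2" "card (I \<inter> {m..}) < k" using fp(3) m(2) k assms(4) by auto
      then obtain J' where J': "J' \<in> set Js" "card J' \<ge> 2"
        using chain_partition_card_ge_2[OF m(3)] by blast
      have "card J' \<le> card (I \<inter> {m..})"
        using chain_partition_parts[OF m(3) J'(1)] assms(2) by (intro card_mono) auto
      then show False using J' \<open>card (I \<inter> {m..}) < k\<close> Cons.prems(2)[of J'] by auto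
    qed
    then have "J = I" "Js = replicate (length Js) {Max I}"
      using fp m chain_partition_singletonD[of "Max I" Js] by (blast, metis)
    then show ?thesis by (metis append_Cons append_Nil replicate_0)
  qed
qed

lemma chain_partition_marked:
  assumes "finite I" "I \<noteq> {}"
  shows "chain_partition I (replicate s {Min I} @ [I] @ replicate t {Max I})"
  using chain_partition_replicate_Cons[OF assms(1) chain_partition_full[OF assms]] by simp

lemma triangle_Int:
  assumes "a < b" "b < (c::nat)"
  shows "{a,b,c} \<inter> {..a} = {a}" "{a,b,c} \<inter> {..b} = {a,b}" "{a,b,c} \<inter> {..c} = {a,b,c}"
    "{a,b,c} \<inter> {a..} = {a,b,c}" "{a,b,c} \<inter> {b..} = {b,c}" "{a,b,c} \<inter> {c..} = {c}"
    "Min {a,b,c} = a" "Max {a,b,c} = c" "Min {b,c} = b" "Max {b,c} = c"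
  using assms by auto

text \<open>
  The first part is the vertex \<open>a\<close>, the edge \<open>{a, b}\<close> or the whole triangle; after the edge, a
  partition of \<open>{b, c}\<close> is left, which needs this edge as a part.
\<close>

lemma chain_partition_triangle:
  fixes a b c :: nat
  assumes "a < b" "b < c"
  shows "chain_partition {a,b,c} Js \<longleftrightarrow>
     (\<exists>s t. Js = replicate s {a} @ [{a,b,c}] @ replicate t {c})
     \<or> (\<exists>s t u. Js = replicate s {a} @ [{a,b}] @ replicate t {b} @ [{b,c}] @ replicate u {c})"
    (is "_ \<longleftrightarrow> ?R Js")
proof -
  note ti = triangle_Int[OF assms]
  have edge: "\<exists>t u. Js = replicate t {b} @ [{b,c}] @ replicate u {c}" if "chain_partition {b,c} Js" for Js
  proof -
    have card: "card {b,c} = 2" using assms by simp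
    have "card J = 1 \<or> card J \<ge> 2" if "J \<in> set Js" for J
    proof -
      have "card J \<noteq> 0"
        using chain_partition_parts[OF \<open>chain_partition {b,c} Js\<close> that]
          chain_partition_parts_nonempty[OF \<open>chain_partition {b,c} Js\<close> that]
        by (metis card_0_eq finite.emptyI finite.insertI finite_subset)
      then show ?thesis by linarith
    qed
    then have "\<exists>s t. Js = replicate s {Min {b,c}} @ [{b,c}] @ replicate t {Max {b,c}}"
      by (intro chain_partition_one_large_part[OF that, of 2]) (use card in auto)
    then show ?thesis unfolding ti .
  qed
  have "?R Js" if "chain_partition {a,b,c} Js" for Js
    using that
  proof (induction Js)
    case Nil then show ?case using assms by simp
  next
    case (Cons J Js)
    then obtain m where m: "m \<in> {a,b,c}" "J = {a,b,c} \<inter> {..m}" "chain_partition ({a,b,c} \<inter> {m..}) Js"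
      unfolding chain_partition.simps by blast
    then consider "m = a" | "m = b" | "m = c" by blast
    then show ?case
    proof cases
      case 1
      have J: "J = {a}" using m(2) unfolding 1 ti .
      have "?R Js" by (rule Cons.IH) (use m(3) in \<open>simp only: 1 ti\<close>)
      then show ?thesis unfolding J by (metis append_Cons replicate_Suc)
    next
      case 2
      have J: "J = {a,b}" using m(2) unfolding 2 ti .
      have "chain_partition {b,c} Js" using m(3) unfolding 2 ti .
      from edge[OF this] show ?thesis unfolding J by (metis append_Cons append_Nil replicate_0)
    next
      case 3
      have J: "J = {a,b,c}" using m(2) unfolding 3 ti .
      have "chain_partition {c} Js" using m(3) unfolding 3 ti .
      from chain_partition_singletonD[OF this] show ?thesis
        unfolding J by (metis append_Cons append_Nil replicate_0)
    qed
  qed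
  moreover have "chain_partition {a,b,c} (replicate s {a} @ [{a,b,c}] @ replicate t {c})" for s t
    using chain_partition_marked[of "{a,b,c}" s t] unfolding ti by blast
  moreover have "chain_partition {a,b,c} (replicate s {a} @ [{a,b}] @ replicate t {b} @ [{b,c}] @ replicate u {c})" for s t u
  proof -
    have "chain_partition {b,c} (replicate t {b} @ [{b,c}] @ replicate u {c})"
      using chain_partition_marked[of "{b,c}" t u] unfolding ti by blast
    then have "chain_partition {a,b,c} ({a,b} # replicate t {b} @ [{b,c}] @ replicate u {c})"
      unfolding chain_partition.simps using ti by (intro bexI[of _ b]) auto
    from chain_partition_replicate_Cons[OF _ this, of s] show ?thesis unfolding ti append_Cons append_Nil by blast
  qed
  ultimately show ?thesis by metis
qed

lemma chain_partition_image:
  assumes "strict_mono_on I \<alpha>"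
  shows "{Ks. chain_partition (\<alpha> ` I) Ks} = map ((`) \<alpha>) ` {Js. chain_partition I Js}"
proof -
  have Int: "\<alpha> ` (I \<inter> {..m}) = \<alpha> ` I \<inter> {..\<alpha> m}" "\<alpha> ` (I \<inter> {m..}) = \<alpha> ` I \<inter> {\<alpha> m..}"
    if "m \<in> I" "strict_mono_on I \<alpha>" for I m
    using that by (auto simp: strict_mono_on_leD strict_mono_on_less_eq)
  have sub: "strict_mono_on (I \<inter> {m..}) \<alpha>" if "strict_mono_on I \<alpha>" for I m
    using that by (auto simp: strict_mono_on_def)
  have "chain_partition (\<alpha> ` I) (map ((`) \<alpha>) Js)" if "chain_partition I Js" "strict_mono_on I \<alpha>" for Js I
    using that
  proof (induction Js arbitrary: I)
    case Nil then show ?case by (simp add: card_image strict_mono_on_imp_inj_on)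
  next
    case (Cons J Js)
    then obtain m where m: "m \<in> I" "J = I \<inter> {..m}" "chain_partition (I \<inter> {m..}) Js" by auto
    from Cons.IH[OF m(3) sub[OF Cons.prems(2)]] show ?case
      using m Int[OF m(1) Cons.prems(2)] by auto
  qed
  moreover have "\<exists>Js. chain_partition I Js \<and> Ks = map ((`) \<alpha>) Js" if "chain_partition (\<alpha> ` I) Ks" "strict_mono_on I \<alpha>" for Ks I
    using that
  proof (induction Ks arbitrary: I)
    case Nil then show ?case by (simp add: card_image strict_mono_on_imp_inj_on)
  next
    case (Cons K Ks)
    then obtain m where m: "m \<in> I" "K = \<alpha> ` I \<inter> {..\<alpha> m}" "chain_partition (\<alpha> ` I \<inter> {\<alpha> m..}) Ks" by auto
    then obtain Js where "chain_partition (I \<inter> {m..}) Js" "Ks = map ((`) \<alpha>) Js"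
      using Cons.IH[OF _ sub[OF Cons.prems(2), of m]] Int(2)[OF m(1) Cons.prems(2)] by auto
    then show ?case using m Int(1)[OF m(1) Cons.prems(2)]
      by (intro exI[of _ "(I \<inter> {..m}) # Js"]) auto
  qed
  ultimately show ?thesis using assms by blast
qed

section \<open>Partition sums of families with few nonzero faces\<close>

lemma after_tensor_Cons:
  "after_tensor \<phi> ((d, i, f) # fs) es xs = with_sign (deg_sum fs * sum_list (take i es))
     (after_tensor (\<lambda>ys. \<phi> (f (take i xs) # ys)) fs (drop i es) (drop i xs))"
  by (cases "koszul_tensor fs (drop i es) (drop i xs)") (simp add: after_tensor_def add.commute)

lemma after_tensor_zero_letter:
  fixes \<phi> :: "'b::ab_group_add list \<Rightarrow> 'c::ab_group_add"
  assumes "multiadditive \<phi>" "(d, i, \<lambda>_. 0) \<in> set (fs :: (int \<times> nat \<times> ('a list \<Rightarrow> 'b)) list)"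
  shows "after_tensor \<phi> fs es xs = 0"
  using assms
proof (induction fs arbitrary: \<phi> es xs)
  case (Cons w fs)
  obtain d' i' f' where w: "w = (d', i', f')" by (cases w) auto
  show ?case
  proof (cases "(d, i, \<lambda>_. 0) \<in> set fs")
    case True
    then show ?thesis
      using Cons.IH multiadditive_Cons[OF Cons.prems(1)] by (simp add: w after_tensor_Cons)
  next
    case False
    then have f': "f' = (\<lambda>_. 0)" using Cons.prems(2) w by auto
    have "after_tensor (\<lambda>_ :: 'b list. 0 :: 'c) fs es' xs' = 0" for es' xs'
      by (simp add: after_tensor_def split: prod.split)
    then show ?thesis
      by (simp add: w f' after_tensor_Cons additive_zero[OF multiadditive_head[OF Cons.prems(1)]])
  qed
qed simp

abbreviation labelled_partitions :: "nat set \<Rightarrow> nat \<Rightarrow> (nat \<times> nat set) list set" where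
  "labelled_partitions I m \<equiv> {ps. 0 \<notin> set (map fst ps) \<and> sum_list (map fst ps) = m \<and>
                 overlapping_partition I (map snd ps)}"

lemma finite_labelled_partitions:
  assumes "finite I" shows "finite (labelled_partitions I m)"
proof (rule finite_subset)
  show "labelled_partitions I m \<subseteq> {ps. set ps \<subseteq> {..m} \<times> Pow I \<and> length ps \<le> m}"
  proof
    fix ps assume "ps \<in> labelled_partitions I m"
    then have ps: "0 \<notin> set (map fst ps)" "overlapping_partition I (map snd ps)" "sum_list (map fst ps) = m"
      by blast+
    have "p \<in> {..m} \<times> Pow I" if "p \<in> set ps" for p
    proof -
      have "fst p \<in> set (map fst ps)" "snd p \<in> set (map snd ps)" using that by auto
      then have "fst p \<le> m" "snd p \<subseteq> I"
        using ps(2,3) member_le_sum_list unfolding overlapping_partition_def by blast+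
      then show ?thesis by (cases p) simp
    qed
    moreover have "length ps \<le> m"
      using length_le_sum_list[OF ps(1)] ps(3) by simp
    ultimately show "ps \<in> {ps. set ps \<subseteq> {..m} \<times> Pow I \<and> length ps \<le> m}" by blast
  qed
  show "finite {ps. set ps \<subseteq> {..m} \<times> Pow I \<and> length ps \<le> m}"
    by (rule finite_lists_length_le) (simp add: assms)
qed

text \<open>
  For \<open>m > 0\<close> the list is nonempty, and the two notions of partition agree.
\<close>

lemma labelled_partition_iff:
  assumes "finite I" "m > 0"
  shows "ps \<in> labelled_partitions I m \<longleftrightarrow>
    0 \<notin> set (map fst ps) \<and> sum_list (map fst ps) = m \<and> chain_partition I (map snd ps)"
proof (cases "ps = []")
  case False
  then show ?thesis using overlapping_partition_iff_chain_partition[OF assms(1), of "map snd ps"] by auto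
qed (use assms in auto)

lemma labelled_replicate:
  assumes "map snd ps = replicate s A" shows "ps = map (\<lambda>i. (i, A)) (map fst ps)"
  using assms
proof (induction ps arbitrary: s)
  case (Cons p ps)
  then obtain s' where "s = Suc s'" by (cases s) auto
  with Cons.prems Cons.IH[of s'] show ?case by (cases p) auto
qed simp

lemma marked_word_inj:
  assumes "map (\<lambda>i. (i, A)) is @ (l, I) # ys = map (\<lambda>i. (i, A)) is' @ (l', I) # ys'" "A \<noteq> I"
  shows "is = is' \<and> l = l' \<and> ys = ys'"
  using assms(1)
proof (induction "is" arbitrary: is')
  case Nil
  then show ?case using assms(2) by (cases is') auto
next
  case (Cons i "is")
  then show ?case using assms(2) by (cases is') auto
qed

lemma map_pair_inj: "map (\<lambda>i. (i, A)) is = map (\<lambda>i. (i, A)) js \<longleftrightarrow> is = js"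
  by (auto simp: inj_map_eq_map inj_def)

abbreviation word_of :: "(nat set \<Rightarrow> 'a list \<Rightarrow> 'b) \<Rightarrow> (nat \<times> nat set) list \<Rightarrow> (int \<times> nat \<times> ('a list \<Rightarrow> 'b)) list" where
  "word_of \<Phi> ps \<equiv> map (\<lambda>(i, J). (- int (face_dim J), i, \<Phi> J)) ps"

lemma face_dim_singleton [simp]: "face_dim {a} = 0"
  by (simp add: face_dim_def)

lemma partition_sum_vertex:
  assumes "xs \<noteq> []"
  shows "partition_sum B \<Phi> {a} es xs =
    (\<Sum>is\<in>compositions (length xs). after_tensor (ops B) (map (\<lambda>i. (0, i, \<Phi> {a})) is) es xs)"
proof -
  have "labelled_partitions {a} (length xs) = (map (\<lambda>i. (i, {a}))) ` compositions (length xs)"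
  proof (intro equalityI subsetI)
    fix ps assume "ps \<in> labelled_partitions {a} (length xs)"
    then have ps: "0 \<notin> set (map fst ps)" "sum_list (map fst ps) = length xs" "chain_partition {a} (map snd ps)"
      using labelled_partition_iff[of "{a}" "length xs" ps] assms by auto
    have "ps = map (\<lambda>i. (i, {a})) (map fst ps)"
      by (rule labelled_replicate[OF chain_partition_singletonD[OF ps(3)]])
    then show "ps \<in> (map (\<lambda>i. (i, {a}))) ` compositions (length xs)"
      using ps(1,2) by (auto simp: compositions_def intro!: image_eqI[of _ _ "map fst ps"])
  next
    fix ps assume "ps \<in> (map (\<lambda>i. (i, {a}))) ` compositions (length xs)"
    then show "ps \<in> labelled_partitions {a} (length xs)"
      using assms by (subst labelled_partition_iff) (auto simp: compositions_def comp_def chain_partition_singleton)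
  qed
  moreover have "inj_on (map (\<lambda>i. (i, {a}))) X" for X :: "nat list set"
    by (simp add: inj_on_def map_pair_inj)
  ultimately show ?thesis
    by (simp add: partition_sum_def sum.reindex comp_def)
qed

definition marked_partition :: "nat set \<Rightarrow> nat list \<times> nat \<times> nat list \<Rightarrow> (nat \<times> nat set) list" where
  "marked_partition I = (\<lambda>(is, l, js). map (\<lambda>i. (i, {Min I})) is @ [(l, I)] @ map (\<lambda>j. (j, {Max I})) js)"

lemma marked_partition_snd:
  "map snd (marked_partition I (is, l, js)) = replicate (length is) {Min I} @ [I] @ replicate (length js) {Max I}"
  by (simp add: marked_partition_def comp_def map_replicate_const)

lemma marked_partition_inj:
  assumes "card I \<noteq> 1" shows "inj_on (marked_partition I) X"
proof (rule inj_onI)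
  fix x y assume e: "marked_partition I x = marked_partition I y"
  obtain "is" l js where x: "x = (is, l, js)" by (cases x) auto
  obtain is' l' js' where y: "y = (is', l', js')" by (cases y) auto
  have ne: "{Min I} \<noteq> I" using assms by (metis is_singletonI is_singleton_altdef)
  have e': "map (\<lambda>i. (i, {Min I})) is @ (l, I) # map (\<lambda>j. (j, {Max I})) js
      = map (\<lambda>i. (i, {Min I})) is' @ (l', I) # map (\<lambda>j. (j, {Max I})) js'"
    using e by (simp add: x y marked_partition_def)
  from marked_word_inj[OF e' ne] show "x = y"
    by (simp add: x y map_pair_inj)
qed

lemma marked_partition_surj:
  assumes "map snd ps = replicate s {Min I} @ [I] @ replicate t {Max I}"
    and "0 \<notin> set (map fst ps)" "sum_list (map fst ps) = m"
  shows "ps \<in> marked_partition I ` marked_compositions m"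
proof -
  obtain ps1 qs where ps: "ps = ps1 @ qs" "map snd ps1 = replicate s {Min I}" "map snd qs = [I] @ replicate t {Max I}"
    using assms(1) by (auto simp: map_eq_append_conv)
  then obtain l ps2 where qs: "qs = (l, I) # ps2" "map snd ps2 = replicate t {Max I}"
    by (cases qs) auto
  have "ps = marked_partition I (map fst ps1, l, map fst ps2)"
    unfolding ps(1) qs(1) marked_partition_def prod.case
    by (subst labelled_replicate[OF ps(2)], subst labelled_replicate[OF qs(2)]) simp
  moreover have "(map fst ps1, l, map fst ps2) \<in> marked_compositions m"
    using assms(2,3) unfolding ps(1) qs(1) marked_compositions_def by simp
  ultimately show ?thesis by blast
qed

lemma marked_partition_in:
  assumes "finite I" "I \<noteq> {}" "m > 0" "x \<in> marked_compositions m"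
  shows "marked_partition I x \<in> labelled_partitions I m"
proof -
  obtain "is" l js where x: "x = (is, l, js)" by (cases x) auto
  have "chain_partition I (map snd (marked_partition I x))"
    unfolding x marked_partition_snd by (rule chain_partition_marked[OF assms(1,2)])
  moreover have "0 \<notin> set (map fst (marked_partition I x))" "sum_list (map fst (marked_partition I x)) = m"
    using assms(4) unfolding x marked_compositions_def marked_partition_def by (auto simp: comp_def)
  ultimately show ?thesis
    using labelled_partition_iff[OF assms(1,3)] by blast
qed

lemma sum_marked_partition:
  assumes "card I \<noteq> 1" "\<Phi> {Min I} = F" "\<Phi> {Max I} = F"
  shows "(\<Sum>ps\<in>marked_partition I ` marked_compositions (length xs). after_tensor (ops B) (word_of \<Phi> ps) es xs)
    = one_sum B F (- int (face_dim I)) (\<Phi> I) es xs"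
  unfolding sum.reindex[OF marked_partition_inj[OF assms(1)]] one_sum_def marked_compositions_def
  by (rule sum.cong[OF refl]) (auto simp: marked_partition_def assms(2,3) comp_def)

text \<open>
  If \<open>\<Phi>\<close> vanishes on all faces of \<open>I\<close> with at least \<open>2\<close> and fewer than \<open>k\<close> vertices, only the partitions
  with \<open>I\<close> as a part survive; they are indexed by the marked compositions of \<open>one_sum\<close>.
\<close>

lemma partition_sum_one_large_part:
  fixes B :: "'b::ab_group_add ainf"
  assumes "finite I" "card I \<ge> 2" "2 * k > card I + 1" "xs \<noteq> []" "\<Phi> {Min I} = F" "\<Phi> {Max I} = F"
    and "\<And>J. J \<subseteq> I \<Longrightarrow> card J \<ge> 2 \<Longrightarrow> card J < k \<Longrightarrow> \<Phi> J = (\<lambda>_. 0)" and "multiadditive (ops B)"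
  shows "partition_sum B \<Phi> I es xs = one_sum B F (- int (face_dim I)) (\<Phi> I) es xs"
proof -
  let ?t = "\<lambda>ps. after_tensor (ops B) (word_of \<Phi> ps) es xs"
  have ne: "I \<noteq> {}" "card I \<noteq> 1" using assms(2) by auto
  have len: "length xs > 0" using assms(4) by simp
  have "sum ?t (labelled_partitions I (length xs)) = sum ?t (marked_partition I ` marked_compositions (length xs))"
  proof (rule sum.mono_neutral_right[OF finite_labelled_partitions[OF assms(1)]])
    show "marked_partition I ` marked_compositions (length xs) \<subseteq> labelled_partitions I (length xs)"
      using marked_partition_in[OF assms(1) ne(1) len] by blast
    show "\<forall>ps\<in>labelled_partitions I (length xs) - marked_partition I ` marked_compositions (length xs). ?t ps = 0"
    proof
      fix ps assume ps: "ps \<in> labelled_partitions I (length xs) - marked_partition I ` marked_compositions (length xs)"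
      then have p: "0 \<notin> set (map fst ps)" "sum_list (map fst ps) = length xs" "chain_partition I (map snd ps)"
        using labelled_partition_iff[OF assms(1) len] by blast+
      have "\<exists>J\<in>set (map snd ps). card J \<noteq> 1 \<and> card J < k"
      proof (rule ccontr)
        assume "\<not> ?thesis"
        then have "\<exists>s t. map snd ps = replicate s {Min I} @ [I] @ replicate t {Max I}"
          by (intro chain_partition_one_large_part[OF p(3) assms(1-3)]) (auto simp: not_less)
        then show False using marked_partition_surj[OF _ p(1,2)] ps by blast
      qed
      then obtain i J where J: "(i, J) \<in> set ps" "card J \<noteq> 1" "card J < k" by auto
      have Js: "J \<in> set (map snd ps)" using J(1) by force
      have "J \<subseteq> I" "J \<noteq> {}"
        using chain_partition_parts[OF p(3) Js] chain_partition_parts_nonempty[OF p(3) Js] by auto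
      moreover have "card J \<noteq> 0" using \<open>J \<noteq> {}\<close> finite_subset[OF \<open>J \<subseteq> I\<close> assms(1)] by simp
      ultimately have "\<Phi> J = (\<lambda>_. 0)" using assms(7)[of J] J by linarith
      then have "(- int (face_dim J), i, \<lambda>_. 0) \<in> set (word_of \<Phi> ps)" using J(1) by force
      then show "?t ps = 0" by (rule after_tensor_zero_letter[OF assms(8)])
    qed
  qed
  then show ?thesis
    unfolding partition_sum_def sum_marked_partition[OF ne(2) assms(5,6)] .
qed

definition bimarked_partition ::
  "nat \<Rightarrow> nat \<Rightarrow> nat \<Rightarrow> nat list \<times> nat \<times> nat list \<times> nat \<times> nat list \<Rightarrow> (nat \<times> nat set) list" where
  "bimarked_partition a b c = (\<lambda>(is, l1, js, l2, ks). map (\<lambda>i. (i, {a})) is @ [(l1, {a, b})]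
     @ map (\<lambda>j. (j, {b})) js @ [(l2, {b, c})] @ map (\<lambda>k. (k, {c})) ks)"

text \<open>
  The source of the quadratic term in the composition law for \<open>n = 1\<close>.
\<close>

lemma partition_sum_triangle:
  fixes B :: "'b::ab_group_add ainf" and a b c :: nat
  assumes abc: "a < b" "b < c" and "xs \<noteq> []" "\<Phi> {a} = F" "\<Phi> {b} = F" "\<Phi> {c} = F"
  shows "partition_sum B \<Phi> {a,b,c} es xs
    = one_sum B F (-2) (\<Phi> {a,b,c}) es xs + two_sum B F (\<Phi> {a,b}) (\<Phi> {b,c}) es xs"
proof -
  let ?I = "{a,b,c}" and ?m = "length xs"
  let ?t = "\<lambda>ps. after_tensor (ops B) (word_of \<Phi> ps) es xs"
  let ?M = "marked_partition ?I ` marked_compositions ?m"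
  let ?N = "bimarked_partition a b c ` bimarked_compositions ?m"
  note ti = triangle_Int[OF abc]
  have len: "?m > 0" using assms(3) by simp
  have card: "card ?I = 3" using abc by auto
  have eq: "labelled_partitions ?I ?m = ?M \<union> ?N"
  proof (intro equalityI subsetI)
    fix ps assume "ps \<in> labelled_partitions ?I ?m"
    then have p: "0 \<notin> set (map fst ps)" "sum_list (map fst ps) = ?m" "chain_partition ?I (map snd ps)"
      using labelled_partition_iff[of ?I ?m ps] len by blast+
    from p(3) consider s t where "map snd ps = replicate s {a} @ [?I] @ replicate t {c}"
      | s t u where "map snd ps = replicate s {a} @ [{a,b}] @ replicate t {b} @ [{b,c}] @ replicate u {c}"
      using chain_partition_triangle[OF abc] by blast
    then show "ps \<in> ?M \<union> ?N"
    proof cases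
      case 1
      then have "map snd ps = replicate s {Min ?I} @ [?I] @ replicate t {Max ?I}" unfolding ti .
      from marked_partition_surj[OF this p(1,2)] show ?thesis by blast
    next
      case 2
      then obtain ps1 qs where ps: "ps = ps1 @ qs" "map snd ps1 = replicate s {a}"
        "map snd qs = [{a,b}] @ replicate t {b} @ [{b,c}] @ replicate u {c}"
        by (auto simp: map_eq_append_conv)
      then obtain l1 qs' where qs: "qs = (l1, {a,b}) # qs'" "map snd qs' = replicate t {b} @ [{b,c}] @ replicate u {c}"
        by (cases qs) auto
      then obtain ps2 rs where qs': "qs' = ps2 @ rs" "map snd ps2 = replicate t {b}" "map snd rs = [{b,c}] @ replicate u {c}"
        by (auto simp: map_eq_append_conv)
      then obtain l2 ps3 where rs: "rs = (l2, {b,c}) # ps3" "map snd ps3 = replicate u {c}"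
        by (cases rs) auto
      have "ps = bimarked_partition a b c (map fst ps1, l1, map fst ps2, l2, map fst ps3)"
        unfolding ps(1) qs(1) qs'(1) rs(1) bimarked_partition_def prod.case
        by (subst labelled_replicate[OF ps(2)], subst labelled_replicate[OF qs'(2)], subst labelled_replicate[OF rs(2)]) simp
      moreover have "(map fst ps1, l1, map fst ps2, l2, map fst ps3) \<in> bimarked_compositions ?m"
        using p(1,2) unfolding ps(1) qs(1) qs'(1) rs(1) bimarked_compositions_def by simp
      ultimately show ?thesis by blast
    qed
  next
    fix ps assume "ps \<in> ?M \<union> ?N"
    then show "ps \<in> labelled_partitions ?I ?m"
    proof
      assume "ps \<in> ?M"
      then show ?thesis using marked_partition_in[of ?I ?m] len by blast
    next
      assume "ps \<in> ?N"
      then obtain "is" l1 js l2 ks where ps: "ps = bimarked_partition a b c (is, l1, js, l2, ks)"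
        and x: "(is, l1, js, l2, ks) \<in> bimarked_compositions ?m" by auto
      have "map snd ps = replicate (length is) {a} @ [{a,b}] @ replicate (length js) {b} @ [{b,c}] @ replicate (length ks) {c}"
        by (simp add: ps bimarked_partition_def comp_def map_replicate_const)
      then have "chain_partition ?I (map snd ps)"
        using chain_partition_triangle[OF abc] by blast
      moreover have "0 \<notin> set (map fst ps)" "sum_list (map fst ps) = ?m"
        using x unfolding ps bimarked_compositions_def bimarked_partition_def by (auto simp: comp_def)
      ultimately show ?thesis using labelled_partition_iff[of ?I ?m ps] len by blast
    qed
  qed
  have disj: "?M \<inter> ?N = {}"
  proof -
    have "?I \<in> snd ` set ps" if "ps \<in> ?M" for ps
      using that by (auto simp: marked_partition_def)
    moreover have "?I \<notin> snd ` set ps" if "ps \<in> ?N" for ps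
      using that abc by (auto simp: bimarked_partition_def) (metis insertE insertI1 insertI2 less_irrefl order_less_trans singletonD)+
    ultimately show ?thesis by blast
  qed
  have inj: "inj_on (bimarked_partition a b c) X" for X
  proof (rule inj_onI)
    fix x y assume e: "bimarked_partition a b c x = bimarked_partition a b c y"
    obtain "is" l1 js l2 ks where x: "x = (is, l1, js, l2, ks)" by (cases x) auto
    obtain is' l1' js' l2' ks' where y: "y = (is', l1', js', l2', ks')" by (cases y) auto
    have ne: "{a} \<noteq> {a,b}" "{b} \<noteq> {b,c}" using abc by auto
    have 1: "is = is' \<and> l1 = l1' \<and> map (\<lambda>j. (j, {b})) js @ (l2, {b, c}) # map (\<lambda>k. (k, {c})) ks
       = map (\<lambda>j. (j, {b})) js' @ (l2', {b, c}) # map (\<lambda>k. (k, {c})) ks'"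
      by (rule marked_word_inj[OF _ ne(1)]) (use e in \<open>simp add: x y bimarked_partition_def\<close>)
    then have "js = js' \<and> l2 = l2' \<and> map (\<lambda>k. (k, {c})) ks = map (\<lambda>k. (k, {c})) ks'"
      by (intro marked_word_inj[OF _ ne(2)]) blast
    with 1 show "x = y" by (simp add: x y map_pair_inj)
  qed
  have fd: "face_dim {a,b} = 1" "face_dim {b,c} = 1" "face_dim ?I = 2"
    using abc card by (auto simp: face_dim_def)
  have "sum ?t ?M = one_sum B F (-2) (\<Phi> ?I) es xs"
    using sum_marked_partition[of ?I \<Phi> F B es xs] assms(4-6) unfolding ti card fd by simp
  moreover have "sum ?t ?N = two_sum B F (\<Phi> {a,b}) (\<Phi> {b,c}) es xs"
    unfolding sum.reindex[OF inj] two_sum_def bimarked_compositions_def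
    by (rule sum.cong[OF refl]) (auto simp: bimarked_partition_def assms(4-6) fd comp_def)
  moreover have "partition_sum B \<Phi> ?I es xs = sum ?t ?M + sum ?t ?N"
    unfolding partition_sum_def eq
    by (rule sum.union_disjoint[OF _ _ disj]) (simp_all add: finite_marked finite_bimarked)
  ultimately show ?thesis by simp
qed

lemma partition_sum_image:
  assumes "finite I" "strict_mono_on I \<alpha>" "xs \<noteq> []"
  shows "partition_sum B \<Phi> (\<alpha> ` I) es xs = partition_sum B (\<lambda>J. \<Phi> (\<alpha> ` J)) I es xs"
proof -
  let ?m = "length xs" and ?r = "map (\<lambda>(i, J). (i, \<alpha> ` J))"
  have len: "?m > 0" and fin: "finite (\<alpha> ` I)" using assms by auto
  have inj: "inj_on \<alpha> I" by (rule strict_mono_on_imp_inj_on[OF assms(2)])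
  have sub: "snd p \<subseteq> I" if "ps \<in> labelled_partitions I ?m" "p \<in> set ps" for ps p
    using that unfolding overlapping_partition_def by auto
  have img: "labelled_partitions (\<alpha> ` I) ?m = ?r ` labelled_partitions I ?m"
  proof (intro equalityI subsetI)
    fix ps assume "ps \<in> labelled_partitions (\<alpha> ` I) ?m"
    then have p: "0 \<notin> set (map fst ps)" "sum_list (map fst ps) = ?m" "chain_partition (\<alpha> ` I) (map snd ps)"
      using labelled_partition_iff[OF fin len, of ps] by blast+
    obtain Js where Js: "chain_partition I Js" "map snd ps = map ((`) \<alpha>) Js"
      using p(3) chain_partition_image[OF assms(2)] by blast
    have l: "length Js = length ps" using arg_cong[OF Js(2), of length] by simp
    have z: "map fst (zip (map fst ps) Js) = map fst ps" "map snd (zip (map fst ps) Js) = Js"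
      using l by simp_all
    have "ps = ?r (zip (map fst ps) Js)"
    proof (rule nth_equalityI)
      fix i assume i: "i < length ps"
      have "snd (ps ! i) = \<alpha> ` (Js ! i)" using arg_cong[OF Js(2), of "\<lambda>x. x ! i"] i l by simp
      then show "ps ! i = ?r (zip (map fst ps) Js) ! i" using i l by (simp add: prod_eq_iff)
    qed (simp add: l)
    moreover have "zip (map fst ps) Js \<in> labelled_partitions I ?m"
      unfolding labelled_partition_iff[OF assms(1) len] z using p Js by blast
    ultimately show "ps \<in> ?r ` labelled_partitions I ?m" by blast
  next
    fix ps assume "ps \<in> ?r ` labelled_partitions I ?m"
    then obtain qs where qs: "qs \<in> labelled_partitions I ?m" "ps = ?r qs" by blast
    have m: "map fst ps = map fst qs" "map snd ps = map ((`) \<alpha>) (map snd qs)"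
      unfolding qs(2) by (auto simp: comp_def split_def)
    have "0 \<notin> set (map fst qs)" "sum_list (map fst qs) = ?m" "chain_partition I (map snd qs)"
      using qs(1) labelled_partition_iff[OF assms(1) len, of qs] by blast+
    then show "ps \<in> labelled_partitions (\<alpha> ` I) ?m"
      unfolding labelled_partition_iff[OF fin len] m using chain_partition_image[OF assms(2)] by blast
  qed
  have "inj_on ?r (labelled_partitions I ?m)"
  proof (rule inj_onI)
    fix ps qs assume ps: "ps \<in> labelled_partitions I ?m" and qs: "qs \<in> labelled_partitions I ?m" and e: "?r ps = ?r qs"
    have "inj_on (\<lambda>(i, J). (i, \<alpha> ` J)) (set ps \<union> set qs)"
    proof (rule inj_onI)
      fix p q assume p: "p \<in> set ps \<union> set qs" and q: "q \<in> set ps \<union> set qs"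
        and e: "(case p of (i, J) \<Rightarrow> (i, \<alpha> ` J)) = (case q of (i, J) \<Rightarrow> (i, \<alpha> ` J))"
      have "snd p \<subseteq> I" "snd q \<subseteq> I" using sub[OF ps] sub[OF qs] p q by blast+
      then show "p = q" using e inj_on_image_eq_iff[OF inj] by (auto simp: prod_eq_iff split: prod.splits)
    qed
    from map_inj_on[OF e this] show "ps = qs" .
  qed
  then have "partition_sum B \<Phi> (\<alpha> ` I) es xs
     = (\<Sum>ps\<in>labelled_partitions I ?m. after_tensor (ops B) (word_of \<Phi> (?r ps)) es xs)"
    unfolding partition_sum_def img by (simp only: sum.reindex comp_def)
  also have "\<dots> = partition_sum B (\<lambda>J. \<Phi> (\<alpha> ` J)) I es xs"
    unfolding partition_sum_def
  proof (rule sum.cong[OF refl])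
    fix ps assume ps: "ps \<in> labelled_partitions I ?m"
    have "face_dim (\<alpha> ` J) = face_dim J" if "J \<subseteq> I" for J
      using card_image[OF inj_on_subset[OF inj that]] by (simp add: face_dim_def)
    then have "word_of \<Phi> (?r ps) = word_of (\<lambda>J. \<Phi> (\<alpha> ` J)) ps"
      using sub[OF ps] by auto
    then show "after_tensor (ops B) (word_of \<Phi> (?r ps)) es xs
      = after_tensor (ops B) (word_of (\<lambda>J. \<Phi> (\<alpha> ` J)) ps) es xs" by (simp only:)
  qed
  finally show ?thesis .
qed

text \<open>
  Some part of every partition contains the neighbouring vertices \<open>x\<close> and \<open>y\<close>.
\<close>

lemma partition_sum_eq_zero:
  fixes B :: "'b::ab_group_add ainf"
  assumes "finite I" "xs \<noteq> []" "multiadditive (ops B)"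
    and xy: "x \<in> I" "y \<in> I" "x < y" "\<And>z. z \<in> I \<Longrightarrow> z \<le> x \<or> y \<le> z"
    and "\<And>J. J \<subseteq> I \<Longrightarrow> x \<in> J \<Longrightarrow> y \<in> J \<Longrightarrow> \<Phi> J = (\<lambda>_. 0)"
  shows "partition_sum B \<Phi> I es xs = 0"
  unfolding partition_sum_def
proof (rule sum.neutral, rule ballI)
  fix ps assume "ps \<in> labelled_partitions I (length xs)"
  then have c: "chain_partition I (map snd ps)"
    using labelled_partition_iff[OF assms(1), of "length xs" ps] assms(2) by blast
  obtain J where J: "J \<in> set (map snd ps)" "x \<in> J" "y \<in> J"
    using chain_partition_adjacent[OF c xy] by blast
  then obtain i where i: "(i, J) \<in> set ps" by auto
  have "\<Phi> J = (\<lambda>_. 0)" using assms(8)[OF chain_partition_parts[OF c J(1)] J(2,3)] .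
  then have "(- int (face_dim J), i, \<lambda>_. 0) \<in> set (word_of \<Phi> ps)" using i by force
  then show "after_tensor (ops B) (word_of \<Phi> ps) es xs = 0"
    by (rule after_tensor_zero_letter[OF assms(3)])
qed

section \<open>Collections as cycles, and their product\<close>

lemma multiadditive_bar:
  assumes "additive s" "multiadditive b" "multiadditive \<phi>"
  shows "multiadditive (bar s b \<phi>)"
proof -
  have "bar s b \<phi> (us @ (x + y) # vs) = bar s b \<phi> (us @ x # vs) + bar s b \<phi> (us @ y # vs)" for us vs x y
    using assms(3)
  proof (induction us arbitrary: \<phi>)
    case Nil
    have head: "additive (\<lambda>x. \<phi> (x # ys))" for ys using multiadditive_head[OF Nil] .
    have b: "b ((x + y) # us) = b (x # us) + b (y # us)" for us
      using additiveD[OF multiadditive_head[OF assms(2)]] .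
    show ?case
      by (simp add: b additiveD[OF head] additiveD[OF assms(1)] split_sum_add bar_add algebra_simps)
  next
    case (Cons u us)
    have head: "additive (\<lambda>x. \<phi> (x # ys))" for ys using multiadditive_head[OF Cons.prems] .
    have "multiadditive (split_sum (\<lambda>us vs. \<phi> (b (u # us) # vs)))"
    proof (rule split_sum_slot)
      show "multiadditive (\<lambda>us. \<phi> (b (u # us) # vs))" for vs
        by (rule multiadditive_comp[OF head multiadditive_Cons[OF assms(2)]])
      show "multiadditive (\<lambda>vs. \<phi> (b (u # us) # vs))" for us
        by (rule multiadditive_Cons[OF Cons.prems])
    qed
    then have "split_sum (\<lambda>us vs. \<phi> (b (u # us) # vs)) (us @ (x + y) # vs)
      = split_sum (\<lambda>us vs. \<phi> (b (u # us) # vs)) (us @ x # vs) + split_sum (\<lambda>us vs. \<phi> (b (u # us) # vs)) (us @ y # vs)"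
      by (simp add: multiadditive_def)
    then show ?case
      using Cons.IH[OF multiadditive_Cons[OF Cons.prems, of "s u"]] by (simp add: algebra_simps)
  qed
  then show ?thesis by (simp add: multiadditive_def)
qed

lemma ainf_algebraD:
  assumes "ainf_algebra A"
  shows "grading (comps A)" "multimap (susp (comps A)) (susp (comps A)) 1 (ops A)"
    "xs \<noteq> [] \<Longrightarrow> homog (susp (comps A)) es xs \<Longrightarrow> pre_sum A (ops A) es xs = 0"
  using assms by (auto simp: ainf_algebra_def)

lemma pre_sum_eq_bar:
  assumes A: "ainf_algebra A" and f: "multiadditive f" and h: "homog (susp (comps A)) es xs"
  shows "pre_sum A f es xs = bar (parity (comps A)) (ops A) f xs"
  unfolding pre_sum_def bar_eq_sum
proof (rule sum.cong[OF refl], clarify)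
  fix i1 i2 i3
  note G = ainf_algebraD(1)[OF A]
  have 1: "hd (map (parity (comps A)) us) = with_sign (sum_list es) (hd us)"
    if "homog (susp (comps A)) es us" "length us \<le> 1" for es us
    using that by (cases us) (auto simp: homog_def list_all2_Cons2 parity_homog[OF G])
  have 2: "ops A (map (parity (comps A)) us) = with_sign (sum_list es) (ops A us)"
    if "homog (susp (comps A)) es us" for es us
    using multiadditive_parity[OF G multimapD(2)[OF ainf_algebraD(2)[OF A]] that] .
  show "after_tensor f (replicate i1 id_factor @ [(1, i2, ops A)] @ replicate i3 id_factor) es xs
      = apply_word (parity (comps A)) f (replicate i1 id_factor @ [(1, i2, ops A)] @ replicate i3 id_factor) xs"
    by (rule after_tensor_eq_apply_word[OF G h f]) (use 1 2 in \<open>auto simp: id_factor_def\<close>)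
qed

lemma one_sum_eq_spread:
  assumes "grading (comps A)" "multiadditive F" "multiadditive G" "multiadditive (ops B)"
    and "homog (susp (comps A)) es xs"
  shows "one_sum B F d G es xs = spread (parity (comps A)) F [(d, G)] (ops B) xs"
  unfolding one_sum_def spread_1_eq_sum marked_compositions_def[symmetric]
  by (rule sum.cong[OF refl], clarify, rule after_tensor_eq_apply_word[OF assms(1,5,4)])
    (use multiadditive_parity[OF assms(1)] assms(2,3) in auto)

lemma two_sum_eq_spread:
  assumes "grading (comps A)" "multiadditive F" "multiadditive G" "multiadditive H" "multiadditive (ops B)"
    and "homog (susp (comps A)) es xs"
  shows "two_sum B F G H es xs = spread (parity (comps A)) F [(-1, G), (-1, H)] (ops B) xs"
  unfolding two_sum_def spread_2_eq_sum bimarked_compositions_def[symmetric]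
  by (rule sum.cong[OF refl], clarify, rule after_tensor_eq_apply_word[OF assms(1,6,5)])
    (use multiadditive_parity[OF assms(1)] assms(2-4) in auto)

lemma partition_sum_vertex_eq_spread:
  assumes "grading (comps A)" "multiadditive (\<Phi> {a})" "multiadditive (ops B)"
    and "homog (susp (comps A)) es xs" "xs \<noteq> []"
  shows "partition_sum B \<Phi> {a} es xs = spread (parity (comps A)) (\<Phi> {a}) [] (ops B) xs"
  unfolding partition_sum_vertex[OF assms(5)] spread_0_eq_sum
  by (rule sum.cong[OF refl], rule after_tensor_eq_apply_word[OF assms(1,4,3)])
    (use multiadditive_parity[OF assms(1)] assms(2) in auto)

lemma koszul_tensor_degree:
  assumes "homog S es xs" "\<forall>(d, i, f)\<in>set fs. multimap S T d f" "0 \<notin> set (map (fst \<circ> snd) fs)"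
    and "sum_list (map (fst \<circ> snd) fs) = length xs"
  shows "\<exists>es'. homog T es' (snd (koszul_tensor fs es xs)) \<and> sum_list es' = sum_list es + deg_sum fs"
  using assms
proof (induction fs arbitrary: es xs)
  case Nil
  then show ?case by (auto simp: homog_def)
next
  case (Cons w fs)
  obtain d i f where w: "w = (d, i, f)" by (cases w) auto
  have h: "homog S (take i es) (take i xs)" "homog S (drop i es) (drop i xs)"
    using Cons.prems(1) by (auto simp: homog_def list_all2_takeI list_all2_dropI)
  obtain es' where es': "homog T es' (snd (koszul_tensor fs (drop i es) (drop i xs)))"
    "sum_list es' = sum_list (drop i es) + deg_sum fs"
  proof -
    have "sum_list (map (fst \<circ> snd) fs) = length (drop i xs)"
      using Cons.prems(4) by (simp add: w comp_def)
    then show ?thesis using Cons.IH[OF h(2)] Cons.prems(2,3) that by (simp add: w comp_def) blast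
  qed
  have "take i xs \<noteq> []" using Cons.prems(3,4) by (auto simp: w)
  then have "f (take i xs) \<in> T (sum_list (take i es) + d)"
    using multimapD(3)[of S T d f] Cons.prems(2) h(1) by (auto simp: w)
  moreover have "sum_list (take i es) + sum_list (drop i es) = sum_list es"
    by (metis append_take_drop_id sum_list_append)
  ultimately show ?case
    using es' by (intro exI[of _ "(sum_list (take i es) + d) # es'"])
      (auto simp: w homog_def split: prod.splits)
qed

lemma after_tensor_degree:
  assumes G: "grading T" and \<phi>: "multimap (susp T) (susp T) e \<phi>"
    and "homog S es xs" "\<forall>(d, i, f)\<in>set fs. multimap S (susp T) d f" "0 \<notin> set (map (fst \<circ> snd) fs)"
    and "sum_list (map (fst \<circ> snd) fs) = length xs" "fs \<noteq> []"
  shows "after_tensor \<phi> fs es xs \<in> susp T (sum_list es + deg_sum fs + e)"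
proof -
  obtain es' where es': "homog (susp T) es' (snd (koszul_tensor fs es xs))" "sum_list es' = sum_list es + deg_sum fs"
    using koszul_tensor_degree[OF assms(3-6)] by blast
  have "snd (koszul_tensor fs es xs) \<noteq> []"
    using assms(7) by (cases fs) (auto split: prod.splits)
  then have "\<phi> (snd (koszul_tensor fs es xs)) \<in> susp T (sum_list es + deg_sum fs + e)"
    using multimapD(3)[OF \<phi>] es' by metis
  then show ?thesis
    unfolding susp_def using gradingD(5)[OF G] by (auto simp: after_tensor_def split: prod.splits)
qed

lemma multimap_zero: "grading T \<Longrightarrow> multimap S (susp T) d (\<lambda>_. 0)"
  by (auto simp: multimap_def susp_def intro: gradingD)

lemma multimap_add:
  "grading T \<Longrightarrow> multimap S (susp T) d f \<Longrightarrow> multimap S (susp T) d g \<Longrightarrow> multimap S (susp T) d (\<lambda>xs. f xs + g xs)"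
  unfolding multimap_def susp_def by (auto simp: algebra_simps intro: gradingD)

lemma multimap_uminus:
  "grading T \<Longrightarrow> multimap S (susp T) d f \<Longrightarrow> multimap S (susp T) d (\<lambda>xs. - f xs)"
  unfolding multimap_def susp_def by (auto simp: algebra_simps intro: gradingD)

lemma multimap_diff:
  "grading T \<Longrightarrow> multimap S (susp T) d f \<Longrightarrow> multimap S (susp T) d g \<Longrightarrow> multimap S (susp T) d (\<lambda>xs. f xs - g xs)"
  using multimap_add[of T S d f "\<lambda>xs. - g xs"] multimap_uminus[of T S d g] by simp

lemma multimap_with_sign:
  "grading T \<Longrightarrow> multimap S (susp T) d f \<Longrightarrow> multimap S (susp T) d (\<lambda>xs. with_sign k (f xs))"
  by (cases "even k") (simp_all add: with_sign_def multimap_uminus)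

locale hom_data =
  fixes A :: "'a::ab_group_add ainf" and B :: "'b::ab_group_add ainf" and F :: "'a list \<Rightarrow> 'b"
  assumes A: "ainf_algebra A" and B: "ainf_algebra B" and F: "ainf_morphism A B F"
begin

abbreviation "SA \<equiv> susp (comps A)"
abbreviation "SB \<equiv> susp (comps B)"
abbreviation "mmap d \<equiv> multimap SA SB d"

lemmas GA = ainf_algebraD(1)[OF A] and GB = ainf_algebraD(1)[OF B]
lemmas opsA = ainf_algebraD(2)[OF A] and opsB = ainf_algebraD(2)[OF B]
lemmas opsA_multiadditive = multimapD(2)[OF opsA] and opsB_multiadditive = multimapD(2)[OF opsB]

lemma F_multimap: "mmap 0 F"
  and F_equation: "xs \<noteq> [] \<Longrightarrow> homog SA es xs \<Longrightarrow> pre_sum A F es xs = partition_sum B (vertex F) {0} es xs"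
proof -
  have I: "is_face 0 {0}" by (simp add: is_face_def)
  have *: "multimap SA SB (- int (face_dim {0})) (vertex F {0})"
    "xs \<noteq> [] \<Longrightarrow> homog SA es xs \<Longrightarrow> (if face_dim {0} = 0 then 0 else \<Sum>j\<in>{0..face_dim {0}}. with_sign (int j) (vertex F (bd_face j {0}) xs))
           + with_sign (- int (face_dim {0})) (pre_sum A (vertex F {0}) es xs)
           = partition_sum B (vertex F) {0} es xs" for es xs
    using F I unfolding ainf_morphism_def n_morphism_def by blast+
  from *(1) show "mmap 0 F" by (simp add: vertex_def)
  show "xs \<noteq> [] \<Longrightarrow> homog SA es xs \<Longrightarrow> pre_sum A F es xs = partition_sum B (vertex F) {0} es xs"
    using *(2)[of xs es] by (simp add: vertex_def)
qed

lemmas F_multiadd = multimapD(2)[OF F_multimap]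

sublocale bar_setting "parity (comps A)" "parity (comps B)" "ops A" "ops B" F
proof
  show "additive (parity (comps A))" by (rule additive_parity[OF GA])
  show "parity (comps A) (parity (comps A) x) = x" for x by (rule parity_parity[OF GA])
  show "ops A (map (parity (comps A)) us) = - parity (comps A) (ops A us)" for us
    using multimap_parity[OF GA GA opsA, of us] by simp
  show "ops B [] = 0" by (rule multimapD(1)[OF opsB])
  show "multiadditive (ops B)" by (rule opsB_multiadditive)
  show "multiadditive F" by (rule F_multiadd)
  show "F (map (parity (comps A)) us) = parity (comps B) (F us)" for us
    using multimap_parity[OF GA GB F_multimap, of us] by simp
  show "bar (parity (comps B)) (ops B) (ops B) ys = 0" for ys
  proof (rule multiadditive_ext[OF GB _ multiadditive_zero])
    show "multiadditive (bar (parity (comps B)) (ops B) (ops B))"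
      by (rule multiadditive_bar[OF additive_parity[OF GB] opsB_multiadditive opsB_multiadditive])
    show "bar (parity (comps B)) (ops B) (ops B) xs = 0" if "xs \<noteq> []" "homog SB es xs" for es xs
      using pre_sum_eq_bar[OF B opsB_multiadditive that(2)] ainf_algebraD(3)[OF B that] by simp
  qed simp
  show "spread (parity (comps A)) F [] (ops B) us = bar (parity (comps A)) (ops A) F us" for us
  proof (rule multiadditive_ext[OF GA])
    show "multiadditive (spread (parity (comps A)) F [] (ops B))"
      by (rule spread_multiadditive[OF additive_parity[OF GA] F_multiadd opsB_multiadditive]) simp
    show "multiadditive (bar (parity (comps A)) (ops A) F)"
      by (rule multiadditive_bar[OF additive_parity[OF GA] opsA_multiadditive F_multiadd])
    show "spread (parity (comps A)) F [] (ops B) [] = bar (parity (comps A)) (ops A) F []"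
      by (simp add: multimapD(1)[OF opsB])
    show "spread (parity (comps A)) F [] (ops B) xs = bar (parity (comps A)) (ops A) F xs"
      if "xs \<noteq> []" "homog SA es xs" for es xs
      using F_equation[OF that] pre_sum_eq_bar[OF A F_multiadd that(2)]
        partition_sum_vertex_eq_spread[OF GA _ opsB_multiadditive that(2,1), of "vertex F" 0]
      by (simp add: vertex_def F_multiadd)
  qed
qed

lemma letter_mmap: "mmap d g \<Longrightarrow> letter (d, g)"
  unfolding letter_def using multimapD(2) multimap_parity[OF GA GB] by auto

lemma T_ops_multiadditive:
  "\<forall>c\<in>set gs. multiadditive (snd c) \<Longrightarrow> multiadditive (T gs (ops B))"
  by (rule spread_multiadditive[OF additive_parity[OF GA] F_multiadd opsB_multiadditive])

lemma defect_multiadditive: "multiadditive g \<Longrightarrow> multiadditive (defect (d, g))"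
  unfolding defect_def[abs_def]
  by (auto intro!: multiadditive_diff T_ops_multiadditive multiadditive_with_sign
      multiadditive_bar additive_parity[OF GA] opsA_multiadditive)

lemma defect_Nil [simp]: "defect c [] = 0"
  by (simp add: defect_def)

lemma defect_homog:
  assumes "multiadditive g" "homog SA es xs"
  shows "one_sum B F d g es xs - with_sign d (pre_sum A g es xs) = defect (d, g) xs"
  unfolding defect_def
  using one_sum_eq_spread[OF GA F_multiadd assms(1) opsB_multiadditive assms(2)]
    pre_sum_eq_bar[OF A assms] by simp

lemma defect_add:
  assumes "multiadditive g" "multiadditive h"
  shows "defect (d, \<lambda>us. g us + h us) xs = defect (d, g) xs + defect (d, h) xs"
  using T_letter_add[OF opsB_multiadditive, of "[]" d g h "[]"]
  by (simp add: defect_def bar_add with_sign_add)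

lemma T_zero_letter: "T (p @ (d, \<lambda>_. 0) # r) (ops B) xs = 0"
  using T_letter_add[OF opsB_multiadditive, of p d "\<lambda>_. 0" "\<lambda>_. 0" r xs] by simp

lemma defect_zero: "defect (d, \<lambda>_. 0) xs = 0"
  using T_zero_letter[of "[]" d "[]" xs] by (simp add: defect_def bar_zero)

lemma T_uminus_letter: "T (p @ (d, \<lambda>us. - g us) # r) (ops B) xs = - T (p @ (d, g) # r) (ops B) xs"
proof -
  have "T (p @ (d, \<lambda>us. g us + - g us) # r) (ops B) xs = 0"
    using T_zero_letter by simp
  then show ?thesis
    unfolding T_letter_add[OF opsB_multiadditive] by (simp add: add_eq_0_iff2)
qed

lemma defect_uminus: "defect (d, \<lambda>us. - g us) xs = - defect (d, g) xs"
  using T_uminus_letter[of "[]" d g "[]" xs] by (simp add: defect_def bar_uminus with_sign_uminus)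

lemma defect_diff:
  assumes "multiadditive g" "multiadditive h"
  shows "defect (d, \<lambda>us. g us - h us) xs = defect (d, g) xs - defect (d, h) xs"
  using defect_add[OF assms(1) multiadditive_uminus[OF assms(2)]] by (simp add: defect_uminus)

abbreviation "coll \<equiv> collections A B F"
abbreviation "crel \<equiv> coll_rel A B F"

text \<open>
  Both sides of the defining equation extend to multiadditive functions on all lists.
\<close>

lemma in_collections:
  "G \<in> coll n \<longleftrightarrow> mmap (- int n) G \<and> (\<forall>xs. defect (- int n, G) xs = 0)"
proof -
  have "(\<forall>es xs. xs \<noteq> [] \<longrightarrow> homog SA es xs \<longrightarrow> with_sign (int n) (pre_sum A G es xs) = one_sum B F (- int n) G es xs)
     \<longleftrightarrow> (\<forall>xs. defect (- int n, G) xs = 0)" if G: "mmap (- int n) G"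
  proof
    assume e: "\<forall>es xs. xs \<noteq> [] \<longrightarrow> homog SA es xs \<longrightarrow> with_sign (int n) (pre_sum A G es xs) = one_sum B F (- int n) G es xs"
    show "\<forall>xs. defect (- int n, G) xs = 0"
    proof
      show "defect (- int n, G) xs = 0" for xs
        by (rule multiadditive_ext[OF GA defect_multiadditive[OF multimapD(2)[OF G]] multiadditive_zero])
          (use e in \<open>simp_all flip: defect_homog[OF multimapD(2)[OF G]]\<close>)
    qed
  next
    assume "\<forall>xs. defect (- int n, G) xs = 0"
    then show "\<forall>es xs. xs \<noteq> [] \<longrightarrow> homog SA es xs \<longrightarrow> with_sign (int n) (pre_sum A G es xs) = one_sum B F (- int n) G es xs"
      using defect_homog[OF multimapD(2)[OF G], of _ _ "- int n"] by (metis with_sign_simps(5) right_minus_eq)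
  qed
  then show ?thesis unfolding collections_def by blast
qed

lemma in_coll_rel:
  "(G, G') \<in> crel n \<longleftrightarrow> G \<in> coll n \<and> G' \<in> coll n \<and>
     (\<exists>H. mmap (- int (n + 1)) H \<and> (\<forall>xs. G' xs - G xs = defect (- int (n + 1), H) xs))"
proof -
  have "(\<forall>es xs. xs \<noteq> [] \<longrightarrow> homog SA es xs \<longrightarrow>
           G' xs - G xs + with_sign (int (n + 1)) (pre_sum A H es xs) = one_sum B F (- int (n + 1)) H es xs)
     \<longleftrightarrow> (\<forall>xs. G' xs - G xs = defect (- int (n + 1), H) xs)" (is "?L \<longleftrightarrow> ?R")
    if H: "mmap (- int (n + 1)) H" and G: "G \<in> coll n" "G' \<in> coll n" for H
  proof -
    have m: "mmap (- int n) G" "mmap (- int n) G'" using G in_collections by auto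
    have h: "G' xs - G xs + with_sign (int (n + 1)) (pre_sum A H es xs) = one_sum B F (- int (n + 1)) H es xs
      \<longleftrightarrow> G' xs - G xs = defect (- int (n + 1), H) xs" if "homog SA es xs" for es xs
      unfolding defect_homog[OF multimapD(2)[OF H] that, symmetric] with_sign_simps(5) eq_diff_eq ..
    show ?thesis
    proof
      assume ?L
      show ?R
      proof
        show "G' xs - G xs = defect (- int (n + 1), H) xs" for xs
          by (rule multiadditive_ext[OF GA multiadditive_diff[OF multimapD(2)[OF m(2)] multimapD(2)[OF m(1)]]
                defect_multiadditive[OF multimapD(2)[OF H]]])
            (use \<open>?L\<close> h multimapD(1)[OF m(1)] multimapD(1)[OF m(2)] in auto)
      qed
    qed (use h in blast)
  qed
  then show ?thesis unfolding coll_rel_def by blast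
qed

lemma zero_in_collections: "(\<lambda>_. 0) \<in> coll n"
  by (simp add: in_collections defect_zero multimap_zero[OF GB])

lemma add_in_collections: "G \<in> coll n \<Longrightarrow> G' \<in> coll n \<Longrightarrow> (\<lambda>xs. G xs + G' xs) \<in> coll n"
proof -
  assume G: "G \<in> coll n" "G' \<in> coll n"
  then have "multiadditive G" "multiadditive G'" using in_collections multimapD(2) by blast+
  then show ?thesis
    using G defect_add[of G G'] by (simp add: in_collections multimap_add[OF GB])
qed

lemma coll_rel_add:
  assumes "(G1, G1') \<in> crel n" "(G2, G2') \<in> crel n"
  shows "(\<lambda>xs. G1 xs + G2 xs, \<lambda>xs. G1' xs + G2' xs) \<in> crel n"
proof -
  obtain H K where H: "mmap (- int (n + 1)) H" "\<And>xs. G1' xs - G1 xs = defect (- int (n + 1), H) xs"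
    and K: "mmap (- int (n + 1)) K" "\<And>xs. G2' xs - G2 xs = defect (- int (n + 1), K) xs"
    using assms unfolding in_coll_rel by blast
  have "(G1' xs + G2' xs) - (G1 xs + G2 xs) = defect (- int (n + 1), \<lambda>xs. H xs + K xs) xs" for xs
    unfolding defect_add[OF multimapD(2)[OF H(1)] multimapD(2)[OF K(1)]] H(2)[symmetric] K(2)[symmetric] by simp
  then show ?thesis
    using assms multimap_add[OF GB H(1) K(1)] unfolding in_coll_rel by (auto intro: add_in_collections)
qed

lemma equiv_coll_rel: "equiv (coll n) (crel n)"
proof (rule equivI)
  show "crel n \<subseteq> coll n \<times> coll n" by (auto simp: in_coll_rel)
  show "refl_on (coll n) (crel n)"
    by (auto simp: refl_on_def in_coll_rel defect_zero multimap_zero[OF GB] intro!: exI[of _ "\<lambda>_. 0"])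
  show "sym (crel n)"
  proof (rule symI)
    fix G G' assume "(G, G') \<in> crel n"
    then obtain H where H: "G \<in> coll n" "G' \<in> coll n" "mmap (- int (n + 1)) H" "\<And>xs. G' xs - G xs = defect (- int (n + 1), H) xs"
      unfolding in_coll_rel by blast
    have "G xs - G' xs = defect (- int (n + 1), \<lambda>us. - H us) xs" for xs
      unfolding defect_uminus H(4)[symmetric] by simp
    then show "(G', G) \<in> crel n"
      using H multimap_uminus[OF GB H(3)] unfolding in_coll_rel by blast
  qed
  show "trans (crel n)"
  proof (rule transI)
    fix G1 G2 G3 assume r: "(G1, G2) \<in> crel n" "(G2, G3) \<in> crel n"
    then obtain H K where H: "mmap (- int (n + 1)) H" "\<And>xs. G2 xs - G1 xs = defect (- int (n + 1), H) xs"
      and K: "mmap (- int (n + 1)) K" "\<And>xs. G3 xs - G2 xs = defect (- int (n + 1), K) xs"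
      unfolding in_coll_rel by blast
    have "G3 xs - G1 xs = defect (- int (n + 1), \<lambda>xs. H xs + K xs) xs" for xs
      unfolding defect_add[OF multimapD(2)[OF H(1)] multimapD(2)[OF K(1)]] H(2)[symmetric] K(2)[symmetric] by simp
    then show "(G1, G3) \<in> crel n"
      using r multimap_add[OF GB H(1) K(1)] unfolding in_coll_rel by blast
  qed
qed

text \<open>
  \<open>\<Sum> b (F \<otimes> \<dots> \<otimes> g \<otimes> \<dots> \<otimes> f \<otimes> \<dots> \<otimes> F)\<close> with \<open>g\<close> and \<open>f\<close> of degrees \<open>d\<close> and \<open>e\<close>.
\<close>

definition cup :: "int \<Rightarrow> int \<Rightarrow> ('a list \<Rightarrow> 'b) \<Rightarrow> ('a list \<Rightarrow> 'b) \<Rightarrow> 'a list \<Rightarrow> 'b" where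
  "cup d e g f = T [(d, g), (e, f)] (ops B)"

lemma cup_mmap:
  assumes g: "mmap d g" and f: "mmap e f"
  shows "mmap (d + e + 1) (cup d e g f)"
proof (rule multimapI)
  show "cup d e g f [] = 0" by (simp add: cup_def)
  show "multiadditive (cup d e g f)"
    unfolding cup_def using multimapD(2)[OF g] multimapD(2)[OF f] by (intro T_ops_multiadditive) auto
  fix es xs assume xs: "xs \<noteq> []" "homog SA es xs"
  show "cup d e g f xs \<in> SB (sum_list es + (d + e + 1))"
    unfolding cup_def spread_2_eq_sum susp_def
  proof (rule grading_sum[OF GB], clarify)
    fix "is" l1 js l2 ks assume c: "(is, l1, js, l2, ks) \<in> bimarked_compositions (length xs)"
    let ?w = "map (\<lambda>i. (0, i, F)) is @ [(d, l1, g)] @ map (\<lambda>j. (0, j, F)) js @ [(e, l2, f)] @ map (\<lambda>k. (0, k, F)) ks"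
    have "apply_word (parity (comps A)) (ops B) ?w xs = after_tensor (ops B) ?w es xs"
      by (rule after_tensor_eq_apply_word[OF GA xs(2) opsB_multiadditive, symmetric])
        (use multiadditive_parity[OF GA] multimapD(2)[OF g] multimapD(2)[OF f] F_multiadd in auto)
    also have "\<dots> \<in> SB (sum_list es + deg_sum ?w + 1)"
      by (rule after_tensor_degree[OF GB opsB xs(2)])
        (use c g f F_multimap in \<open>auto simp: bimarked_compositions_def comp_def\<close>)
    finally show "apply_word (parity (comps A)) (ops B) ?w xs \<in> comps B (sum_list es + (d + e + 1) + 1)"
      by (simp add: susp_def algebra_simps)
  qed
qed

lemma defect_cup:
  assumes "mmap d g" "mmap e f"
  shows "defect (d + e + 1, cup d e g f) xs = - cup (d + 1) e (defect (d, g)) f xs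
     - with_sign d (cup d (e + 1) g (defect (e, f)) xs)"
  using defect_product[OF letter_mmap[OF assms(1)] letter_mmap[OF assms(2)]] by (simp add: cup_def)

lemma cup_zero: "cup d e (\<lambda>_. 0) f xs = 0" "cup d e g (\<lambda>_. 0) xs = 0"
  using T_zero_letter[of "[]" d "[(e, f)]" xs] T_zero_letter[of "[(d, g)]" e "[]" xs] by (simp_all add: cup_def)

lemma cup_diff:
  "cup d e (\<lambda>us. g us - g' us) f xs = cup d e g f xs - cup d e g' f xs"
  "cup d e g (\<lambda>us. f us - f' us) xs = cup d e g f xs - cup d e g f' xs"
proof -
  show "cup d e (\<lambda>us. g us - g' us) f xs = cup d e g f xs - cup d e g' f xs"
    using T_letter_add[OF opsB_multiadditive, of "[]" d g "\<lambda>us. - g' us" "[(e, f)]" xs]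
      T_uminus_letter[of "[]" d g' "[(e, f)]" xs] by (simp add: cup_def)
  show "cup d e g (\<lambda>us. f us - f' us) xs = cup d e g f xs - cup d e g f' xs"
    using T_letter_add[OF opsB_multiadditive, of "[(d, g)]" e f "\<lambda>us. - f' us" "[]" xs]
      T_uminus_letter[of "[(d, g)]" e f' "[]" xs] by (simp add: cup_def)
qed

lemma cup_homog:
  assumes "multiadditive g" "multiadditive f" "homog SA es xs"
  shows "two_sum B F g f es xs = cup (-1) (-1) g f xs"
  unfolding cup_def by (rule two_sum_eq_spread[OF GA F_multiadd assms(1,2) opsB_multiadditive assms(3)])

text \<open>
  The representative of a composite for \<open>n = 1\<close>. In the triangle that exhibits it, \<open>g\<close>
  lies on the edge \<open>01\<close> and \<open>f\<close> on the edge \<open>12\<close>.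
\<close>

definition concat_coll :: "('a list \<Rightarrow> 'b) \<Rightarrow> ('a list \<Rightarrow> 'b) \<Rightarrow> 'a list \<Rightarrow> 'b" where
  "concat_coll g f xs = f xs + g xs - cup (-1) (-1) g f xs"

text \<open>
  By the Leibniz rule the product of two cycles is a cycle.
\<close>

lemma concat_in_collections:
  assumes "g \<in> coll 1" "f \<in> coll 1"
  shows "concat_coll g f \<in> coll 1"
proof -
  have m: "mmap (-1) g" "mmap (-1) f" and z: "defect (-1, g) = (\<lambda>_. 0)" "defect (-1, f) = (\<lambda>_. 0)"
    using assms by (auto simp: in_collections)
  have c: "mmap (-1) (cup (-1) (-1) g f)" using cup_mmap[OF m] by simp
  have "defect (-1, cup (-1) (-1) g f) xs = 0" for xs
    using defect_cup[OF m, of xs] by (simp add: z cup_zero)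
  moreover have "defect (-1, concat_coll g f) xs = defect (-1, \<lambda>us. f us + g us) xs - defect (-1, cup (-1) (-1) g f) xs" for xs
    unfolding concat_coll_def[abs_def]
    by (rule defect_diff) (use multimapD(2) m c multiadditive_add in blast)+
  moreover have "defect (-1, \<lambda>us. f us + g us) xs = 0" for xs
    using defect_add[OF multimapD(2)[OF m(2)] multimapD(2)[OF m(1)]] by (simp add: z)
  moreover have "mmap (-1) (concat_coll g f)"
    unfolding concat_coll_def[abs_def] by (rule multimap_diff[OF GB multimap_add[OF GB m(2,1)] c])
  ultimately show ?thesis by (simp add: in_collections)
qed

text \<open>
  By the Leibniz rule the product of a cycle and a boundary is a boundary: for \<open>f' - f = D H\<close> and
  \<open>D g = 0\<close> one has \<open>cup g (f' - f) = D (cup g H)\<close>, and for \<open>g' - g = D K\<close> and \<open>D f' = 0\<close> one has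
  \<open>cup (g' - g) f' = - D (cup K f')\<close>.
\<close>

lemma concat_coll_rel:
  assumes "(g, g') \<in> crel 1" "(f, f') \<in> crel 1"
  shows "(concat_coll g f, concat_coll g' f') \<in> crel 1"
proof -
  have co: "g \<in> coll 1" "g' \<in> coll 1" "f \<in> coll 1" "f' \<in> coll 1" using assms by (auto simp: in_coll_rel)
  then have m: "mmap (-1) g" "mmap (-1) g'" "mmap (-1) f" "mmap (-1) f'"
    and z: "defect (-1, g) = (\<lambda>_. 0)" "defect (-1, f') = (\<lambda>_. 0)" "defect (-1, f) = (\<lambda>_. 0)"
    by (auto simp: in_collections)
  obtain K H where K: "mmap (-2) K" "\<And>xs. g' xs - g xs = defect (-2, K) xs"
    and H: "mmap (-2) H" "\<And>xs. f' xs - f xs = defect (-2, H) xs"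
    using assms by (auto simp: in_coll_rel)
  have dK: "defect (-2, K) = (\<lambda>us. g' us - g us)" and dH: "defect (-2, H) = (\<lambda>us. f' us - f us)"
    using K(2) H(2) by auto
  \<comment> \<open>The product changes first in \<open>f\<close> (along \<open>?P\<close>), then in \<open>g\<close> (along \<open>?Q\<close>).\<close>
  let ?P = "cup (-1) (-2) g H" and ?Q = "cup (-2) (-1) K f'"
  have P: "mmap (-2) ?P" and Q: "mmap (-2) ?Q"
    using cup_mmap[OF m(1) H(1)] cup_mmap[OF K(1) m(4)] by simp_all
  have dP: "defect (-2, ?P) xs = cup (-1) (-1) g f' xs - cup (-1) (-1) g f xs" for xs
    using defect_cup[OF m(1) H(1), of xs] by (simp add: z dH cup_zero cup_diff)
  have dQ: "defect (-2, ?Q) xs = cup (-1) (-1) g f' xs - cup (-1) (-1) g' f' xs" for xs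
    using defect_cup[OF K(1) m(4), of xs] by (simp add: z dK cup_zero cup_diff)
  let ?R = "\<lambda>us. ((H us + K us) - ?P us) + ?Q us"
  note ma = multimapD(2)[OF H(1)] multimapD(2)[OF K(1)] multimapD(2)[OF P] multimapD(2)[OF Q]
  have "defect (-2, ?R) xs = concat_coll g' f' xs - concat_coll g f xs" for xs
    by (simp add: defect_add defect_diff ma multiadditive_add multiadditive_diff dP dQ dK dH concat_coll_def)
  moreover have "mmap (-2) ?R"
    by (intro multimap_add[OF GB] multimap_diff[OF GB] H K P Q)
  ultimately show ?thesis
    using concat_in_collections[OF co(1,3)] concat_in_collections[OF co(2,4)]
    unfolding in_coll_rel by (intro conjI exI[of _ ?R]) auto
qed

end

section \<open>Pullbacks of n-morphisms and the Yoneda lemma\<close>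

text \<open>
  The restriction of \<open>\<Phi>\<close> along the monotone map \<open>v\<close>, written as the list of its values. Faces on which \<open>v\<close>
  is not injective are collapsed and get the value \<open>0\<close>, as for degeneracies.
\<close>

definition pullback :: "nat list \<Rightarrow> (nat set \<Rightarrow> 'a list \<Rightarrow> 'b::zero) \<Rightarrow> nat set \<Rightarrow> 'a list \<Rightarrow> 'b" where
  "pullback v \<Phi> J = (if is_face (length v - 1) J \<and> inj_on ((!) v) J then \<Phi> ((!) v ` J) else (\<lambda>_. 0))"

lemma in_std_simplex:
  "v \<in> simplices (std_simplex n) k \<longleftrightarrow> length v = Suc k \<and> sorted v \<and> set v \<subseteq> {0..n}"
  by (simp add: std_simplex_def)

lemma sorted_list_of_set_image:
  assumes "strict_mono_on J \<alpha>" "finite (J :: nat set)"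
  shows "sorted_list_of_set (\<alpha> ` J :: nat set) = map \<alpha> (sorted_list_of_set J)"
proof -
  have "sorted_wrt (<) (map \<alpha> (sorted_list_of_set J))"
    unfolding sorted_wrt_map
    by (rule sorted_wrt_mono_rel[OF _ strict_sorted_list_of_set])
      (use assms in \<open>auto simp: strict_mono_on_def\<close>)
  moreover have "length (map \<alpha> (sorted_list_of_set J)) = card (\<alpha> ` J)"
    by (simp add: card_image strict_mono_on_imp_inj_on[OF assms(1)])
  ultimately show ?thesis
    using assms(2) sorted_list_of_set_unique[of "\<alpha> ` J" "map \<alpha> (sorted_list_of_set J)"] by simp
qed

lemma sorted_list_of_initial [simp]: "sorted_list_of_set {0..n} = [0..<Suc n]"
  by (metis atLeastLessThanSuc_atLeastAtMost sorted_list_of_set_range)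

lemma bd_face_initial: "j \<le> n \<Longrightarrow> bd_face j {0..n} = {0..n} - {j}"
  unfolding bd_face_def sorted_list_of_initial by (subst nth_upt) auto

lemma bd_face_image:
  assumes "strict_mono_on I \<alpha>" "finite I" "j < card I"
  shows "bd_face j (\<alpha> ` I) = \<alpha> ` bd_face j I"
proof -
  have l: "j < length (sorted_list_of_set I)" using assms(3) by simp
  then have "sorted_list_of_set I ! j \<in> I" using assms(2) nth_mem[OF l] by simp
  then have "\<alpha> ` (I - {sorted_list_of_set I ! j}) = \<alpha> ` I - \<alpha> ` {sorted_list_of_set I ! j}"
    by (intro inj_on_image_set_diff[OF strict_mono_on_imp_inj_on[OF assms(1)]]) auto
  then show ?thesis
    unfolding bd_face_def sorted_list_of_set_image[OF assms(1,2)] nth_map[OF l] by simp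
qed

lemma bd_face_card:
  assumes "finite I" "j < card I"
  shows "bd_face j I \<subseteq> I" "card (bd_face j I) = card I - 1"
proof -
  have "sorted_list_of_set I ! j \<in> I"
    using assms nth_mem[of j "sorted_list_of_set I"] by simp
  then show "bd_face j I \<subseteq> I" "card (bd_face j I) = card I - 1"
    using assms(1) by (auto simp: bd_face_def)
qed

lemma is_face_finite: "is_face n I \<Longrightarrow> finite I"
  using finite_subset by (auto simp: is_face_def)

lemma is_face_card: "is_face n I \<Longrightarrow> card I \<ge> 1"
  using is_face_finite[of n I] by (auto simp: is_face_def Suc_le_eq card_gt_0_iff)

lemma bd_face_is_face:
  assumes "is_face n I" "face_dim I \<noteq> 0" "j \<le> face_dim I"
  shows "is_face n (bd_face j I)" "bd_face j I \<subseteq> I" "j < card I"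
proof -
  have j: "j < card I" using assms(2,3) by (simp add: face_dim_def)
  note b = bd_face_card[OF is_face_finite[OF assms(1)] j]
  have "card (bd_face j I) \<noteq> 0" using b(2) assms(2) by (simp add: face_dim_def)
  then have "bd_face j I \<noteq> {}" by auto
  then show "is_face n (bd_face j I)" "bd_face j I \<subseteq> I" "j < card I"
    using assms(1) b(1) j by (auto simp: is_face_def)
qed

lemma is_face_nth:
  assumes "v \<in> simplices (std_simplex n) k" "is_face k J" shows "is_face n ((!) v ` J)"
proof -
  have "v ! j \<in> {0..n}" if "j \<in> J" for j
  proof -
    have "j < length v" using assms that by (auto simp: is_face_def in_std_simplex)
    then have "v ! j \<in> set v" by simp
    then show ?thesis using assms(1) by (auto simp: in_std_simplex)
  qed
  then show ?thesis using assms(2) by (auto simp: is_face_def)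
qed

lemma nth_strict_mono:
  assumes "v \<in> simplices (std_simplex n) k" "is_face k J" "inj_on ((!) v) J"
  shows "strict_mono_on J ((!) v)"
proof (rule strict_mono_onI)
  fix r s assume rs: "r \<in> J" "s \<in> J" "r < s"
  have "v ! r \<le> v ! s"
    using assms(1,2) rs by (intro sorted_nth_mono) (auto simp: in_std_simplex is_face_def)
  moreover have "v ! r \<noteq> v ! s" using inj_onD[OF assms(3) _ rs(1,2)] rs(3) by auto
  ultimately show "v ! r < v ! s" by simp
qed

lemma face_dim_image: "inj_on \<alpha> J \<Longrightarrow> face_dim (\<alpha> ` J) = face_dim J"
  by (simp add: face_dim_def card_image)

lemma pullback_reindex:
  assumes "length v = Suc k" "length v' = Suc k'" "is_face k' J"
    and "\<And>j. j \<le> k' \<Longrightarrow> \<alpha> j \<le> k \<and> v' ! j = v ! \<alpha> j"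
  shows "pullback v' \<Phi> J = (if inj_on \<alpha> J then pullback v \<Phi> (\<alpha> ` J) else (\<lambda>_. 0))"
proof -
  have J: "\<And>j. j \<in> J \<Longrightarrow> j \<le> k'" using assms(3) by (auto simp: is_face_def)
  have "inj_on ((!) v') J \<longleftrightarrow> inj_on ((!) v \<circ> \<alpha>) J"
    by (rule inj_on_cong) (use assms(4) J in auto)
  also have "\<dots> \<longleftrightarrow> inj_on \<alpha> J \<and> inj_on ((!) v) (\<alpha> ` J)"
    by (metis comp_inj_on inj_on_imageI inj_on_imageI2)
  finally have i: "inj_on ((!) v') J \<longleftrightarrow> inj_on \<alpha> J \<and> inj_on ((!) v) (\<alpha> ` J)" .
  have im: "(!) v' ` J = (!) v ` \<alpha> ` J"
    unfolding image_image by (rule image_cong[OF refl]) (use assms(4) J in blast)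
  have f: "is_face k (\<alpha> ` J)" using assms(3,4) J by (auto simp: is_face_def)
  show ?thesis
    using assms(1,2,3) f by (simp add: pullback_def i im)
qed

lemma std_simplex_reindex:
  assumes "v \<in> simplices (std_simplex n) k" "length v' = Suc k'"
    and "\<And>j. j \<le> k' \<Longrightarrow> \<alpha> j \<le> k \<and> v' ! j = v ! \<alpha> j" "mono \<alpha>"
  shows "v' \<in> simplices (std_simplex n) k'"
  unfolding in_std_simplex
proof (intro conjI assms(2))
  have v: "length v = Suc k" "sorted v" "set v \<subseteq> {0..n}" using assms(1) by (auto simp: in_std_simplex)
  show "sorted v'"
    unfolding sorted_iff_nth_mono
  proof (intro allI impI)
    fix i j assume ij: "i \<le> j" "j < length v'"
    then have "v ! \<alpha> i \<le> v ! \<alpha> j"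
      using assms(2-4) v by (intro sorted_nth_mono) (auto dest: monoD simp: less_Suc_eq_le)
    then show "v' ! i \<le> v' ! j" using ij assms(2,3) by simp
  qed
  show "set v' \<subseteq> {0..n}"
  proof
    fix x assume "x \<in> set v'"
    then obtain j where "j \<le> k'" "x = v' ! j" using assms(2) by (auto simp: in_set_conv_nth less_Suc_eq_le)
    then have "x \<in> set v" using assms(3)[of j] v(1) by (auto simp: less_Suc_eq_le)
    then show "x \<in> {0..n}" using v(3) by blast
  qed
qed

lemma mono_coface: "mono (coface i)" and mono_codegen: "mono (codegen i)"
  by (auto simp: coface_def codegen_def intro!: monoI)

lemma inj_coface: "inj_on (coface i) J"
  by (auto simp: coface_def inj_on_def split: if_splits)

lemma strict_mono_coface: "strict_mono_on J (coface i)"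
  by (auto simp: coface_def strict_mono_on_def)

lemma codegen_coface [simp]: "codegen i (coface i x) = x" "codegen i (coface (Suc i) x) = x"
  by (auto simp: codegen_def coface_def)

lemma delete_nth:
  assumes "length v = Suc (Suc k)" "i \<le> Suc k"
  shows "length (take i v @ drop (Suc i) v) = Suc k"
    "j \<le> k \<Longrightarrow> coface i j \<le> Suc k \<and> (take i v @ drop (Suc i) v) ! j = v ! coface i j"
  using assms by (auto simp: coface_def nth_append min_def)

lemma repeat_nth:
  assumes "length v = Suc k" "i \<le> k"
  shows "length (take (Suc i) v @ drop i v) = Suc (Suc k)"
    "j \<le> Suc k \<Longrightarrow> codegen i j \<le> k \<and> (take (Suc i) v @ drop i v) ! j = v ! codegen i j"
  using assms by (auto simp: codegen_def nth_append min_def)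

lemma inj_codegen: "inj_on (codegen i) J \<longleftrightarrow> \<not> {i, Suc i} \<subseteq> J"
proof
  assume "inj_on (codegen i) J"
  then show "\<not> {i, Suc i} \<subseteq> J"
    using inj_onD[of "codegen i" J i "Suc i"] by (auto simp: codegen_def)
next
  assume n: "\<not> {i, Suc i} \<subseteq> J"
  show "inj_on (codegen i) J"
  proof (rule inj_onI)
    fix x y assume xy: "x \<in> J" "y \<in> J" "codegen i x = codegen i y"
    then have "x = y \<or> (x = i \<and> y = Suc i) \<or> (x = Suc i \<and> y = i)"
      unfolding codegen_def by (simp split: if_splits; linarith)
    then show "x = y" using n xy(1,2) by blast
  qed
qed

lemma face_std: "face (std_simplex n) k i v = take i v @ drop (Suc i) v"
  and degen_std: "degen (std_simplex n) k i v = take (Suc i) v @ drop i v"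
  by (simp_all add: std_simplex_def)

lemma face_pullback:
  assumes "length v = Suc (Suc k)" "i \<le> Suc k"
  shows "face (HOM A B) (Suc k) i (pullback v \<Phi>) = pullback (take i v @ drop (Suc i) v) \<Phi>"
proof
  fix J
  show "face (HOM A B) (Suc k) i (pullback v \<Phi>) J = pullback (take i v @ drop (Suc i) v) \<Phi> J"
  proof (cases "is_face k J")
    case True
    then show ?thesis
      using pullback_reindex[OF assms(1) delete_nth(1)[OF assms] True delete_nth(2)[OF assms], of \<Phi>]
      by (simp add: HOM_def inj_coface)
  next
    case False
    then show ?thesis using delete_nth(1)[OF assms] by (simp add: HOM_def pullback_def)
  qed
qed

lemma degen_pullback:
  assumes "length v = Suc k" "i \<le> k"
  shows "degen (HOM A B) k i (pullback v \<Phi>) = pullback (take (Suc i) v @ drop i v) \<Phi>"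
proof
  fix J
  show "degen (HOM A B) k i (pullback v \<Phi>) J = pullback (take (Suc i) v @ drop i v) \<Phi> J"
  proof (cases "is_face (Suc k) J")
    case True
    then show ?thesis
      using pullback_reindex[OF assms(1) repeat_nth(1)[OF assms] True repeat_nth(2)[OF assms], of \<Phi>]
      by (simp add: HOM_def inj_codegen)
  next
    case False
    then show ?thesis using repeat_nth(1)[OF assms] by (simp add: HOM_def pullback_def)
  qed
qed

lemma face_in_std:
  "v \<in> simplices (std_simplex n) (Suc k) \<Longrightarrow> i \<le> Suc k \<Longrightarrow> face (std_simplex n) (Suc k) i v \<in> simplices (std_simplex n) k"
  unfolding face_std
  by (rule std_simplex_reindex[where \<alpha> = "coface i"]) (auto simp: in_std_simplex delete_nth mono_coface)

lemma degen_in_std: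
  "v \<in> simplices (std_simplex n) k \<Longrightarrow> i \<le> k \<Longrightarrow> degen (std_simplex n) k i v \<in> simplices (std_simplex n) (Suc k)"
  unfolding degen_std
  by (rule std_simplex_reindex[where \<alpha> = "codegen i"]) (auto simp: in_std_simplex repeat_nth mono_codegen)

lemma identity_in_std: "[0..<Suc n] \<in> simplices (std_simplex n) n"
  by (auto simp: in_std_simplex simp del: upt_Suc)

context hom_data
begin

abbreviation "X \<equiv> HOM A B"

lemma simplices_X: "simplices X n = {\<Phi>. n_morphism A B n \<Phi>}"
  by (simp add: HOM_def)

definition boundary_sum :: "(nat set \<Rightarrow> 'a list \<Rightarrow> 'b) \<Rightarrow> nat set \<Rightarrow> 'a list \<Rightarrow> 'b" where
  "boundary_sum \<Phi> I xs = (if face_dim I = 0 then 0 else \<Sum>j\<in>{0..face_dim I}. with_sign (int j) (\<Phi> (bd_face j I) xs))"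

definition face_equation :: "(nat set \<Rightarrow> 'a list \<Rightarrow> 'b) \<Rightarrow> nat set \<Rightarrow> bool" where
  "face_equation \<Phi> I \<longleftrightarrow> mmap (- int (face_dim I)) (\<Phi> I) \<and>
     (\<forall>es xs. xs \<noteq> [] \<longrightarrow> homog SA es xs \<longrightarrow>
        boundary_sum \<Phi> I xs + with_sign (int (face_dim I)) (pre_sum A (\<Phi> I) es xs) = partition_sum B \<Phi> I es xs)"

lemma n_morphism_iff:
  "n_morphism A B n \<Phi> \<longleftrightarrow> (\<forall>I. \<not> is_face n I \<longrightarrow> \<Phi> I = (\<lambda>_. 0)) \<and> (\<forall>I. is_face n I \<longrightarrow> face_equation \<Phi> I)"
  unfolding n_morphism_def face_equation_def boundary_sum_def by simp

lemma pre_sum_zero: "pre_sum A (\<lambda>_. 0 :: 'b) es xs = 0"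
  unfolding pre_sum_def by (rule sum.neutral) (auto simp: after_tensor_def split: prod.split)

text \<open>
  If \<open>v\<close> identifies two vertices of \<open>J\<close>, it identifies two neighbouring ones, \<open>x < y\<close>. Every face
  and every part of a partition that contains both gets the value \<open>0\<close>. This leaves nothing of the
  partition sum, and of the boundary only the faces opposite to \<open>x\<close> and to \<open>y\<close>; these have the same
  image under \<open>v\<close> and opposite signs.
\<close>

lemma pullback_degenerate_equation:
  assumes v: "v \<in> simplices (std_simplex n) k" and J: "is_face k J" and ni: "\<not> inj_on ((!) v) J"
  shows "face_equation (pullback v \<Phi>) J"
proof -
  have vk: "length v - 1 = k" "length v = Suc k" "sorted v" using v by (auto simp: in_std_simplex)
  have fin: "finite J" using J is_face_finite by blast
  have bnd: "j < length v" if "j \<in> J" for j using that J vk(2) by (auto simp: is_face_def)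
  have zero: "pullback v \<Phi> I = (\<lambda>_. 0)" if "\<not> inj_on ((!) v) I" for I
    using that by (simp add: pullback_def)
  obtain x b where xb: "x \<in> J" "b \<in> J" "x < b" "v ! x = v ! b"
  proof -
    obtain p q where pq: "p \<in> J" "q \<in> J" "v ! p = v ! q" "p \<noteq> q" using ni by (auto simp: inj_on_def)
    then consider "p < q" | "q < p" by linarith
    then show ?thesis using that[of p q] that[of q p] pq by cases auto
  qed
  \<comment> \<open>The successor \<open>y\<close> of \<open>x\<close> in \<open>J\<close> lies between \<open>x\<close> and \<open>b\<close>, so \<open>v\<close> identifies it with \<open>x\<close>.\<close>
  obtain y where y: "y \<in> J" "x < y" "y \<le> b" and adj: "\<And>z. z \<in> J \<Longrightarrow> z \<le> x \<or> y \<le> z"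
    using adjacent_above[OF fin xb(1-3)] by metis
  have vxy: "v ! x = v ! y"
  proof (rule antisym)
    show "v ! x \<le> v ! y" using sorted_nth_mono[OF vk(3), of x y] y bnd by simp
    show "v ! y \<le> v ! x" unfolding xb(4) using sorted_nth_mono[OF vk(3), of y b] y xb bnd by simp
  qed
  have van: "pullback v \<Phi> I = (\<lambda>_. 0)" if "x \<in> I" "y \<in> I" for I
    by (rule zero) (use that vxy y(2) in \<open>auto simp: inj_on_def\<close>)
  have "boundary_sum (pullback v \<Phi>) J xs = 0" for xs
  proof -
    define L where "L = sorted_list_of_set J"
    have L: "sorted_wrt (<) L" "set L = J" "length L = card J" using fin by (auto simp: L_def)
    obtain p where p: "p < card J" "L ! p = x" using xb(1) L(2,3) by (metis in_set_conv_nth)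
    obtain q where q: "q < card J" "L ! q = y" using y(1) L(2,3) by (metis in_set_conv_nth)
    have mono: "L ! i < L ! j \<longleftrightarrow> i < j" if "i < card J" "j < card J" for i j
      using sorted_wrt_nth_less[OF L(1), of i j] sorted_wrt_nth_less[OF L(1), of j i] that L(3)
      by (metis less_irrefl linorder_neqE_nat order_less_trans)
    have "p < q" using mono[OF p(1) q(1)] p(2) q(2) y(2) by simp
    have qp: "q = Suc p"
    proof (rule ccontr)
      assume "q \<noteq> Suc p"
      then have "Suc p < q" using \<open>p < q\<close> by simp
      then have "x < L ! Suc p" "L ! Suc p < y" using mono[of p "Suc p"] mono[of "Suc p" q] p q by auto
      moreover have "L ! Suc p \<in> J" using L \<open>Suc p < q\<close> q(1) by (metis nth_mem order_less_trans)
      ultimately show False using adj by fastforce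
    qed
    have bd: "bd_face j J = J - {L ! j}" for j by (simp add: bd_face_def L_def)
    have dim: "face_dim J \<noteq> 0" "Suc p \<le> face_dim J" using q(1) qp by (auto simp: face_dim_def)
    have other: "pullback v \<Phi> (bd_face j J) = (\<lambda>_. 0)" if "j \<le> face_dim J" "j \<noteq> p" "j \<noteq> Suc p" for j
    proof (rule van)
      have "j < card J" using that(1) dim(1) by (simp add: face_dim_def)
      then have "L ! j \<noteq> x" "L ! j \<noteq> y" using that mono[of j p] mono[of p j] mono[of j q] mono[of q j] p q qp by fastforce+
      then show "x \<in> bd_face j J" "y \<in> bd_face j J" using bd xb(1) y(1) by auto
    qed
    have eq: "pullback v \<Phi> (bd_face p J) = pullback v \<Phi> (bd_face (Suc p) J)"
    proof -
      have f: "is_face k (J - {x})" "is_face k (J - {y})" using J xb(1) y(1,2) by (auto simp: is_face_def)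
      have im: "(!) v ` (J - {x}) = (!) v ` (J - {y})"
      proof -
        have "v ! x \<in> (!) v ` (J - {x})" using vxy y(1,2) by (metis DiffI imageI less_irrefl singletonD)
        moreover have "v ! y \<in> (!) v ` (J - {y})" using vxy xb(1) y(2) by (metis DiffI imageI less_irrefl singletonD)
        ultimately have "(!) v ` J = (!) v ` (J - {x})" "(!) v ` J = (!) v ` (J - {y})"
          using xb(1) y(1) by (metis image_insert insert_Diff insert_absorb)+
        then show ?thesis by simp
      qed
      have "card (J - {x}) = card (J - {y})" using xb(1) y(1) fin by simp
      then have "inj_on ((!) v) (J - {x}) \<longleftrightarrow> inj_on ((!) v) (J - {y})"
        using im fin by (metis card_image eq_card_imp_inj_on finite_Diff)
      then show ?thesis
        using f im p q qp by (simp add: pullback_def vk bd)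
    qed
    have "boundary_sum (pullback v \<Phi>) J xs = (\<Sum>j\<in>{0..face_dim J}. with_sign (int j) (pullback v \<Phi> (bd_face j J) xs))"
      using dim by (simp add: boundary_sum_def)
    also have "\<dots> = (\<Sum>j\<in>{p, Suc p}. with_sign (int j) (pullback v \<Phi> (bd_face j J) xs))"
      by (rule sum.mono_neutral_right) (use dim other in auto)
    also have "\<dots> = 0"
    proof -
      have "with_sign (int (Suc p)) z = - with_sign (int p) z" for z :: 'b by (simp add: with_sign_def)
      then show ?thesis by (simp add: eq del: of_nat_Suc)
    qed
    finally show ?thesis .
  qed
  moreover have "partition_sum B (pullback v \<Phi>) J es xs = 0" if "xs \<noteq> []" for es xs
    by (rule partition_sum_eq_zero[OF fin that opsB_multiadditive xb(1) y(1,2)]) (use adj van in auto)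
  ultimately show ?thesis
    unfolding face_equation_def zero[OF ni] by (simp add: pre_sum_zero multimap_zero[OF GB])
qed

text \<open>
  If \<open>v\<close> is injective on \<open>J\<close>, the equation for \<open>J\<close> is that of \<open>\<Phi>\<close> for the image of \<open>J\<close>.
\<close>

lemma pullback_nondegenerate_equation:
  assumes \<Phi>: "n_morphism A B n \<Phi>" and v: "v \<in> simplices (std_simplex n) k"
    and J: "is_face k J" and inj: "inj_on ((!) v) J"
  shows "face_equation (pullback v \<Phi>) J"
proof -
  have vk: "length v - 1 = k" using v by (auto simp: in_std_simplex)
  have fin: "finite J" using J is_face_finite by blast
  note sm = nth_strict_mono[OF v J inj]
  have pb: "pullback v \<Phi> I = \<Phi> ((!) v ` I)" if "I \<subseteq> J" "I \<noteq> {}" for I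
  proof -
    have "is_face k I" using that J by (auto simp: is_face_def)
    then show ?thesis using inj_on_subset[OF inj that(1)] unfolding pullback_def vk by simp
  qed
  have "J \<noteq> {}" using J by (simp add: is_face_def)
  have dim: "face_dim ((!) v ` J) = face_dim J" by (rule face_dim_image[OF inj])
  have fe: "face_equation \<Phi> ((!) v ` J)" using \<Phi> is_face_nth[OF v J] unfolding n_morphism_iff by blast
  have "boundary_sum (pullback v \<Phi>) J xs = boundary_sum \<Phi> ((!) v ` J) xs" for xs
  proof (cases "face_dim J = 0")
    case False
    have "pullback v \<Phi> (bd_face j J) = \<Phi> (bd_face j ((!) v ` J))" if "j \<le> face_dim J" for j
      using pb[of "bd_face j J"] bd_face_is_face[OF J False that] bd_face_image[OF sm fin, of j]
      by (simp add: is_face_def)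
    then show ?thesis unfolding boundary_sum_def dim by simp
  qed (simp add: boundary_sum_def dim)
  moreover have "partition_sum B (pullback v \<Phi>) J es xs = partition_sum B \<Phi> ((!) v ` J) es xs" if "xs \<noteq> []" for es xs
    unfolding partition_sum_image[OF fin sm that]
    unfolding partition_sum_def
  proof (rule sum.cong[OF refl])
    fix ps assume ps: "ps \<in> labelled_partitions J (length xs)"
    have "word_of (pullback v \<Phi>) ps = word_of (\<lambda>J. \<Phi> ((!) v ` J)) ps"
    proof (rule map_cong[OF refl])
      fix p assume p: "p \<in> set ps"
      then have "snd p \<in> set (map snd ps)" by simp
      then have "snd p \<subseteq> J" "snd p \<noteq> {}" using ps unfolding overlapping_partition_def by blast+
      from pb[OF this] show "(case p of (i, I) \<Rightarrow> (- int (face_dim I), i, pullback v \<Phi> I))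
        = (case p of (i, I) \<Rightarrow> (- int (face_dim I), i, \<Phi> ((!) v ` I)))" by (simp add: split_def)
    qed
    then show "after_tensor (ops B) (word_of (pullback v \<Phi>) ps) es xs
      = after_tensor (ops B) (word_of (\<lambda>J. \<Phi> ((!) v ` J)) ps) es xs" by (simp only:)
  qed
  ultimately show ?thesis
    using fe pb[OF order_refl \<open>J \<noteq> {}\<close>] unfolding face_equation_def dim by simp
qed

lemma pullback_n_morphism:
  assumes "n_morphism A B n \<Phi>" "v \<in> simplices (std_simplex n) k"
  shows "n_morphism A B k (pullback v \<Phi>)"
  unfolding n_morphism_iff
proof (intro conjI allI impI)
  show "pullback v \<Phi> I = (\<lambda>_. 0)" if "\<not> is_face k I" for I
    using that assms(2) by (simp add: pullback_def in_std_simplex)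
  show "face_equation (pullback v \<Phi>) I" if "is_face k I" for I
    using pullback_degenerate_equation[OF assms(2) that] pullback_nondegenerate_equation[OF assms that] by blast
qed

definition simplex_map :: "nat \<Rightarrow> (nat set \<Rightarrow> 'a list \<Rightarrow> 'b) \<Rightarrow> nat \<Rightarrow> nat list \<Rightarrow> nat set \<Rightarrow> 'a list \<Rightarrow> 'b" where
  "simplex_map n \<Phi> = (\<lambda>k. \<lambda>v\<in>simplices (std_simplex n) k. pullback v \<Phi>)"

lemma simplex_map_simplicial:
  assumes "n_morphism A B n \<Phi>"
  shows "simplicial_map (std_simplex n) X (simplex_map n \<Phi>)"
  unfolding simplicial_map_def
proof (intro conjI allI ballI impI)
  show "simplex_map n \<Phi> k \<in> simplices (std_simplex n) k \<rightarrow>\<^sub>E simplices X k" for k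
    using pullback_n_morphism[OF assms] by (auto simp: simplex_map_def simplices_X)
  show "simplex_map n \<Phi> k (face (std_simplex n) (Suc k) i v) = face X (Suc k) i (simplex_map n \<Phi> (Suc k) v)"
    if "i \<le> Suc k" "v \<in> simplices (std_simplex n) (Suc k)" for k i v
    using face_in_std[OF that(2,1)] that face_pullback[of v k i A B \<Phi>]
    by (simp add: simplex_map_def face_std in_std_simplex)
  show "simplex_map n \<Phi> (Suc k) (degen (std_simplex n) k i v) = degen X k i (simplex_map n \<Phi> k v)"
    if "i \<le> k" "v \<in> simplices (std_simplex n) k" for k i v
    using degen_in_std[OF that(2,1)] that degen_pullback[of v k i A B \<Phi>]
    by (simp add: simplex_map_def degen_std in_std_simplex)
qed

lemma simplicial_mapD:
  assumes "simplicial_map Y X f"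
  shows "v \<in> simplices Y k \<Longrightarrow> n_morphism A B k (f k v)"
    "v \<notin> simplices Y k \<Longrightarrow> f k v = undefined"
    "i \<le> Suc k \<Longrightarrow> v \<in> simplices Y (Suc k) \<Longrightarrow> f k (face Y (Suc k) i v) = face X (Suc k) i (f (Suc k) v)"
    "i \<le> k \<Longrightarrow> v \<in> simplices Y k \<Longrightarrow> f (Suc k) (degen Y k i v) = degen X k i (f k v)"
  using assms unfolding simplicial_map_def simplices_X by (auto simp: PiE_def extensional_def)

text \<open>
  Taking the faces opposite to the vertices outside \<open>J\<close>, one after the other, moves every component
  to the top component of a simplex of smaller dimension.
\<close>

lemma simplicial_map_on_face:
  assumes f: "simplicial_map (std_simplex n) X f" and "v \<in> simplices (std_simplex n) k" "is_face k J"
  shows "f k v J = f (face_dim J) (map ((!) v) (sorted_list_of_set J)) {0..face_dim J}"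
  using assms(2,3)
proof (induction k arbitrary: v J)
  case 0
  then have J: "J = {0..0}" by (auto simp: is_face_def)
  have "length v = 1" using 0 by (simp add: in_std_simplex)
  then have "map ((!) v) [0..<Suc 0] = v" by (cases v) auto
  then show ?case unfolding J by (simp add: face_dim_def)
next
  case (Suc k)
  have len: "length v = Suc (Suc k)" using Suc.prems(1) by (simp add: in_std_simplex)
  show ?case
  proof (cases "J = {0..Suc k}")
    case True
    have "map ((!) v) [0..<Suc (Suc k)] = v" using len by (metis map_nth)
    then show ?thesis unfolding True sorted_list_of_initial by (simp add: face_dim_def)
  next
    case False
    then obtain i where i: "i \<le> Suc k" "i \<notin> J" using Suc.prems(2) by (auto simp: is_face_def)
    define J' where "J' = codegen i ` J"
    have JJ: "J = coface i ` J'"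
    proof -
      have "coface i (codegen i x) = x" if "x \<in> J" for x
        using that i(2) by (cases "x = i") (auto simp: coface_def codegen_def)
      then show ?thesis unfolding J'_def image_image by simp
    qed
    have J': "is_face k J'"
    proof -
      have "codegen i x \<le> k" if "x \<in> J" for x
      proof -
        have "x \<noteq> i" "x \<le> Suc k" using that i(2) Suc.prems(2) by (auto simp: is_face_def)
        then show ?thesis using i(1) by (auto simp: codegen_def)
      qed
      then show ?thesis using Suc.prems(2) by (auto simp: is_face_def J'_def)
    qed
    have "f (Suc k) v J = face X (Suc k) i (f (Suc k) v) J'"
      using J' JJ by (simp add: HOM_def)
    also have "\<dots> = f k (take i v @ drop (Suc i) v) J'"
      using simplicial_mapD(3)[OF f i(1) Suc.prems(1)] by (simp add: face_std)
    also have "\<dots> = f (face_dim J') (map ((!) (take i v @ drop (Suc i) v)) (sorted_list_of_set J')) {0..face_dim J'}"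
      by (rule Suc.IH[OF _ J']) (use face_in_std[OF Suc.prems(1) i(1)] in \<open>simp add: face_std\<close>)
    also have "map ((!) (take i v @ drop (Suc i) v)) (sorted_list_of_set J') = map ((!) v) (sorted_list_of_set J)"
      unfolding JJ sorted_list_of_set_image[OF strict_mono_coface is_face_finite[OF J']]
      using delete_nth(2)[OF len i(1)] J' is_face_finite[OF J'] by (auto simp: is_face_def)
    also have "face_dim J' = face_dim J" unfolding JJ by (simp add: face_dim_image inj_coface)
    finally show ?thesis .
  qed
qed

lemma simplicial_map_degenerate:
  assumes f: "simplicial_map (std_simplex n) X f" and w: "w \<in> simplices (std_simplex n) d" and "\<not> distinct w"
  shows "f d w {0..d} = (\<lambda>_. 0)"
proof -
  have l: "length w = Suc d" "sorted w" using w by (auto simp: in_std_simplex)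
  have "\<exists>i. Suc i < length w \<and> w ! i = w ! Suc i"
  proof (rule ccontr)
    assume "\<not> ?thesis"
    then have "\<And>i. Suc i < length w \<Longrightarrow> w ! i < w ! Suc i"
      using sorted_nth_mono[OF l(2)] by (metis lessI less_imp_le_nat nat_less_le)
    then have "sorted_wrt (<) w" by (simp add: sorted_wrt_iff_nth_Suc_transp)
    then show False using assms(3) strict_sorted_iff by blast
  qed
  then obtain i where i: "Suc i < length w" "w ! i = w ! Suc i" by blast
  then obtain d' where d': "d = Suc d'" "i \<le> d'" using l(1) by (cases d) auto
  \<comment> \<open>Deleting one copy of the repeated value and doubling the other one gives back \<open>w\<close>.\<close>
  define w' where "w' = take i w @ drop (Suc i) w"
  have w': "w' \<in> simplices (std_simplex n) d'"
    using face_in_std[of w n d' i] w d' by (simp add: w'_def face_std)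
  have lw': "length w' = Suc d'" using w' by (simp add: in_std_simplex)
  have "w = degen (std_simplex n) d' i w'"
    unfolding degen_std
  proof (rule nth_equalityI)
    show "length w = length (take (Suc i) w' @ drop i w')" using repeat_nth(1)[OF lw' d'(2)] l d' by simp
    fix j assume "j < length w"
    then have j: "j \<le> Suc d'" using l d' by simp
    have "(take (Suc i) w' @ drop i w') ! j = w' ! codegen i j" using repeat_nth(2)[OF lw' d'(2) j] by simp
    also have "\<dots> = w ! coface i (codegen i j)"
      unfolding w'_def using delete_nth(2)[of w d' i "codegen i j"] repeat_nth(2)[OF lw' d'(2) j] l d' by simp
    also have "\<dots> = w ! j" using i(2) by (cases "j = i") (auto simp: coface_def codegen_def)
    finally show "w ! j = (take (Suc i) w' @ drop i w') ! j" ..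
  qed
  then have "f d w = degen X d' i (f d' w')"
    using simplicial_mapD(4)[OF f d'(2) w'] d'(1) by simp
  then show ?thesis using d' by (simp add: HOM_def)
qed

text \<open>
  Every component of every simplex \<open>f k v\<close> is a top component by \<open>simplicial_map_on_face\<close>. If \<open>v\<close>
  repeats a vertex, this component belongs to a degenerate simplex and vanishes; otherwise it is also
  the component of \<open>f n [0..<Suc n]\<close> at the image of \<open>v\<close>.
\<close>

lemma yoneda:
  assumes f: "simplicial_map (std_simplex n) X f"
  shows "n_morphism A B n (f n [0..<Suc n])" "f = simplex_map n (f n [0..<Suc n])"
proof -
  let ?\<Phi> = "f n [0..<Suc n]"
  show "n_morphism A B n ?\<Phi>" by (rule simplicial_mapD(1)[OF f identity_in_std])
  have "f k v J = pullback v ?\<Phi> J" if v: "v \<in> simplices (std_simplex n) k" for k v J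
  proof (cases "is_face k J")
    case False
    then have "f k v J = (\<lambda>_. 0)" using simplicial_mapD(1)[OF f v] unfolding n_morphism_iff by blast
    then show ?thesis using False v by (simp add: pullback_def in_std_simplex)
  next
    case True
    let ?d = "face_dim J" and ?w = "map ((!) v) (sorted_list_of_set J)"
    have fin: "finite J" using True is_face_finite by blast
    have card: "card J = Suc ?d" using is_face_card[OF True] by (simp add: face_dim_def)
    have set: "set ?w = (!) v ` J" using fin by simp
    have w: "?w \<in> simplices (std_simplex n) ?d"
    proof -
      have "sorted ?w"
        unfolding sorted_map
        by (rule sorted_wrt_mono_rel[OF _ sorted_sorted_list_of_set])
          (use v True fin in \<open>auto simp: in_std_simplex is_face_def intro!: sorted_nth_mono\<close>)
      then show ?thesis
        using is_face_nth[OF v True] card fin set by (simp add: in_std_simplex is_face_def)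
    qed
    have e: "f k v J = f ?d ?w {0..?d}" by (rule simplicial_map_on_face[OF f v True])
    show ?thesis
    proof (cases "inj_on ((!) v) J")
      case False
      then have "\<not> distinct ?w" using fin by (simp add: distinct_map)
      then have "f k v J = (\<lambda>_. 0)" unfolding e by (rule simplicial_map_degenerate[OF f w])
      then show ?thesis using False by (simp add: pullback_def)
    next
      case inj: True
      let ?I = "(!) v ` J"
      have sl: "sorted_list_of_set ?I = ?w"
        by (rule sorted_list_of_set_image[OF nth_strict_mono[OF v True inj] fin])
      have "map ((!) [0..<Suc n]) ?w = ?w"
      proof (rule map_idI)
        fix x assume "x \<in> set ?w"
        then have "x < Suc n" using w by (auto simp: in_std_simplex)
        then show "[0..<Suc n] ! x = x" by (simp del: upt_Suc)
      qed
      then have "?\<Phi> ?I = f ?d ?w {0..?d}"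
        using simplicial_map_on_face[OF f identity_in_std is_face_nth[OF v True]]
        unfolding sl face_dim_image[OF inj] by (simp only:)
      then show ?thesis using True inj v e by (simp add: pullback_def in_std_simplex)
    qed
  qed
  then show "f = simplex_map n ?\<Phi>"
    unfolding simplex_map_def using simplicial_mapD(2)[OF f]
    by (intro ext) (auto simp: restrict_def)
qed

section \<open>Families concentrated in the top two dimensions\<close>


text \<open>
  The families on the faces of \<open>\<Delta>\<^sup>m\<close> that are \<open>F\<close> on vertices and vanish in the dimensions
  \<open>1, \<dots>, n - 1\<close>, which occur for \<open>m = n\<close> and \<open>m = n + 1\<close>.
\<close>

definition concentrated :: "nat \<Rightarrow> nat \<Rightarrow> (nat set \<Rightarrow> 'a list \<Rightarrow> 'b) \<Rightarrow> bool" where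
  "concentrated n m \<Phi> \<longleftrightarrow> (\<forall>I. \<not> is_face m I \<longrightarrow> \<Phi> I = (\<lambda>_. 0)) \<and> (\<forall>a\<le>m. \<Phi> {a} = F) \<and>
     (\<forall>I. I \<subseteq> {0..m} \<longrightarrow> 2 \<le> card I \<longrightarrow> card I \<le> n \<longrightarrow> \<Phi> I = (\<lambda>_. 0))"

lemma concentratedD:
  assumes "concentrated n m \<Phi>"
  shows "\<not> is_face m I \<Longrightarrow> \<Phi> I = (\<lambda>_. 0)" "a \<le> m \<Longrightarrow> \<Phi> {a} = F"
    "I \<subseteq> {0..m} \<Longrightarrow> 2 \<le> card I \<Longrightarrow> card I \<le> n \<Longrightarrow> \<Phi> I = (\<lambda>_. 0)"
  using assms unfolding concentrated_def by blast+

lemma concentrated_card_1: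
  assumes "concentrated n m \<Phi>" "I \<subseteq> {0..m}" "card I = 1" shows "\<Phi> I = F"
proof -
  obtain a where "I = {a}" using assms(3) card_1_singletonE by blast
  then show ?thesis using concentratedD(2)[OF assms(1)] assms(2) by simp
qed

lemma face_equation_vertex:
  assumes "\<Phi> {a} = F" shows "face_equation \<Phi> {a}"
proof -
  have "partition_sum B \<Phi> {a} es xs = partition_sum B (vertex F) {0} es xs" if "xs \<noteq> []" for es xs
    unfolding partition_sum_vertex[OF that] by (simp add: assms vertex_def)
  then show ?thesis
    using F_multimap F_equation by (simp add: face_equation_def assms boundary_sum_def)
qed

text \<open>
  The faces of an edge are two copies of \<open>F\<close> with opposite signs; those of larger faces vanish.
\<close>

lemma boundary_sum_low:
  assumes c: "concentrated n m \<Phi>" and I: "is_face m I" "2 \<le> card I" "card I \<le> n + 1"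
  shows "boundary_sum \<Phi> I xs = 0"
proof -
  have fin: "finite I" using I(1) is_face_finite by blast
  have dim: "face_dim I = card I - 1" "face_dim I \<noteq> 0" using I(2) by (auto simp: face_dim_def)
  have bd: "bd_face j I \<subseteq> {0..m}" "card (bd_face j I) = card I - 1" if "j \<le> face_dim I" for j
    using bd_face_card[OF fin bd_face_is_face(3)[OF I(1) dim(2) that]] I(1) by (auto simp: is_face_def)
  show ?thesis
  proof (cases "card I = 2")
    case True
    then have "\<Phi> (bd_face j I) = F" if "j \<le> face_dim I" for j
      using bd[OF that] by (intro concentrated_card_1[OF c]) auto
    then have "boundary_sum \<Phi> I xs = (\<Sum>j\<in>{0..1}. with_sign (int j) (F xs))"
      using True dim by (simp add: boundary_sum_def)
    also have "{0..1} = {0, 1::nat}" by auto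
    finally show ?thesis by simp
  next
    case False
    then have "\<Phi> (bd_face j I) = (\<lambda>_. 0)" if "j \<le> face_dim I" for j
      using bd[OF that] I(2,3) by (intro concentratedD(3)[OF c]) auto
    then show ?thesis by (simp add: boundary_sum_def)
  qed
qed

lemma concentrated_Min_Max:
  assumes "concentrated n m \<Phi>" "is_face m I"
  shows "\<Phi> {Min I} = F" "\<Phi> {Max I} = F"
proof -
  have "Min I \<in> I" "Max I \<in> I" using assms(2) is_face_finite[OF assms(2)] by (auto simp: is_face_def)
  then show "\<Phi> {Min I} = F" "\<Phi> {Max I} = F"
    using assms(2) by (auto simp: is_face_def intro!: concentratedD(2)[OF assms(1)])
qed

lemma face_equation_low:
  assumes c: "concentrated n m \<Phi>" and I: "is_face m I" "card I = d + 1" "1 \<le> d" "d \<le> n"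
  shows "face_equation \<Phi> I \<longleftrightarrow> \<Phi> I \<in> coll d"
proof -
  have fin: "finite I" using I(1) is_face_finite by blast
  have dim: "face_dim I = d" using I(2) by (simp add: face_dim_def)
  have "boundary_sum \<Phi> I xs = 0" for xs
    by (rule boundary_sum_low[OF c I(1)]) (use I in auto)
  moreover have "partition_sum B \<Phi> I es xs = one_sum B F (- int d) (\<Phi> I) es xs" if "xs \<noteq> []" for es xs
    unfolding dim[symmetric]
  proof (rule partition_sum_one_large_part[where k = "d + 1"])
    show "\<Phi> J = (\<lambda>_. 0)" if "J \<subseteq> I" "2 \<le> card J" "card J < d + 1" for J
      using that I by (intro concentratedD(3)[OF c]) (auto simp: is_face_def)
  qed (use fin I that concentrated_Min_Max[OF c I(1)] opsB_multiadditive in auto)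
  ultimately show ?thesis
    unfolding face_equation_def collections_def dim by simp
qed

lemma n_morphism_low:
  assumes c: "concentrated n n \<Phi>" and n: "n \<ge> 1"
  shows "n_morphism A B n \<Phi> \<longleftrightarrow> \<Phi> {0..n} \<in> coll n"
proof
  assume "n_morphism A B n \<Phi>"
  then have "face_equation \<Phi> {0..n}" unfolding n_morphism_iff by (simp add: is_face_def)
  then show "\<Phi> {0..n} \<in> coll n"
    using face_equation_low[OF c, of "{0..n}" n] n by (simp add: is_face_def)
next
  assume top: "\<Phi> {0..n} \<in> coll n"
  have "face_equation \<Phi> I" if I: "is_face n I" for I
  proof -
    have sub: "I \<subseteq> {0..n}" using I by (simp add: is_face_def)
    have le: "card I \<le> n + 1" using card_mono[OF _ sub] by simp
    consider "card I = 1" | "2 \<le> card I" "card I \<le> n" | "card I = n + 1"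
      using is_face_card[OF I] le by linarith
    then show ?thesis
    proof cases
      case 1
      then obtain a where a: "I = {a}" using card_1_singletonE by blast
      show ?thesis unfolding a using sub a by (intro face_equation_vertex concentratedD(2)[OF c]) simp
    next
      case 2
      then have "\<Phi> I \<in> coll (card I - 1)" using concentratedD(3)[OF c sub] zero_in_collections by simp
      then show ?thesis using face_equation_low[OF c I, of "card I - 1"] 2 by simp
    next
      case 3
      then have "I = {0..n}" using card_subset_eq[OF _ sub] by simp
      then show ?thesis using face_equation_low[OF c I 3] n top by simp
    qed
  qed
  then show "n_morphism A B n \<Phi>" unfolding n_morphism_iff using concentratedD(1)[OF c] by blast
qed

text \<open>
  The equation for the top face of \<open>\<Delta>\<^sup>n\<^sup>+\<^sup>1\<close>: the alternating sum of the codimension one components is a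
  boundary, up to a product of the edges \<open>01\<close> and \<open>12\<close> (the faces \<open>2\<close> and \<open>0\<close>) of a triangle.
\<close>

definition top_equation :: "nat \<Rightarrow> (nat \<Rightarrow> 'a list \<Rightarrow> 'b) \<Rightarrow> ('a list \<Rightarrow> 'b) \<Rightarrow> bool" where
  "top_equation n w H \<longleftrightarrow> mmap (- int (n + 1)) H \<and>
     (\<forall>xs. (\<Sum>j\<le>Suc n. with_sign (int j) (w j xs))
        = defect (- int (n + 1), H) xs + (if n = 1 then cup (-1) (-1) (w 2) (w 0) xs else 0))"

lemma face_equation_top:
  assumes c: "concentrated n (Suc n) \<Phi>" and n: "n \<ge> 1"
    and faces: "\<And>j. j \<le> Suc n \<Longrightarrow> \<Phi> ({0..Suc n} - {j}) \<in> coll n"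
  shows "face_equation \<Phi> {0..Suc n} \<longleftrightarrow> top_equation n (\<lambda>j. \<Phi> ({0..Suc n} - {j})) (\<Phi> {0..Suc n})"
proof -
  let ?I = "{0..Suc n}" and ?w = "\<lambda>j. \<Phi> ({0..Suc n} - {j})"
  have I: "is_face (Suc n) ?I" by (simp add: is_face_def)
  have dim: "face_dim ?I = n + 1" by (simp add: face_dim_def)
  have bs: "boundary_sum \<Phi> ?I xs = (\<Sum>j\<le>Suc n. with_sign (int j) (?w j xs))" for xs
    unfolding boundary_sum_def dim atMost_atLeast0 by (simp add: bd_face_initial del: sum.cl_ivl_Suc)
  have m: "multiadditive (?w j)" if "j \<le> Suc n" for j
    using faces[OF that] multimapD(2) unfolding in_collections by blast
  have ps: "partition_sum B \<Phi> ?I es xs = one_sum B F (- int (n + 1)) (\<Phi> ?I) es xs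
      + (if n = 1 then cup (-1) (-1) (?w 2) (?w 0) xs else 0)" if xs: "xs \<noteq> []" "homog SA es xs" for es xs
  proof (cases "n = 1")
    case True
    have s: "{0..Suc n} = {0, 1, 2}" "{0, 1, 2} - {2} = {0, 1::nat}" "{0, 1, 2} - {0} = {1, 2::nat}"
      using True by auto
    have "partition_sum B \<Phi> {0, 1, 2} es xs = one_sum B F (-2) (\<Phi> {0, 1, 2}) es xs + two_sum B F (\<Phi> {0, 1}) (\<Phi> {1, 2}) es xs"
      by (rule partition_sum_triangle) (use xs True concentratedD(2)[OF c] in auto)
    also have "two_sum B F (\<Phi> {0, 1}) (\<Phi> {1, 2}) es xs = cup (-1) (-1) (\<Phi> {0, 1}) (\<Phi> {1, 2}) xs"
      using m[of 2] m[of 0] True s by (intro cup_homog[OF _ _ xs(2)]) simp_all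
    finally show ?thesis using True unfolding s by simp
  next
    case False
    have "partition_sum B \<Phi> ?I es xs = one_sum B F (- int (face_dim ?I)) (\<Phi> ?I) es xs"
    proof (rule partition_sum_one_large_part[where k = "n + 1"])
      show "\<Phi> J = (\<lambda>_. 0)" if "J \<subseteq> ?I" "2 \<le> card J" "card J < n + 1" for J
        using that by (intro concentratedD(3)[OF c]) auto
      show "\<Phi> {Min ?I} = F" "\<Phi> {Max ?I} = F" using concentrated_Min_Max[OF c I] .
    qed (use n False xs opsB_multiadditive in auto)
    then show ?thesis using False unfolding dim by simp
  qed
  show ?thesis
  proof (cases "mmap (- int (n + 1)) (\<Phi> ?I)")
    case H: True
    have cup: "multiadditive (\<lambda>xs. if n = 1 then cup (-1) (-1) (?w 2) (?w 0) xs else 0)"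
    proof (cases "n = 1")
      case True
      have "mmap (-1) (?w 2)" "mmap (-1) (?w 0)" using faces[of 2] faces[of 0] True unfolding in_collections by simp_all
      from multimapD(2)[OF cup_mmap[OF this]] show ?thesis using True by simp
    qed (simp add: multiadditive_zero)
    have ms: "multiadditive (\<lambda>xs. \<Sum>j\<in>S. with_sign (int j) (?w j xs))" if "S \<subseteq> {..Suc n}" for S
      using finite_subset[OF that finite_atMost] that
      by (induction S rule: finite_induct) (auto intro!: multiadditive_zero multiadditive_add multiadditive_with_sign m)
    have e: "boundary_sum \<Phi> ?I xs + with_sign (int (face_dim ?I)) (pre_sum A (\<Phi> ?I) es xs) = partition_sum B \<Phi> ?I es xs
      \<longleftrightarrow> (\<Sum>j\<le>Suc n. with_sign (int j) (?w j xs)) = defect (- int (n + 1), \<Phi> ?I) xs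
        + (if n = 1 then cup (-1) (-1) (?w 2) (?w 0) xs else 0)" if xs: "xs \<noteq> []" "homog SA es xs" for es xs
      unfolding ps[OF xs] bs dim defect_homog[OF multimapD(2)[OF H] xs(2), symmetric] with_sign_simps(5)
      by (simp add: algebra_simps del: sum.atMost_Suc)
    have "(\<forall>es xs. xs \<noteq> [] \<longrightarrow> homog SA es xs \<longrightarrow>
        boundary_sum \<Phi> ?I xs + with_sign (int (face_dim ?I)) (pre_sum A (\<Phi> ?I) es xs) = partition_sum B \<Phi> ?I es xs)
      \<longleftrightarrow> (\<forall>xs. (\<Sum>j\<le>Suc n. with_sign (int j) (?w j xs))
        = defect (- int (n + 1), \<Phi> ?I) xs + (if n = 1 then cup (-1) (-1) (?w 2) (?w 0) xs else 0))" (is "?L \<longleftrightarrow> ?R")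
    proof
      assume L: ?L
      have n0: "?w j [] = 0" if "j \<le> Suc n" for j
        using faces[OF that] multimapD(1) unfolding in_collections by blast
      have nil: "(\<Sum>j\<le>Suc n. with_sign (int j) (?w j [])) = 0" by (rule sum.neutral) (simp add: n0)
      show ?R
      proof
        show "(\<Sum>j\<le>Suc n. with_sign (int j) (?w j xs))
        = defect (- int (n + 1), \<Phi> ?I) xs + (if n = 1 then cup (-1) (-1) (?w 2) (?w 0) xs else 0)" for xs
          by (rule multiadditive_ext[OF GA ms[OF order_refl] multiadditive_add[OF defect_multiadditive[OF multimapD(2)[OF H]] cup]])
            (use L e nil in \<open>auto simp: cup_def simp del: sum.atMost_Suc\<close>)
      qed
    qed (use e in blast)
    then show ?thesis using H unfolding face_equation_def top_equation_def dim by blast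
  next
    case False
    then show ?thesis unfolding face_equation_def top_equation_def dim by blast
  qed
qed

lemma card_codim_1:
  assumes "I \<subseteq> {0..Suc n}" "card I = n + 1"
  obtains j where "j \<le> Suc n" "I = {0..Suc n} - {j}"
proof -
  have "card ({0..Suc n} - I) = 1"
    using assms card_Diff_subset[OF finite_subset[OF assms(1)] assms(1)] by simp
  then obtain j where j: "{0..Suc n} - I = {j}" using card_1_singletonE by blast
  then have "j \<le> Suc n" "I = {0..Suc n} - {j}" using assms(1) by auto
  then show ?thesis using that by blast
qed

text \<open>
  The equations for vertices hold because \<open>F\<close> is a morphism, those in the dimensions \<open>1, \<dots>, n - 1\<close>
  because \<open>0\<close> is a cycle.
\<close>

lemma n_morphism_top:
  assumes c: "concentrated n (Suc n) \<Phi>" and n: "n \<ge> 1"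
  shows "n_morphism A B (Suc n) \<Phi> \<longleftrightarrow> (\<forall>j\<le>Suc n. \<Phi> ({0..Suc n} - {j}) \<in> coll n) \<and>
     top_equation n (\<lambda>j. \<Phi> ({0..Suc n} - {j})) (\<Phi> {0..Suc n})"
proof -
  have fj: "is_face (Suc n) ({0..Suc n} - {j})" "card ({0..Suc n} - {j}) = n + 1" if "j \<le> Suc n" for j
  proof -
    show "card ({0..Suc n} - {j}) = n + 1" using that by simp
    then show "is_face (Suc n) ({0..Suc n} - {j})" unfolding is_face_def by (metis Diff_subset add_is_0 card.empty one_neq_zero)
  qed
  have low: "face_equation \<Phi> ({0..Suc n} - {j}) \<longleftrightarrow> \<Phi> ({0..Suc n} - {j}) \<in> coll n" if "j \<le> Suc n" for j
    by (rule face_equation_low[OF c fj[OF that] n]) simp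
  have top: "is_face (Suc n) {0..Suc n}" by (simp add: is_face_def)
  show ?thesis
  proof
    assume "n_morphism A B (Suc n) \<Phi>"
    then have fe: "face_equation \<Phi> I" if "is_face (Suc n) I" for I using that unfolding n_morphism_iff by blast
    then have "\<forall>j\<le>Suc n. \<Phi> ({0..Suc n} - {j}) \<in> coll n" using low fj(1) by blast
    then show "(\<forall>j\<le>Suc n. \<Phi> ({0..Suc n} - {j}) \<in> coll n) \<and>
     top_equation n (\<lambda>j. \<Phi> ({0..Suc n} - {j})) (\<Phi> {0..Suc n})"
      using face_equation_top[OF c n] fe[OF top] by blast
  next
    assume r: "(\<forall>j\<le>Suc n. \<Phi> ({0..Suc n} - {j}) \<in> coll n) \<and>
     top_equation n (\<lambda>j. \<Phi> ({0..Suc n} - {j})) (\<Phi> {0..Suc n})"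
    have "face_equation \<Phi> I" if I: "is_face (Suc n) I" for I
    proof -
      have sub: "I \<subseteq> {0..Suc n}" using I by (simp add: is_face_def)
      have le: "card I \<le> n + 2" using card_mono[OF _ sub] by simp
      consider "card I = 1" | "2 \<le> card I" "card I \<le> n" | "card I = n + 1" | "card I = n + 2"
        using is_face_card[OF I] le by linarith
      then show ?thesis
      proof cases
        case 1
        then obtain a where a: "I = {a}" using card_1_singletonE by blast
        show ?thesis unfolding a using sub a by (intro face_equation_vertex concentratedD(2)[OF c]) simp
      next
        case 2
        then have "\<Phi> I \<in> coll (card I - 1)" using concentratedD(3)[OF c sub] zero_in_collections by simp
        then show ?thesis using face_equation_low[OF c I, of "card I - 1"] 2 by simp
      next
        case 3
        then obtain j where "j \<le> Suc n" "I = {0..Suc n} - {j}" using card_codim_1[OF sub] by blast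
        then show ?thesis using low r by blast
      next
        case 4
        then have "I = {0..Suc n}" using card_subset_eq[OF _ sub] by simp
        then show ?thesis using face_equation_top[OF c n] r by blast
      qed
    qed
    then show "n_morphism A B (Suc n) \<Phi>" unfolding n_morphism_iff using concentratedD(1)[OF c] by blast
  qed
qed

definition sphere_family :: "nat \<Rightarrow> ('a list \<Rightarrow> 'b) \<Rightarrow> nat set \<Rightarrow> 'a list \<Rightarrow> 'b" where
  "sphere_family n G I = (if \<not> is_face n I then (\<lambda>_. 0) else if card I = 1 then F else if I = {0..n} then G else (\<lambda>_. 0))"

text \<open>
  The codimension one face opposite to \<open>j\<close> carries \<open>w j\<close>; the \<open>Min\<close> recovers \<open>j\<close> from the face.
\<close>

definition ball_family :: "nat \<Rightarrow> (nat \<Rightarrow> 'a list \<Rightarrow> 'b) \<Rightarrow> ('a list \<Rightarrow> 'b) \<Rightarrow> nat set \<Rightarrow> 'a list \<Rightarrow> 'b" where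
  "ball_family n w H I = (if \<not> is_face (Suc n) I then (\<lambda>_. 0) else if card I = 1 then F
     else if I = {0..Suc n} then H else if card I = n + 1 then w (Min ({0..Suc n} - I)) else (\<lambda>_. 0))"

lemma concentrated_sphere_family: "n \<ge> 1 \<Longrightarrow> concentrated n n (sphere_family n G)"
  by (auto simp: concentrated_def sphere_family_def is_face_def)

lemma concentrated_ball_family: "n \<ge> 1 \<Longrightarrow> concentrated n (Suc n) (ball_family n w H)"
  by (auto simp: concentrated_def ball_family_def is_face_def)

lemma sphere_family_top: "n \<ge> 1 \<Longrightarrow> sphere_family n G {0..n} = G"
  by (simp add: sphere_family_def is_face_def)

lemma ball_family_top: "n \<ge> 1 \<Longrightarrow> ball_family n w H {0..Suc n} = H"
  by (simp add: ball_family_def is_face_def)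

lemma ball_family_face:
  assumes "n \<ge> 1" "j \<le> Suc n" shows "ball_family n w H ({0..Suc n} - {j}) = w j"
proof -
  define I where "I = {0..Suc n} - {j}"
  have c: "card I = n + 1" using assms(2) by (simp add: I_def)
  have "I \<noteq> {}" using c by (metis add_is_0 card.empty one_neq_zero)
  then have f: "is_face (Suc n) I" by (auto simp: is_face_def I_def)
  have d: "{0..Suc n} - I = {j}" using assms(2) by (auto simp: I_def)
  have "j \<in> {0..Suc n}" using assms(2) by simp
  then have "I \<noteq> {0..Suc n}" unfolding I_def by blast
  moreover have "card I \<noteq> 1" using c assms(1) by simp
  ultimately have "ball_family n w H I = w j"
    unfolding ball_family_def d using f c by simp
  then show ?thesis unfolding I_def .
qed

lemma n_morphism_sphere_family:
  "n \<ge> 1 \<Longrightarrow> n_morphism A B n (sphere_family n G) \<longleftrightarrow> G \<in> coll n"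
  using n_morphism_low[OF concentrated_sphere_family] by (simp add: sphere_family_top)

lemma n_morphism_ball_family:
  assumes "n \<ge> 1"
  shows "n_morphism A B (Suc n) (ball_family n w H) \<longleftrightarrow> (\<forall>j\<le>Suc n. w j \<in> coll n) \<and> top_equation n w H"
proof -
  have "top_equation n (\<lambda>j. ball_family n w H ({0..Suc n} - {j})) H \<longleftrightarrow> top_equation n w H"
  proof -
    have s: "(\<Sum>j\<le>Suc n. with_sign (int j) (ball_family n w H ({0..Suc n} - {j}) xs)) = (\<Sum>j\<le>Suc n. with_sign (int j) (w j xs))" for xs
      by (rule sum.cong[OF refl]) (simp add: ball_family_face[OF assms] del: atLeastAtMost_iff)
    have z: "ball_family n w H ({0..Suc n} - {0}) = w 0" by (rule ball_family_face[OF assms]) simp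
    have t: "ball_family n w H ({0..Suc n} - {2}) = w 2" if "n = 1"
      by (rule ball_family_face[OF assms]) (simp add: that)
    show ?thesis
      unfolding top_equation_def s z using t by (cases "n = 1") (simp_all only: if_True if_False)
  qed
  then show ?thesis
    using n_morphism_top[OF concentrated_ball_family[OF assms] assms, of w H]
    unfolding ball_family_top[OF assms] using ball_family_face[OF assms, of _ w H] by metis
qed

lemma concentrated_low_eq_sphere_family:
  assumes "concentrated n n \<Phi>" "n \<ge> 1"
  shows "\<Phi> = sphere_family n (\<Phi> {0..n})"
proof
  fix I
  show "\<Phi> I = sphere_family n (\<Phi> {0..n}) I"
  proof (cases "is_face n I")
    case True
    then have sub: "I \<subseteq> {0..n}" by (simp add: is_face_def)
    have "card I \<le> n + 1" using card_mono[OF _ sub] by simp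
    then have "card I \<le> n \<or> I = {0..n}" using card_subset_eq[OF _ sub] by (cases "card I = n + 1") simp_all
    then show ?thesis
      using True concentrated_card_1[OF assms(1) sub] concentratedD(3)[OF assms(1) sub] is_face_card[OF True]
      unfolding sphere_family_def by (cases "card I = 1") auto
  qed (simp add: sphere_family_def concentratedD(1)[OF assms(1)])
qed

text \<open>
  The totally degenerate simplex on \<open>F\<close>, in closed form.
\<close>

definition const_family :: "nat \<Rightarrow> nat set \<Rightarrow> 'a list \<Rightarrow> 'b" where
  "const_family k J = (if is_face k J \<and> card J = 1 then F else (\<lambda>_. 0))"

lemma const_simplex_eq: "const_simplex X (vertex F) k = const_family k"
proof (induction k)
  case 0
  show ?case
  proof
    fix J
    have "is_face 0 J \<longleftrightarrow> J = {0}" by (auto simp: is_face_def)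
    then show "const_simplex X (vertex F) 0 J = const_family 0 J"
      by (simp add: const_family_def vertex_def)
  qed
next
  case (Suc k)
  show ?case
  proof
    fix J
    have rec: "const_simplex X (vertex F) (Suc k) J
      = (if is_face (Suc k) J \<and> \<not> {0, Suc 0} \<subseteq> J then const_family k (codegen 0 ` J) else (\<lambda>_. 0))"
      by (simp only: const_simplex.simps Suc) (simp add: HOM_def)
    show "const_simplex X (vertex F) (Suc k) J = const_family (Suc k) J"
    proof (cases "is_face (Suc k) J \<and> \<not> {0, Suc 0} \<subseteq> J")
      case True
      then have "inj_on (codegen 0) J" by (simp add: inj_codegen)
      then have "card (codegen 0 ` J) = card J" by (rule card_image)
      moreover have "is_face k (codegen 0 ` J)"
      proof -
        have "codegen 0 x \<le> k" if "x \<in> J" for x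
          using that True by (auto simp: is_face_def codegen_def)
        then show ?thesis using True by (auto simp: is_face_def)
      qed
      ultimately show ?thesis using True unfolding rec by (simp add: const_family_def)
    next
      case False
      have "card J \<noteq> 1" if "{0, Suc 0} \<subseteq> J"
      proof
        assume "card J = 1"
        then obtain a where "J = {a}" using card_1_singletonE by blast
        then show False using that by auto
      qed
      then show ?thesis using False unfolding rec by (auto simp: const_family_def)
    qed
  qed
qed

lemma pullback_eq_const:
  assumes "v \<in> simplices (std_simplex m) k" "\<And>a. a \<le> m \<Longrightarrow> \<Phi> {a} = F"
    and "\<And>I. I \<subseteq> set v \<Longrightarrow> card I \<ge> 2 \<Longrightarrow> \<Phi> I = (\<lambda>_. 0)"
  shows "pullback v \<Phi> = const_family k"
proof
  fix J
  have l: "length v = Suc k" using assms(1) by (simp add: in_std_simplex)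
  show "pullback v \<Phi> J = const_family k J"
  proof (cases "is_face k J \<and> inj_on ((!) v) J")
    case True
    then have J: "is_face k J" and inj: "inj_on ((!) v) J" by auto
    have im: "(!) v ` J \<subseteq> set v" using J l by (auto simp: is_face_def less_Suc_eq_le)
    have card: "card ((!) v ` J) = card J" by (rule card_image[OF inj])
    show ?thesis
    proof (cases "card J = 1")
      case True
      then obtain a where a: "(!) v ` J = {a}" using card card_1_singletonE by metis
      then have "a \<le> m" using is_face_nth[OF assms(1) J] by (simp add: is_face_def)
      then show ?thesis using True J inj l a assms(2) by (simp add: pullback_def const_family_def)
    next
      case False
      then have "card ((!) v ` J) \<ge> 2" using is_face_card[OF J] card by linarith
      then show ?thesis using False J inj l assms(3)[OF im] by (simp add: pullback_def const_family_def)
    qed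
  next
    case False
    have "card J \<noteq> 1" if "\<not> inj_on ((!) v) J"
    proof
      assume "card J = 1"
      then obtain a where "J = {a}" using card_1_singletonE by blast
      then show False using that by simp
    qed
    then show ?thesis using False l by (auto simp: pullback_def const_family_def)
  qed
qed

abbreviation "Sph n \<equiv> spheres X (vertex F) n"
abbreviation "sphere_map n G \<equiv> simplex_map n (sphere_family n G)"

lemma pullback_boundary:
  assumes "v \<in> simplices (std_simplex n) k" "in_boundary n v" "n \<ge> 1"
  shows "pullback v (sphere_family n G) = const_family k"
proof (rule pullback_eq_const[OF assms(1)])
  show "sphere_family n G {a} = F" if "a \<le> n" for a
    by (rule concentratedD(2)[OF concentrated_sphere_family[OF assms(3)] that])
  fix I assume I: "I \<subseteq> set v" "card I \<ge> 2"
  then have "I \<noteq> {0..n}" using assms(1,2) by (auto simp: in_boundary_def in_std_simplex)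
  then show "sphere_family n G I = (\<lambda>_. 0)" using I by (simp add: sphere_family_def)
qed

lemma sphere_map_in_spheres:
  assumes "G \<in> coll n" "n \<ge> 1" shows "sphere_map n G \<in> Sph n"
  using simplex_map_simplicial[of n "sphere_family n G"] n_morphism_sphere_family[OF assms(2)] assms(1)
    pullback_boundary[OF _ _ assms(2)]
  by (simp add: spheres_def const_simplex_eq simplex_map_def)

lemma pullback_identity:
  assumes "is_face n I" shows "pullback [0..<Suc n] \<Phi> I = \<Phi> I"
proof -
  have "[0..<Suc n] ! x = x" if "x \<in> I" for x
    using assms that by (subst nth_upt) (auto simp: is_face_def less_Suc_eq_le)
  then have "(!) [0..<Suc n] ` I = I" "inj_on ((!) [0..<Suc n]) I"
    by (auto simp: image_iff inj_on_def simp del: upt_Suc)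
  then show ?thesis using assms by (simp add: pullback_def del: upt_Suc)
qed

lemma simplex_map_identity:
  "is_face n I \<Longrightarrow> simplex_map n \<Phi> n [0..<Suc n] I = \<Phi> I"
  using identity_in_std pullback_identity by (simp add: simplex_map_def del: upt_Suc)

lemma top_component_simplex_map: "top_component n (simplex_map n \<Phi>) = \<Phi> {0..n}"
  unfolding top_component_def by (rule simplex_map_identity) (simp add: is_face_def)

text \<open>
  The proper faces of \<open>\<Delta>\<^sup>n\<close> lie in the boundary; so the family at \<open>[0..<Suc n]\<close> is \<open>F\<close> on
  vertices and \<open>0\<close> on all other proper faces.
\<close>

lemma sphere_eq_sphere_map:
  assumes f: "f \<in> Sph n" and n: "n \<ge> 1"
  shows "top_component n f \<in> coll n" "f = sphere_map n (top_component n f)"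
proof -
  let ?\<Phi> = "f n [0..<Suc n]"
  have s: "simplicial_map (std_simplex n) X f" and bd: "\<And>k v. v \<in> simplices (std_simplex n) k \<Longrightarrow> in_boundary n v \<Longrightarrow> f k v = const_family k"
    using f by (auto simp: spheres_def const_simplex_eq)
  have m: "n_morphism A B n ?\<Phi>" by (rule yoneda(1)[OF s])
  have proper: "?\<Phi> I = const_family n I" if I: "is_face n I" "I \<noteq> {0..n}" for I
  proof -
    have fin: "finite I" using I is_face_finite by blast
    have sub: "I \<subseteq> {0..n}" using I by (simp add: is_face_def)
    have w: "map ((!) [0..<Suc n]) (sorted_list_of_set I) = sorted_list_of_set I"
      by (rule map_idI, subst nth_upt) (use sub fin in \<open>auto simp: less_Suc_eq_le\<close>)
    have d: "face_dim I + 1 = card I" using is_face_card[OF I(1)] by (simp add: face_dim_def)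
    have "sorted_list_of_set I \<in> simplices (std_simplex n) (face_dim I)"
      using fin sub d by (simp add: in_std_simplex)
    then have "f (face_dim I) (sorted_list_of_set I) = const_family (face_dim I)"
      by (rule bd) (use fin I in \<open>simp add: in_boundary_def\<close>)
    then have "?\<Phi> I = const_family (face_dim I) {0..face_dim I}"
      using simplicial_map_on_face[OF s identity_in_std I(1)] unfolding w by simp
    then show ?thesis using I(1) d by (auto simp: const_family_def is_face_def)
  qed
  have ne: "I \<noteq> {0..n}" if "card I \<le> n" for I using that by auto
  have c: "concentrated n n ?\<Phi>"
    unfolding concentrated_def
  proof (intro conjI allI impI)
    show "?\<Phi> I = (\<lambda>_. 0)" if "\<not> is_face n I" for I using m that unfolding n_morphism_iff by blast
    show "?\<Phi> {a} = F" if "a \<le> n" for a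
      using proper[OF _ ne, of "{a}"] n that by (simp add: const_family_def is_face_def)
    show "?\<Phi> I = (\<lambda>_. 0)" if "I \<subseteq> {0..n}" "2 \<le> card I" "card I \<le> n" for I
    proof -
      have "is_face n I" using that by (auto simp: is_face_def)
      then show ?thesis using proper[OF _ ne[OF that(3)]] that(2) by (simp add: const_family_def del: upt_Suc)
    qed
  qed
  have e: "?\<Phi> = sphere_family n (top_component n f)"
    unfolding top_component_def by (rule concentrated_low_eq_sphere_family[OF c n])
  show "top_component n f \<in> coll n"
    using m n_morphism_sphere_family[OF n] unfolding e by blast
  show "f = sphere_map n (top_component n f)"
    using yoneda(2)[OF s] unfolding e .
qed

end

section \<open>Homotopies\<close>

lemma map_in_std:
  assumes "v \<in> simplices (std_simplex m) k" "mono \<alpha>" "\<And>x. x \<le> m \<Longrightarrow> \<alpha> x \<le> n"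
  shows "map \<alpha> v \<in> simplices (std_simplex n) k"
  using assms by (auto simp: in_std_simplex sorted_map intro: sorted_wrt_mono_rel[of v "(\<le>)"] dest: monoD)

context hom_data
begin

lemma coface_face: "is_face n I \<Longrightarrow> is_face (Suc n) (coface j ` I)"
  by (auto simp: is_face_def coface_def)

lemma coface_initial: "j \<le> Suc n \<Longrightarrow> coface j ` {0..n} = {0..Suc n} - {j}"
proof (rule card_subset_eq)
  show "coface j ` {0..n} \<subseteq> {0..Suc n} - {j}" by (auto simp: coface_def)
  show "card (coface j ` {0..n}) = card ({0..Suc n} - {j})" if "j \<le> Suc n"
    using that by (simp add: card_image inj_coface)
qed simp

lemma coface_preimage:
  assumes "I \<subseteq> {0..Suc n}" "j \<notin> I" "j \<le> Suc n" "I \<noteq> {}"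
  obtains I' where "is_face n I'" "I = coface j ` I'" "card I' = card I"
proof -
  define I' where "I' = {x \<in> {0..n}. coface j x \<in> I}"
  have sub: "I \<subseteq> coface j ` {0..n}"
    unfolding coface_initial[OF assms(3)] using assms(1,2) by blast
  have e: "I = coface j ` I'"
  proof
    show "I \<subseteq> coface j ` I'" using sub by (auto simp: I'_def)
    show "coface j ` I' \<subseteq> I" by (auto simp: I'_def)
  qed
  have "I' \<noteq> {}" using e assms(4) by (metis image_empty)
  then have "is_face n I'" by (auto simp: is_face_def I'_def)
  moreover have "card I' = card I" unfolding e by (rule card_image[OF inj_coface, symmetric])
  ultimately show ?thesis using that e by metis
qed

lemma concentrated_coface:
  assumes c: "concentrated n (Suc n) \<Phi>" and "j \<le> Suc n" "is_face n I"
  shows "\<Phi> (coface j ` I) = sphere_family n (\<Phi> ({0..Suc n} - {j})) I"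
proof -
  have sub: "coface j ` I \<subseteq> {0..Suc n}" using coface_face[OF assms(3)] by (simp add: is_face_def)
  have card: "card (coface j ` I) = card I" by (rule card_image[OF inj_coface])
  have "I \<subseteq> {0..n}" using assms(3) by (simp add: is_face_def)
  then have le: "card I \<le> n + 1" "card I = n + 1 \<Longrightarrow> I = {0..n}"
    using card_mono[of "{0..n}" I] card_subset_eq[of "{0..n}" I] by simp_all
  consider "card I = 1" | "card I \<noteq> 1" "I = {0..n}" | "2 \<le> card I" "card I \<le> n" "I \<noteq> {0..n}"
    using is_face_card[OF assms(3)] le by linarith
  then show ?thesis
  proof cases
    case 1
    then show ?thesis using concentrated_card_1[OF c sub] card assms(3) by (simp add: sphere_family_def)
  next
    case 2
    then show ?thesis using assms(3) coface_initial[OF assms(2)] by (simp add: sphere_family_def)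
  next
    case 3
    then show ?thesis using concentratedD(3)[OF c sub] card assms(3) by (simp add: sphere_family_def)
  qed
qed

lemma pullback_map_coface:
  assumes "v \<in> simplices (std_simplex n) k"
  shows "pullback (map (coface j) v) \<Phi> J = pullback v (\<lambda>I. \<Phi> (coface j ` I)) J"
proof (cases "is_face k J")
  case True
  have l: "length v = Suc k" using assms by (simp add: in_std_simplex)
  have nth: "map (coface j) v ! x = coface j (v ! x)" if "x \<in> J" for x
    using that True l by (auto simp: is_face_def less_Suc_eq_le)
  have "inj_on ((!) (map (coface j) v)) J \<longleftrightarrow> inj_on (coface j \<circ> (!) v) J"
    by (rule inj_on_cong) (simp add: nth)
  also have "\<dots> \<longleftrightarrow> inj_on ((!) v) J"
    using comp_inj_on[OF _ inj_coface] inj_on_imageI2 by blast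
  finally have "inj_on ((!) (map (coface j) v)) J \<longleftrightarrow> inj_on ((!) v) J" .
  moreover have "(!) (map (coface j) v) ` J = coface j ` (!) v ` J"
    unfolding image_image by (rule image_cong[OF refl nth])
  ultimately show ?thesis using True l by (simp add: pullback_def)
next
  case False
  then show ?thesis using assms by (simp add: pullback_def in_std_simplex)
qed

lemma pullback_cong:
  assumes "v \<in> simplices (std_simplex n) k" "\<And>I. is_face n I \<Longrightarrow> \<Phi> I = \<Psi> I"
  shows "pullback v \<Phi> = pullback v \<Psi>"
proof
  fix J
  show "pullback v \<Phi> J = pullback v \<Psi> J"
    using assms(2)[OF is_face_nth[OF assms(1), of J]] assms(1) by (auto simp: pullback_def in_std_simplex)
qed

lemma pullback_concentrated_coface:
  assumes "concentrated n (Suc n) \<Phi>" "j \<le> Suc n" "v \<in> simplices (std_simplex n) k"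
  shows "pullback (map (coface j) v) \<Phi> = pullback v (sphere_family n (\<Phi> ({0..Suc n} - {j})))"
proof -
  have "pullback (map (coface j) v) \<Phi> = pullback v (\<lambda>I. \<Phi> (coface j ` I))"
    by (rule ext) (rule pullback_map_coface[OF assms(3)])
  also have "\<dots> = pullback v (sphere_family n (\<Phi> ({0..Suc n} - {j})))"
    by (rule pullback_cong[OF assms(3)]) (rule concentrated_coface[OF assms(1,2)])
  finally show ?thesis .
qed

lemma bij_betw_top_component:
  assumes "n \<ge> 1" shows "bij_betw (top_component n) (Sph n) (coll n)"
proof (rule bij_betw_imageI)
  show "inj_on (top_component n) (Sph n)"
  proof (rule inj_onI)
    fix f g assume fg: "f \<in> Sph n" "g \<in> Sph n" "top_component n f = top_component n g"
    have "f = sphere_map n (top_component n f)" by (rule sphere_eq_sphere_map(2)[OF fg(1) assms])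
    also have "\<dots> = sphere_map n (top_component n g)" unfolding fg(3) ..
    also have "\<dots> = g" by (rule sphere_eq_sphere_map(2)[OF fg(2) assms, symmetric])
    finally show "f = g" .
  qed
  show "top_component n ` Sph n = coll n"
  proof (intro equalityI subsetI)
    fix G assume "G \<in> coll n"
    from sphere_map_in_spheres[OF this assms] show "G \<in> top_component n ` Sph n"
      by (rule rev_image_eqI) (simp add: top_component_simplex_map sphere_family_top[OF assms])
  qed (use sphere_eq_sphere_map(1)[OF _ assms] in blast)
qed

lemma top_component_sphere_map: "n \<ge> 1 \<Longrightarrow> top_component n (sphere_map n G) = G"
  by (simp add: top_component_simplex_map sphere_family_top)

lemma sum_last_two:
  fixes f :: "nat \<Rightarrow> 'b"
  assumes "\<And>j. j < n \<Longrightarrow> f j = 0" shows "(\<Sum>j\<le>Suc n. f j) = f n + f (Suc n)"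
proof -
  have "(\<Sum>j\<le>n. f j) = f n"
    unfolding lessThan_Suc_atMost[symmetric] by (simp add: assms)
  then show ?thesis by simp
qed

lemma defect_with_sign: "defect (d, \<lambda>us. with_sign k (g us)) xs = with_sign k (defect (d, g) xs)"
  by (cases "even k") (simp_all add: with_sign_def defect_uminus)

text \<open>
  A monotone map from the vertices of \<open>\<Delta>\<^sup>1 \<times> \<Delta>\<^sup>n\<close> to \<open>\<Delta>\<^sup>n\<^sup>+\<^sup>1\<close> which sends the ends of the prism to the faces
  opposite to \<open>n + 1\<close> and to \<open>n\<close>. Over a proper face of \<open>\<Delta>\<^sup>n\<close> its image misses some \<open>j < n\<close> or both \<open>n\<close>
  and \<open>n + 1\<close>.
\<close>

definition prism_collapse :: "nat \<Rightarrow> nat \<Rightarrow> nat \<Rightarrow> nat" where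
  "prism_collapse n u v = (if u = 1 \<and> v = n then Suc n else v)"

lemma prism_collapse_in_std:
  assumes "u \<in> simplices (std_simplex 1) k" "v \<in> simplices (std_simplex n) k"
  shows "map2 (prism_collapse n) u v \<in> simplices (std_simplex (Suc n)) k"
proof -
  have l: "length u = Suc k" "length v = Suc k" using assms by (auto simp: in_std_simplex)
  have el: "u ! i \<le> 1" "v ! i \<le> n" if "i < Suc k" for i
  proof -
    have "u ! i \<in> set u" "v ! i \<in> set v" using that l by simp_all
    then have "u ! i \<in> {0..1}" "v ! i \<in> {0..n}" using assms unfolding in_std_simplex by blast+
    then show "u ! i \<le> 1" "v ! i \<le> n" by simp_all
  qed
  have "sorted (map2 (prism_collapse n) u v)"
    unfolding sorted_iff_nth_mono
  proof (intro allI impI)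
    fix i j assume ij: "i \<le> j" "j < length (map2 (prism_collapse n) u v)"
    then have j: "j < Suc k" "i < Suc k" using l by auto
    have "u ! i \<le> u ! j" "v ! i \<le> v ! j"
      using assms ij(1) j l by (auto simp: in_std_simplex intro: sorted_nth_mono)
    then show "map2 (prism_collapse n) u v ! i \<le> map2 (prism_collapse n) u v ! j"
      using j l el[OF j(1)] el[OF j(2)] by (auto simp: prism_collapse_def)
  qed
  moreover have "set (map2 (prism_collapse n) u v) \<subseteq> {0..Suc n}"
  proof
    fix x assume "x \<in> set (map2 (prism_collapse n) u v)"
    then obtain i where "i < Suc k" "x = prism_collapse n (u ! i) (v ! i)"
      using l by (auto simp: in_set_conv_nth)
    then show "x \<in> {0..Suc n}" using el[of i] by (auto simp: prism_collapse_def)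
  qed
  ultimately show ?thesis using l by (simp add: in_std_simplex)
qed

lemma simplices_prod: "simplices (sset_prod Y Z) k = simplices Y k \<times> simplices Z k"
  and face_prod: "face (sset_prod Y Z) k i (x, y) = (face Y k i x, face Z k i y)"
  and degen_prod: "degen (sset_prod Y Z) k i (x, y) = (degen Y k i x, degen Z k i y)"
  by (simp_all add: sset_prod_def)

text \<open>
  If \<open>G' - G = D H\<close>, the family with \<open>G'\<close> and \<open>G\<close> on the faces opposite to \<open>n\<close> and to \<open>n + 1\<close>, with \<open>0\<close> on
  the other codimension one faces and with \<open>(-1)\<^sup>n H\<close> on top is an \<open>(n + 1)\<close>-morphism. Its pullback along
  the collapse of the prism is the homotopy.
\<close>

lemma homotopy_of_coll_rel:
  assumes rel: "(G, G') \<in> crel n" and n: "n \<ge> 1"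
  shows "(sphere_map n G, sphere_map n G') \<in> homotopy_rel X (vertex F) n"
proof -
  have GG: "G \<in> coll n" "G' \<in> coll n" using rel by (auto simp: in_coll_rel)
  obtain H where H: "mmap (- int (n + 1)) H" "\<And>xs. G' xs - G xs = defect (- int (n + 1), H) xs"
    using rel unfolding in_coll_rel by blast
  define w where "w = (\<lambda>j. if j = n then G' else if j = Suc n then G else (\<lambda>_. 0))"
  \<comment> \<open>In the top equation \<open>G'\<close> occurs with the sign \<open>(-1)\<^sup>n\<close>.\<close>
  define H' where "H' = (\<lambda>us. with_sign (int n) (H us))"
  define W where "W = ball_family n w H'"
  have c: "concentrated n (Suc n) W" unfolding W_def by (rule concentrated_ball_family[OF n])
  have Wf: "W ({0..Suc n} - {j}) = w j" if "j \<le> Suc n" for j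
    unfolding W_def by (rule ball_family_face[OF n that])
  have te: "top_equation n w H'"
    unfolding top_equation_def
  proof (intro conjI allI)
    show "mmap (- int (n + 1)) H'" unfolding H'_def by (rule multimap_with_sign[OF GB H(1)])
    fix xs
    have "(\<Sum>j\<le>Suc n. with_sign (int j) (w j xs)) = with_sign (int n) (G' xs) + with_sign (int (Suc n)) (G xs)"
      by (subst sum_last_two) (auto simp: w_def)
    also have "with_sign (int (Suc n)) (G xs) = - with_sign (int n) (G xs)" by (simp add: with_sign_def)
    also have "with_sign (int n) (G' xs) + - with_sign (int n) (G xs) = defect (- int (n + 1), H') xs"
      unfolding H'_def defect_with_sign H(2)[symmetric] with_sign_diff by simp
    finally show "(\<Sum>j\<le>Suc n. with_sign (int j) (w j xs)) = defect (- int (n + 1), H') xs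
       + (if n = 1 then cup (-1) (-1) (w 2) (w 0) xs else 0)"
      using n by (simp add: w_def cup_zero del: sum.atMost_Suc)
  qed
  have "\<forall>j\<le>Suc n. w j \<in> coll n" using GG zero_in_collections by (auto simp: w_def)
  then have W: "n_morphism A B (Suc n) W"
    unfolding W_def n_morphism_ball_family[OF n] using te by blast
  have Wz: "W I = (\<lambda>_. 0)" if I: "I \<subseteq> {0..Suc n}" "card I \<ge> 2" and "(\<exists>j<n. j \<notin> I) \<or> (n \<notin> I \<and> Suc n \<notin> I)" for I
  proof -
    have "I \<noteq> {0..Suc n}" using that(3) by auto
    then have "card I < card {0..Suc n}" using I(1) by (intro psubset_card_mono) auto
    then consider "card I \<le> n" | "card I = n + 1" by force
    then show ?thesis
    proof cases
      case 1 then show ?thesis using concentratedD(3)[OF c I] by simp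
    next
      case 2
      then obtain j where j: "j \<le> Suc n" "I = {0..Suc n} - {j}" using card_codim_1[OF I(1)] by blast
      have "j < n" using that(3) j by auto
      then show ?thesis using Wf[OF j(1)] j(2) by (simp add: w_def)
    qed
  qed
  define h where "h = (\<lambda>k. \<lambda>p\<in>simplices (sset_prod (std_simplex 1) (std_simplex n)) k.
     pullback (map2 (prism_collapse n) (fst p) (snd p)) W)"
  have h: "h k (u, v) = pullback (map2 (prism_collapse n) u v) W"
    if "u \<in> simplices (std_simplex 1) k" "v \<in> simplices (std_simplex n) k" for k u v
    using that by (simp add: h_def simplices_prod)
  have "simplicial_map (sset_prod (std_simplex 1) (std_simplex n)) X h"
    unfolding simplicial_map_def
  proof (intro conjI allI ballI impI)
    show "h k \<in> simplices (sset_prod (std_simplex 1) (std_simplex n)) k \<rightarrow>\<^sub>E simplices X k" for k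
      using pullback_n_morphism[OF W prism_collapse_in_std] by (auto simp: h_def simplices_prod simplices_X)
  next
    fix k i p assume i: "i \<le> Suc k" and p: "p \<in> simplices (sset_prod (std_simplex 1) (std_simplex n)) (Suc k)"
    obtain u v where uv: "p = (u, v)" "u \<in> simplices (std_simplex 1) (Suc k)" "v \<in> simplices (std_simplex n) (Suc k)"
      using p by (cases p) (auto simp: simplices_prod)
    have l: "length u = Suc (Suc k)" "length v = Suc (Suc k)" using uv by (auto simp: in_std_simplex)
    have "map2 (prism_collapse n) (take i u @ drop (Suc i) u) (take i v @ drop (Suc i) v)
      = take i (map2 (prism_collapse n) u v) @ drop (Suc i) (map2 (prism_collapse n) u v)"
      using l by (simp add: take_map drop_map take_zip drop_zip)
    then show "h k (face (sset_prod (std_simplex 1) (std_simplex n)) (Suc k) i p) = face X (Suc k) i (h (Suc k) p)"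
      using h[OF face_in_std[OF uv(2) i] face_in_std[OF uv(3) i]] h[OF uv(2,3)]
        face_pullback[of "map2 (prism_collapse n) u v" k i A B W] l i
      by (simp add: uv(1) face_prod face_std)
  next
    fix k i p assume i: "i \<le> k" and p: "p \<in> simplices (sset_prod (std_simplex 1) (std_simplex n)) k"
    obtain u v where uv: "p = (u, v)" "u \<in> simplices (std_simplex 1) k" "v \<in> simplices (std_simplex n) k"
      using p by (cases p) (auto simp: simplices_prod)
    have l: "length u = Suc k" "length v = Suc k" using uv by (auto simp: in_std_simplex)
    have "map2 (prism_collapse n) (take (Suc i) u @ drop i u) (take (Suc i) v @ drop i v)
      = take (Suc i) (map2 (prism_collapse n) u v) @ drop i (map2 (prism_collapse n) u v)"
      using l by (simp add: take_map drop_map take_zip drop_zip)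
    then show "h (Suc k) (degen (sset_prod (std_simplex 1) (std_simplex n)) k i p) = degen X k i (h k p)"
      using h[OF degen_in_std[OF uv(2) i] degen_in_std[OF uv(3) i]] h[OF uv(2,3)]
        degen_pullback[of "map2 (prism_collapse n) u v" k i A B W] l i
      by (simp add: uv(1) degen_prod degen_std)
  qed
  moreover have "h k (u, v) = const_simplex X (vertex F) k"
    if u: "u \<in> simplices (std_simplex 1) k" and v: "v \<in> simplices (std_simplex n) k" "in_boundary n v" for k u v
    unfolding h[OF u v(1)] const_simplex_eq
  proof (rule pullback_eq_const[OF prism_collapse_in_std[OF u v(1)]])
    show "W {a} = F" if "a \<le> Suc n" for a by (rule concentratedD(2)[OF c that])
    fix I assume I: "I \<subseteq> set (map2 (prism_collapse n) u v)" "2 \<le> card I"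
    have sub: "set (map2 (prism_collapse n) u v) \<subseteq> {0..Suc n}"
      using prism_collapse_in_std[OF u v(1)] by (simp add: in_std_simplex)
    have "set v \<subset> {0..n}" using v unfolding in_boundary_def in_std_simplex by blast
    then obtain j where j: "j \<le> n" "j \<notin> set v" by (meson atLeastAtMost_iff psubset_imp_ex_mem DiffE)
    have mem: "x \<in> set v \<or> (x = Suc n \<and> n \<in> set v)" if x: "x \<in> set (map2 (prism_collapse n) u v)" for x
    proof -
      obtain p where p: "p \<in> set (zip u v)" "x = prism_collapse n (fst p) (snd p)"
        using x by (auto simp: split_def)
      have "snd p \<in> set v" using p(1) by (metis prod.collapse set_zip_rightD)
      then show ?thesis unfolding p(2) by (auto simp: prism_collapse_def)
    qed
    have vn: "Suc n \<notin> set v" using v(1) by (auto simp: in_std_simplex)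
    have "(\<exists>j<n. j \<notin> I) \<or> (n \<notin> I \<and> Suc n \<notin> I)"
    proof (cases "j = n")
      case True
      have "n \<notin> I" using mem[of n] I(1) j(2) True by auto
      moreover have "Suc n \<notin> I" using mem[of "Suc n"] I(1) j(2) True vn by auto
      ultimately show ?thesis by blast
    next
      case False
      then have "j < n" "j \<noteq> Suc n" using j(1) by auto
      moreover have "j \<notin> I" using mem[of j] I(1) j \<open>j \<noteq> Suc n\<close> by auto
      ultimately show ?thesis by blast
    qed
    then show "W I = (\<lambda>_. 0)" using Wz[OF order_trans[OF I(1) sub] I(2)] by blast
  qed
  moreover have "h k (replicate (Suc k) 0, v) = sphere_map n G k v \<and> h k (replicate (Suc k) 1, v) = sphere_map n G' k v"
    if v: "v \<in> simplices (std_simplex n) k" for k v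
  proof -
    have r: "replicate (Suc k) 0 \<in> simplices (std_simplex 1) k" "replicate (Suc k) 1 \<in> simplices (std_simplex 1) k"
      by (auto simp: in_std_simplex)
    have l: "length v = Suc k" using v by (simp add: in_std_simplex)
    have el: "v ! i \<le> n" if "i < Suc k" for i
    proof -
      have "v ! i \<in> set v" using that l by simp
      then have "v ! i \<in> {0..n}" using v unfolding in_std_simplex by blast
      then show ?thesis by simp
    qed
    have m: "map2 (prism_collapse n) (replicate (Suc k) 0) v = map (coface (Suc n)) v"
      "map2 (prism_collapse n) (replicate (Suc k) 1) v = map (coface n) v"
      using l el by (auto intro!: nth_equalityI simp: prism_collapse_def coface_def less_Suc_eq_le nth_append simp del: replicate_Suc)
         (metis le_antisym not_less)+
    have s: "w (Suc n) = G" "w n = G'" by (auto simp: w_def)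
    show ?thesis
      unfolding h[OF r(1) v] h[OF r(2) v] m simplex_map_def
      using pullback_concentrated_coface[OF c _ v] v by (simp add: Wf s)
  qed
  ultimately show ?thesis
    unfolding homotopy_rel_def using sphere_map_in_spheres[OF _ n] GG by blast
qed

text \<open>
  The prism is the union of the \<open>n + 1\<close> simplices with vertices
  \<open>(0,0), \<dots>, (0,i), (1,i), \<dots>, (1,n)\<close>. The codimension one faces of the \<open>i\<close>-th one lie over the boundary of \<open>\<Delta>\<^sup>n\<close>, except those
  opposite to \<open>i\<close> and to \<open>i + 1\<close>. Their components \<open>Q i\<close> and \<open>Q (i + 1)\<close> are therefore equivalent
  collections, and \<open>Q 0\<close> and \<open>Q (n + 1)\<close> come from the two ends. In a triangle of this kind one of the
  edges \<open>01\<close> and \<open>12\<close> vanishes, so that no product occurs for \<open>n = 1\<close>.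
\<close>

lemma coll_rel_of_homotopy:
  assumes hr: "(f, g) \<in> homotopy_rel X (vertex F) n" and n: "n \<ge> 1"
  shows "(top_component n f, top_component n g) \<in> crel n"
proof -
  let ?P = "sset_prod (std_simplex 1) (std_simplex n)"
  obtain h where fg: "f \<in> Sph n" "g \<in> Sph n" and h: "simplicial_map ?P X h"
    and bd: "\<And>k u v. u \<in> simplices (std_simplex 1) k \<Longrightarrow> v \<in> simplices (std_simplex n) k \<Longrightarrow>
        in_boundary n v \<Longrightarrow> h k (u, v) = const_family k"
    and ends: "\<And>k v. v \<in> simplices (std_simplex n) k \<Longrightarrow>
        h k (replicate (Suc k) 0, v) = f k v \<and> h k (replicate (Suc k) 1, v) = g k v"
    using hr unfolding homotopy_rel_def const_simplex_eq by blast
  \<comment> \<open>The \<open>i\<close>-th simplex of the prism has the vertices \<open>(\<alpha> i y, codegen i y)\<close>, \<open>0 \<le> y \<le> n + 1\<close>.\<close>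
  define \<alpha> :: "nat \<Rightarrow> nat \<Rightarrow> nat" where "\<alpha> = (\<lambda>i y. if y \<le> i then 0 else 1)"
  define Q where "Q = (\<lambda>i. h n (map (\<lambda>x. if x < i then 0 else 1) [0..<Suc n], [0..<Suc n]) {0..n})"
  have Q0: "Q 0 = top_component n g"
    using ends[OF identity_in_std]
    by (simp add: Q_def top_component_def map_replicate_const del: upt_Suc replicate_Suc)
  have Qn: "Q (Suc n) = top_component n f"
  proof -
    have "map (\<lambda>x. if x < Suc n then 0 else 1) [0..<Suc n] = replicate (Suc n) (0::nat)"
      by (rule nth_equalityI) (auto simp del: upt_Suc replicate_Suc)
    then show ?thesis
      using ends[OF identity_in_std] by (simp add: Q_def top_component_def del: upt_Suc replicate_Suc)
  qed
  have step: "(Q (Suc i), Q i) \<in> crel n" if i: "i \<le> n" for i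
  proof -
    define prism_map where "prism_map = (\<lambda>k. \<lambda>w\<in>simplices (std_simplex (Suc n)) k. h k (map (\<alpha> i) w, map (codegen i) w))"
    have in1: "map (\<alpha> i) w \<in> simplices (std_simplex 1) k" and in2: "map (codegen i) w \<in> simplices (std_simplex n) k"
      if "w \<in> simplices (std_simplex (Suc n)) k" for w k
    proof -
      show "map (\<alpha> i) w \<in> simplices (std_simplex 1) k"
        by (rule map_in_std[OF that]) (auto simp: \<alpha>_def mono_def)
      show "map (codegen i) w \<in> simplices (std_simplex n) k"
        by (rule map_in_std[OF that mono_codegen]) (use i in \<open>auto simp: codegen_def\<close>)
    qed
    have prism_map: "prism_map k w = h k (map (\<alpha> i) w, map (codegen i) w)" if "w \<in> simplices (std_simplex (Suc n)) k" for w k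
      using that by (simp add: prism_map_def)
    have s: "simplicial_map (std_simplex (Suc n)) X prism_map"
      unfolding simplicial_map_def
    proof (intro conjI allI ballI impI)
      have "h k (map (\<alpha> i) w, map (codegen i) w) \<in> simplices X k" if "w \<in> simplices (std_simplex (Suc n)) k" for w k
        using simplicial_mapD(1)[OF h, of _ k] in1[OF that] in2[OF that] by (simp add: simplices_prod simplices_X)
      then show "prism_map k \<in> simplices (std_simplex (Suc n)) k \<rightarrow>\<^sub>E simplices X k" for k
        by (auto simp: prism_map_def)
      fix k j w assume j: "j \<le> Suc k" and w: "w \<in> simplices (std_simplex (Suc n)) (Suc k)"
      show "prism_map k (face (std_simplex (Suc n)) (Suc k) j w) = face X (Suc k) j (prism_map (Suc k) w)"
        using simplicial_mapD(3)[OF h j, of "(map (\<alpha> i) w, map (codegen i) w)"] in1[OF w] in2[OF w]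
          prism_map[OF w] prism_map[OF face_in_std[OF w j]]
        by (simp add: simplices_prod face_prod face_std take_map drop_map)
    next
      fix k j w assume j: "j \<le> k" and w: "w \<in> simplices (std_simplex (Suc n)) k"
      show "prism_map (Suc k) (degen (std_simplex (Suc n)) k j w) = degen X k j (prism_map k w)"
        using simplicial_mapD(4)[OF h j, of "(map (\<alpha> i) w, map (codegen i) w)"] in1[OF w] in2[OF w]
          prism_map[OF w] prism_map[OF degen_in_std[OF w j]]
        by (simp add: simplices_prod degen_prod degen_std take_map drop_map)
    qed
    define W where "W = prism_map (Suc n) [0..<Suc (Suc n)]"
    have Wm: "n_morphism A B (Suc n) W" unfolding W_def by (rule yoneda(1)[OF s])
    have WI: "W I = h (face_dim I) (map (\<alpha> i) (sorted_list_of_set I), map (codegen i) (sorted_list_of_set I)) {0..face_dim I}"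
      "sorted_list_of_set I \<in> simplices (std_simplex (Suc n)) (face_dim I)"
      if I: "is_face (Suc n) I" for I
    proof -
      have fin: "finite I" using I is_face_finite by blast
      have d: "face_dim I + 1 = card I" using is_face_card[OF I] by (simp add: face_dim_def)
      show sl: "sorted_list_of_set I \<in> simplices (std_simplex (Suc n)) (face_dim I)"
        using fin I d by (simp add: in_std_simplex is_face_def)
      have w: "map ((!) [0..<Suc (Suc n)]) (sorted_list_of_set I) = sorted_list_of_set I"
        by (rule map_idI, subst nth_upt) (use I fin in \<open>auto simp: is_face_def less_Suc_eq_le\<close>)
      show "W I = h (face_dim I) (map (\<alpha> i) (sorted_list_of_set I), map (codegen i) (sorted_list_of_set I)) {0..face_dim I}"
        unfolding W_def simplicial_map_on_face[OF s identity_in_std I] w prism_map[OF sl] ..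
    qed
    have Wc: "W I = const_family (face_dim I) {0..face_dim I}" if I: "is_face (Suc n) I" "codegen i ` I \<noteq> {0..n}" for I
      unfolding WI(1)[OF I(1)]
      by (subst bd[OF in1[OF WI(2)[OF I(1)]] in2[OF WI(2)[OF I(1)]]])
        (use I is_face_finite[OF I(1)] in \<open>simp_all add: in_boundary_def\<close>)
    have small: "W I = (if card I = 1 then F else (\<lambda>_. 0))" if I: "is_face (Suc n) I" "codegen i ` I \<noteq> {0..n}" for I
      unfolding Wc[OF I] using is_face_card[OF I(1)] by (auto simp: const_family_def is_face_def face_dim_def)
    have cd: "codegen i ` I \<noteq> {0..n}" if "card (codegen i ` I) \<noteq> n + 1" for I using that by auto
    have cle: "codegen i ` I \<noteq> {0..n}" if "is_face (Suc n) I" "card I \<le> n" for I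
      by (rule cd) (use card_image_le[OF is_face_finite[OF that(1)], of "codegen i"] that(2) in linarith)
    have c: "concentrated n (Suc n) W"
      unfolding concentrated_def
    proof (intro conjI allI impI)
      show "W I = (\<lambda>_. 0)" if "\<not> is_face (Suc n) I" for I using Wm that unfolding n_morphism_iff by blast
      show "W {a} = F" if "a \<le> Suc n" for a
      proof -
        have "is_face (Suc n) {a}" using that by (simp add: is_face_def)
        from small[OF this cle[OF this]] show ?thesis using n by simp
      qed
      show "W I = (\<lambda>_. 0)" if "I \<subseteq> {0..Suc n}" "2 \<le> card I" "card I \<le> n" for I
      proof -
        have "is_face (Suc n) I" using that by (auto simp: is_face_def)
        from small[OF this cle[OF this that(3)]] show ?thesis using that(2) by simp
      qed
    qed
    have fj: "is_face (Suc n) ({0..Suc n} - {j})" "card ({0..Suc n} - {j}) = n + 1" if "j \<le> Suc n" for j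
      using coface_face[of n "{0..n}" j] coface_initial[OF that] that by (simp_all add: is_face_def)
    have other: "W ({0..Suc n} - {j}) = (\<lambda>_. 0)" if j: "j \<le> Suc n" "j \<noteq> i" "j \<noteq> Suc i" for j
    proof -
      have "\<not> inj_on (codegen i) ({0..Suc n} - {j})" unfolding inj_codegen using j i by auto
      then have "card (codegen i ` ({0..Suc n} - {j})) \<noteq> n + 1"
        using eq_card_imp_inj_on[OF is_face_finite[OF fj(1)[OF j(1)]], of "codegen i"] fj(2)[OF j(1)] by metis
      then show ?thesis using small[OF fj(1)[OF j(1)] cd] fj(2)[OF j(1)] n by simp
    qed
    have W_eq: "W ({0..Suc n} - {j}) = h n (map (\<alpha> i \<circ> coface j) [0..<Suc n], map (codegen i \<circ> coface j) [0..<Suc n]) {0..n}"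
      if "j \<le> Suc n" for j
    proof -
      have "sorted_list_of_set ({0..Suc n} - {j}) = map (coface j) [0..<Suc n]"
        unfolding coface_initial[OF that, symmetric]
        using sorted_list_of_set_image[OF strict_mono_coface, of "{0..n}" j] unfolding sorted_list_of_initial by simp
      moreover have "face_dim ({0..Suc n} - {j}) = n" using fj(2)[OF that] by (simp add: face_dim_def)
      ultimately show ?thesis using WI(1)[OF fj(1)[OF that]] by (simp only: map_map)
    qed
    have ca: "codegen i \<circ> coface i = id" "codegen i \<circ> coface (Suc i) = id"
      "\<alpha> i \<circ> coface i = (\<lambda>x. if x < i then 0 else 1)" "\<alpha> i \<circ> coface (Suc i) = (\<lambda>x. if x < Suc i then 0 else 1)"
      by (auto simp: fun_eq_iff \<alpha>_def coface_def codegen_def)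
    have Wi: "W ({0..Suc n} - {i}) = Q i" "W ({0..Suc n} - {Suc i}) = Q (Suc i)"
      using W_eq[of i] W_eq[of "Suc i"] i unfolding ca Q_def by (simp_all del: upt_Suc)
    have nm: "\<And>j. j \<le> Suc n \<Longrightarrow> W ({0..Suc n} - {j}) \<in> coll n"
      and te: "top_equation n (\<lambda>j. W ({0..Suc n} - {j})) (W {0..Suc n})"
      using n_morphism_top[OF c n] Wm by blast+
    have Qc: "Q i \<in> coll n" "Q (Suc i) \<in> coll n"
      using nm[of i] nm[of "Suc i"] i unfolding Wi by simp_all
    have eq: "Q i xs - Q (Suc i) xs = defect (- int (n + 1), \<lambda>us. with_sign (int i) (W {0..Suc n} us)) xs" for xs
    proof -
      have "(\<Sum>j\<le>Suc n. with_sign (int j) (W ({0..Suc n} - {j}) xs))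
        = (\<Sum>j\<in>{i, Suc i}. with_sign (int j) (W ({0..Suc n} - {j}) xs))"
        by (rule sum.mono_neutral_right) (use i other in auto)
      also have "\<dots> = with_sign (int i) (Q i xs) + with_sign (int (Suc i)) (Q (Suc i) xs)"
        using Wi by simp
      also have "with_sign (int (Suc i)) (Q (Suc i) xs) = - with_sign (int i) (Q (Suc i) xs)"
        by (simp add: with_sign_def)
      finally have 1: "(\<Sum>j\<le>Suc n. with_sign (int j) (W ({0..Suc n} - {j}) xs)) = with_sign (int i) (Q i xs - Q (Suc i) xs)"
        by (simp add: with_sign_diff)
      have "cup (-1) (-1) (W ({0..Suc n} - {2})) (W ({0..Suc n} - {0})) xs = 0" if "n = 1"
      proof (cases "i = 0")
        case True
        then show ?thesis using other[of 2] that cup_zero(1) by simp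
      next
        case False
        then show ?thesis using other[of 0] cup_zero(2) by simp
      qed
      then have 2: "(if n = 1 then cup (-1) (-1) (W ({0..Suc n} - {2})) (W ({0..Suc n} - {0})) xs else 0) = 0" by simp
      have "(\<Sum>j\<le>Suc n. with_sign (int j) (W ({0..Suc n} - {j}) xs)) = defect (- int (n + 1), W {0..Suc n}) xs
         + (if n = 1 then cup (-1) (-1) (W ({0..Suc n} - {2})) (W ({0..Suc n} - {0})) xs else 0)"
        using te unfolding top_equation_def by blast
      then have "with_sign (int i) (Q i xs - Q (Suc i) xs) = defect (- int (n + 1), W {0..Suc n}) xs"
        unfolding 1 2 add_0_right .
      then show ?thesis unfolding defect_with_sign by (metis with_sign_with_sign with_sign_self)
    qed
    have "mmap (- int (n + 1)) (\<lambda>us. with_sign (int i) (W {0..Suc n} us))"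
      using te multimap_with_sign[OF GB] unfolding top_equation_def by blast
    then show ?thesis unfolding in_coll_rel using Qc eq by blast
  qed
  have "(Q m, Q 0) \<in> crel n" if "m \<le> Suc n" for m
    using that
  proof (induction m)
    case 0
    have "Q 0 \<in> coll n" unfolding Q0 by (rule sphere_eq_sphere_map(1)[OF fg(2) n])
    then show ?case using equiv_coll_rel[of n] by (simp add: equiv_def refl_on_def)
  next
    case (Suc m)
    then show ?case using step[of m] equiv_coll_rel[of n] unfolding equiv_def by (metis Suc_le_mono le_SucI transD)
  qed
  from this[of "Suc n"] show ?thesis unfolding Q0 Qn by simp
qed

lemma homotopy_rel_iff:
  assumes "n \<ge> 1"
  shows "(f, g) \<in> homotopy_rel X (vertex F) n \<longleftrightarrow>
     f \<in> Sph n \<and> g \<in> Sph n \<and> (top_component n f, top_component n g) \<in> crel n"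
proof
  assume r: "(f, g) \<in> homotopy_rel X (vertex F) n"
  then show "f \<in> Sph n \<and> g \<in> Sph n \<and> (top_component n f, top_component n g) \<in> crel n"
    using coll_rel_of_homotopy[OF r assms] unfolding homotopy_rel_def by blast
next
  assume r: "f \<in> Sph n \<and> g \<in> Sph n \<and> (top_component n f, top_component n g) \<in> crel n"
  then show "(f, g) \<in> homotopy_rel X (vertex F) n"
    using homotopy_of_coll_rel[of "top_component n f" "top_component n g" n] assms
      sphere_eq_sphere_map(2)[of f n] sphere_eq_sphere_map(2)[of g n] by metis
qed

section \<open>Composites\<close>


definition product :: "nat \<Rightarrow> ('a list \<Rightarrow> 'b) \<Rightarrow> ('a list \<Rightarrow> 'b) \<Rightarrow> 'a list \<Rightarrow> 'b" where
  "product n f g = (if n = 1 then concat_coll g f else (\<lambda>xs. f xs + g xs))"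

lemma product_in_collections: "f \<in> coll n \<Longrightarrow> g \<in> coll n \<Longrightarrow> product n f g \<in> coll n"
  unfolding product_def using concat_in_collections add_in_collections by auto

lemma product_rel: "(f, f') \<in> crel n \<Longrightarrow> (g, g') \<in> crel n \<Longrightarrow> (product n f g, product n f' g') \<in> crel n"
  unfolding product_def using concat_coll_rel coll_rel_add by auto

lemma map_face_concentrated:
  assumes "concentrated n (Suc n) W" "i \<le> Suc n"
  shows "map_face n i (simplex_map (Suc n) W) = sphere_map n (W ({0..Suc n} - {i}))"
proof (rule ext, rule ext)
  fix k v
  have "map (coface i) v \<in> simplices (std_simplex (Suc n)) k" if "v \<in> simplices (std_simplex n) k"
    by (rule map_in_std[OF that mono_coface]) (simp add: coface_def)
  then show "map_face n i (simplex_map (Suc n) W) k v = sphere_map n (W ({0..Suc n} - {i})) k v"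
    using pullback_concentrated_coface[OF assms] by (auto simp: map_face_def simplex_map_def restrict_def)
qed

lemma const_map_eq:
  assumes n: "n \<ge> 1" shows "const_map X (vertex F) n = sphere_map n (\<lambda>_. 0)"
proof (rule ext, rule ext)
  fix k v
  have "pullback v (sphere_family n (\<lambda>_. 0)) = const_family k" if v: "v \<in> simplices (std_simplex n) k"
  proof (rule pullback_eq_const[OF v])
    show "sphere_family n (\<lambda>_. 0) {a} = F" if "a \<le> n" for a
      by (rule concentratedD(2)[OF concentrated_sphere_family[OF n] that])
    show "sphere_family n (\<lambda>_. 0) I = (\<lambda>_. 0)" if "2 \<le> card I" for I
      using that by (simp add: sphere_family_def)
  qed
  then show "const_map X (vertex F) n k v = sphere_map n (\<lambda>_. 0) k v"
    by (auto simp: const_map_def simplex_map_def const_simplex_eq restrict_def)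
qed

lemma sum_last_three:
  fixes f :: "nat \<Rightarrow> 'b"
  assumes "\<And>j. j + 1 < n \<Longrightarrow> f j = 0" "n \<ge> 1"
  shows "(\<Sum>j\<le>Suc n. f j) = f (n - 1) + f n + f (Suc n)"
proof -
  obtain p where p: "n = Suc p" using assms(2) by (cases n) auto
  have "(\<Sum>j\<le>n. f j) = f p + f (Suc p)"
    unfolding p by (rule sum_last_two) (use assms(1) p in simp)
  then show ?thesis by (simp add: p)
qed

text \<open>
  The faces \<open>n - 1\<close> and \<open>n + 1\<close> of the horn have the same sign, opposite to that of the missing face \<open>n\<close>.
\<close>

lemma horn_sum:
  fixes w :: "nat \<Rightarrow> 'a list \<Rightarrow> 'b"
  assumes "\<And>j. j + 1 < n \<Longrightarrow> w j = (\<lambda>_. 0)" "n \<ge> 1"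
  shows "(\<Sum>j\<le>Suc n. with_sign (int j) (w j xs))
    = with_sign (int (n + 1)) (w (n - 1) xs + w (Suc n) xs - w n xs)"
proof -
  have "with_sign (int (n - 1)) z = with_sign (int (n + 1)) z" "with_sign (int n) z = - with_sign (int (n + 1)) z" for z :: 'b
    using assms(2) by (auto simp: with_sign_def)
  then show ?thesis
    by (subst sum_last_three) (use assms in \<open>simp_all add: with_sign_add with_sign_diff algebra_simps\<close>)
qed

text \<open>
  With the expected composite on the missing face and \<open>0\<close> on top, the top equation becomes an identity.
\<close>

lemma horn_filler_exists:
  assumes f: "f \<in> Sph n" and g: "g \<in> Sph n" and n: "n \<ge> 1"
  shows "\<exists>w. horn_filler X (vertex F) n f g w"
proof -
  define f' where "f' = top_component n f"
  define g' where "g' = top_component n g"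
  have fe: "f = sphere_map n f'" "f' \<in> coll n" and ge: "g = sphere_map n g'" "g' \<in> coll n"
    unfolding f'_def g'_def using sphere_eq_sphere_map[OF f n] sphere_eq_sphere_map[OF g n] by blast+
  define w where "w = (\<lambda>j. if j = n - 1 then f' else if j = n then product n f' g' else if j = Suc n then g' else (\<lambda>_. 0))"
  define W where "W = ball_family n w (\<lambda>_. 0)"
  have c: "concentrated n (Suc n) W" unfolding W_def by (rule concentrated_ball_family[OF n])
  have wn: "w (n - 1) = f'" "w n = product n f' g'" "w (Suc n) = g'" using n by (auto simp: w_def)
  have w0: "w j = (\<lambda>_. 0)" if "j + 1 < n" for j
  proof -
    have "j \<noteq> n - 1" "j \<noteq> n" "j \<noteq> Suc n" using that by linarith+
    then show ?thesis unfolding w_def by (simp only: if_False)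
  qed
  have wc: "\<forall>j\<le>Suc n. w j \<in> coll n"
    using fe(2) ge(2) product_in_collections[OF fe(2) ge(2)] zero_in_collections by (auto simp: w_def)
  have "top_equation n w (\<lambda>_. 0)"
    unfolding top_equation_def
  proof (intro conjI allI)
    show "mmap (- int (n + 1)) (\<lambda>_. 0)" by (rule multimap_zero[OF GB])
    fix xs
    have "(\<Sum>j\<le>Suc n. with_sign (int j) (w j xs)) = with_sign (int (n + 1)) (f' xs + g' xs - product n f' g' xs)"
      using horn_sum[of n w xs] w0 n unfolding wn by blast
    also have "\<dots> = (if n = 1 then cup (-1) (-1) (w 2) (w 0) xs else 0)"
    proof (cases "n = 1")
      case True
      then have "n - 1 = 0" "Suc n = 2" by simp_all
      then have "w 0 = f'" "w 2 = g'" using wn by metis+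
      then show ?thesis using True with_sign_even(1)[of 1] by (simp add: product_def concat_coll_def)
    qed (simp add: product_def)
    finally show "(\<Sum>j\<le>Suc n. with_sign (int j) (w j xs)) = defect (- int (n + 1), \<lambda>_. 0) xs
        + (if n = 1 then cup (-1) (-1) (w 2) (w 0) xs else 0)"
      by (simp add: defect_zero)
  qed
  then have W: "n_morphism A B (Suc n) W"
    unfolding W_def n_morphism_ball_family[OF n] using wc by blast
  have mf: "map_face n i (simplex_map (Suc n) W) = sphere_map n (w i)" if "i \<le> Suc n" for i
  proof -
    have "W ({0..Suc n} - {i}) = w i" unfolding W_def by (rule ball_family_face[OF n that])
    then show ?thesis by (simp only: map_face_concentrated[OF c that])
  qed
  have "horn_filler X (vertex F) n f g (simplex_map (Suc n) W)"
    unfolding horn_filler_def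
  proof (intro conjI allI impI)
    show "simplicial_map (std_simplex (Suc n)) X (simplex_map (Suc n) W)"
      by (rule simplex_map_simplicial[OF W])
    show "map_face n i (simplex_map (Suc n) W) = const_map X (vertex F) n" if "i + 1 < n" for i
      using mf[of i] that w0[OF that] unfolding const_map_eq[OF n] by simp
    show "map_face n (n - 1) (simplex_map (Suc n) W) = f" using mf[of "n - 1"] unfolding wn fe(1)[symmetric] by simp
    show "map_face n (n + 1) (simplex_map (Suc n) W) = g" using mf[of "Suc n"] unfolding wn ge(1)[symmetric] by simp
  qed
  then show ?thesis by blast
qed

text \<open>
  A face of \<open>\<Delta>\<^sup>n\<^sup>+\<^sup>1\<close> of dimension less than \<open>n\<close> lies in one of the given faces of the horn, so that every
  filler is concentrated, and the top equation determines the missing face up to a boundary.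
\<close>

lemma horn_filler_face:
  assumes f: "f \<in> Sph n" and g: "g \<in> Sph n" and n: "n \<ge> 1" and w: "horn_filler X (vertex F) n f g w"
  shows "map_face n n w \<in> Sph n"
    "(top_component n (map_face n n w), product n (top_component n f) (top_component n g)) \<in> crel n"
proof -
  define W where "W = w (Suc n) [0..<Suc (Suc n)]"
  have s: "simplicial_map (std_simplex (Suc n)) X w" using w by (simp add: horn_filler_def)
  have W: "n_morphism A B (Suc n) W" and we: "w = simplex_map (Suc n) W"
    unfolding W_def by (rule yoneda(1)[OF s], rule yoneda(2)[OF s])
  have faces: "\<exists>G. map_face n j w = sphere_map n G" if j: "j \<le> Suc n" "j \<noteq> n" for j
  proof -
    consider "j + 1 < n" | "j = n - 1" | "j = n + 1" using j by linarith
    then show ?thesis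
    proof cases
      case 1 then show ?thesis using w const_map_eq[OF n] unfolding horn_filler_def by metis
    next
      case 2 then show ?thesis using w sphere_eq_sphere_map(2)[OF f n] unfolding horn_filler_def by metis
    next
      case 3 then show ?thesis using w sphere_eq_sphere_map(2)[OF g n] unfolding horn_filler_def by metis
    qed
  qed
  have on_face: "map_face n j w n [0..<Suc n] I = W (coface j ` I)" if "is_face n I" for j I
  proof -
    have "map (coface j) [0..<Suc n] \<in> simplices (std_simplex (Suc n)) n"
      by (rule map_in_std[OF identity_in_std mono_coface]) (simp add: coface_def)
    then have "map_face n j w n [0..<Suc n] I = pullback (map (coface j) [0..<Suc n]) W I"
      unfolding we using identity_in_std[of n] by (simp add: map_face_def simplex_map_def del: upt_Suc)
    also have "\<dots> = W (coface j ` I)"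
      unfolding pullback_map_coface[OF identity_in_std] by (rule pullback_identity[OF that])
    finally show ?thesis .
  qed
  have small: "W I = (if card I = 1 then F else (\<lambda>_. 0))" if I: "I \<subseteq> {0..Suc n}" "I \<noteq> {}" "card I \<le> n" for I
  proof -
    have "\<not> {0..Suc n} - {n} \<subseteq> I"
    proof
      assume "{0..Suc n} - {n} \<subseteq> I"
      from card_mono[OF finite_subset[OF I(1)] this] show False using I(3) by simp
    qed
    then obtain j where "j \<in> {0..Suc n} - {n}" and jI: "j \<notin> I" by blast
    then have j: "j \<le> Suc n" "j \<noteq> n" "j \<notin> I" by simp_all
    obtain I' where I': "is_face n I'" "I = coface j ` I'" "card I' = card I"
      using coface_preimage[OF I(1) j(3,1) I(2)] by blast
    obtain G where G: "map_face n j w = sphere_map n G" using faces[OF j(1,2)] by blast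
    have "W I = sphere_map n G n [0..<Suc n] I'"
      unfolding I'(2) on_face[OF I'(1), symmetric] G ..
    also have "\<dots> = sphere_family n G I'" by (rule simplex_map_identity[OF I'(1)])
    also have "\<dots> = (if card I = 1 then F else (\<lambda>_. 0))"
    proof -
      have "I' \<noteq> {0..n}" using I'(3) I(3) by auto
      then show ?thesis using I'(1,3) by (simp add: sphere_family_def)
    qed
    finally show ?thesis .
  qed
  have c: "concentrated n (Suc n) W"
    unfolding concentrated_def
  proof (intro conjI allI impI)
    show "W I = (\<lambda>_. 0)" if "\<not> is_face (Suc n) I" for I using W that unfolding n_morphism_iff by blast
    show "W {a} = F" if "a \<le> Suc n" for a using small[of "{a}"] that n by simp
    show "W I = (\<lambda>_. 0)" if I: "I \<subseteq> {0..Suc n}" "2 \<le> card I" "card I \<le> n" for I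
    proof -
      have "I \<noteq> {}" using I(2) by auto
      then show ?thesis using small[OF I(1) _ I(3)] I(2) by simp
    qed
  qed
  let ?w = "\<lambda>j. W ({0..Suc n} - {j})"
  have mf: "map_face n j w = sphere_map n (?w j)" if "j \<le> Suc n" for j
    unfolding we by (rule map_face_concentrated[OF c that])
  have wj: "?w j = top_component n (map_face n j w)" if "j \<le> Suc n" for j
    unfolding mf[OF that] top_component_sphere_map[OF n] ..
  have nm: "\<And>j. j \<le> Suc n \<Longrightarrow> ?w j \<in> coll n" and te: "top_equation n ?w (W {0..Suc n})"
    using n_morphism_top[OF c n] W by blast+
  have e1: "?w (n - 1) = top_component n f" and e2: "?w (Suc n) = top_component n g"
    using wj[of "n - 1"] wj[of "Suc n"] w by (simp_all add: horn_filler_def)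
  have e0: "?w j = (\<lambda>_. 0)" if "j + 1 < n" for j
    using wj[of j] w that by (simp add: horn_filler_def const_map_eq[OF n] top_component_sphere_map[OF n])
  have en: "?w n = top_component n (map_face n n w)" using wj[of n] by simp
  show "map_face n n w \<in> Sph n"
    unfolding mf[of n, simplified] by (rule sphere_map_in_spheres[OF nm n]) simp
  define H where "H = (\<lambda>us. with_sign (int (n + 1)) (W {0..Suc n} us))"
  have H: "mmap (- int (n + 1)) H"
    using te multimap_with_sign[OF GB] unfolding top_equation_def H_def by blast
  have "product n (top_component n f) (top_component n g) xs - ?w n xs = defect (- int (n + 1), H) xs" for xs
  proof -
    have c0: "(if n = 1 then cup (-1) (-1) (?w 2) (?w 0) xs else 0)
       = (if n = 1 then cup (-1) (-1) (top_component n g) (top_component n f) xs else 0)"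
    proof (cases "n = 1")
      case True
      then have "n - 1 = 0" "Suc n = 2" by simp_all
      then have "?w 0 = top_component n f" "?w 2 = top_component n g" using e1 e2 by metis+
      then show ?thesis by (simp only:)
    qed simp
    have "with_sign (int (n + 1)) (top_component n f xs + top_component n g xs - ?w n xs)
      = defect (- int (n + 1), W {0..Suc n}) xs + (if n = 1 then cup (-1) (-1) (top_component n g) (top_component n f) xs else 0)"
    proof -
      have "(\<Sum>j\<le>Suc n. with_sign (int j) (?w j xs))
        = defect (- int (n + 1), W {0..Suc n}) xs + (if n = 1 then cup (-1) (-1) (?w 2) (?w 0) xs else 0)"
        using te unfolding top_equation_def by blast
      moreover have "(\<Sum>j\<le>Suc n. with_sign (int j) (?w j xs)) = with_sign (int (n + 1)) (?w (n - 1) xs + ?w (Suc n) xs - ?w n xs)"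
        using horn_sum[of n ?w xs] e0 n by blast
      ultimately show ?thesis unfolding c0 e1 e2 by (simp only:)
    qed
    then have "with_sign (int (n + 1)) (with_sign (int (n + 1)) (top_component n f xs + top_component n g xs - ?w n xs))
      = defect (- int (n + 1), H) xs + with_sign (int (n + 1)) (if n = 1 then cup (-1) (-1) (top_component n g) (top_component n f) xs else 0)"
      unfolding H_def defect_with_sign by (simp only: with_sign_add)
    moreover have "with_sign (int (n + 1)) (if n = 1 then z else 0) = (if n = 1 then z else 0)" for z :: 'b
      by (simp add: with_sign_def)
    ultimately have "top_component n f xs + top_component n g xs - ?w n xs
      = defect (- int (n + 1), H) xs + (if n = 1 then cup (-1) (-1) (top_component n g) (top_component n f) xs else 0)"
      unfolding with_sign_with_sign with_sign_self by (simp only:)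
    then show ?thesis
      by (auto simp: product_def concat_coll_def algebra_simps)
  qed
  then show "(top_component n (map_face n n w), product n (top_component n f) (top_component n g)) \<in> crel n"
    unfolding in_coll_rel using nm[of n] nm[of "n - 1"] nm[of "Suc n"] H product_in_collections[of "?w (n - 1)" n "?w (Suc n)"]
    unfolding en e1 e2 by auto
qed

abbreviation "hrel n \<equiv> homotopy_rel X (vertex F) n"

lemma equiv_homotopy_rel:
  assumes n: "n \<ge> 1" shows "equiv (Sph n) (hrel n)"
proof (rule equivI)
  note E = equiv_coll_rel[of n]
  show "hrel n \<subseteq> Sph n \<times> Sph n" by (auto simp: homotopy_rel_def)
  show "refl_on (Sph n) (hrel n)"
    using E sphere_eq_sphere_map(1)[OF _ n] unfolding refl_on_def homotopy_rel_iff[OF n] equiv_def by blast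
  show "sym (hrel n)"
    using E unfolding sym_def homotopy_rel_iff[OF n] equiv_def by blast
  show "trans (hrel n)"
    using E unfolding trans_def homotopy_rel_iff[OF n] equiv_def by blast
qed

lemma top_component_class:
  assumes n: "n \<ge> 1" and f: "f \<in> Sph n"
  shows "top_component n ` (hrel n `` {f}) = crel n `` {top_component n f}"
proof (intro equalityI subsetI)
  fix G assume "G \<in> crel n `` {top_component n f}"
  then have G: "(top_component n f, G) \<in> crel n" by simp
  then have Gc: "G \<in> coll n" by (simp add: in_coll_rel)
  have "(f, sphere_map n G) \<in> hrel n"
    unfolding homotopy_rel_iff[OF n] top_component_sphere_map[OF n] using f sphere_map_in_spheres[OF Gc n] G by blast
  then show "G \<in> top_component n ` (hrel n `` {f})"
    by (intro image_eqI[of _ _ "sphere_map n G"]) (simp_all add: top_component_sphere_map[OF n])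
qed (auto simp: homotopy_rel_iff[OF n])

lemma bij_betw_classes:
  assumes n: "n \<ge> 1"
  shows "bij_betw (\<lambda>c. top_component n ` c) (homotopy_set X (vertex F) n) (coll n // crel n)"
proof (rule bij_betw_imageI)
  let ?t = "top_component n"
  have inj: "inj_on ?t (Sph n)" and im: "?t ` Sph n = coll n"
    using bij_betw_top_component[OF n] by (auto simp: bij_betw_def)
  have sub: "c \<subseteq> Sph n" if "c \<in> homotopy_set X (vertex F) n" for c
    using that in_quotient_imp_subset[OF equiv_homotopy_rel[OF n]] by (simp add: homotopy_set_def)
  show "inj_on (\<lambda>c. ?t ` c) (homotopy_set X (vertex F) n)"
  proof (rule inj_onI)
    fix c d assume cd: "c \<in> homotopy_set X (vertex F) n" "d \<in> homotopy_set X (vertex F) n" "?t ` c = ?t ` d"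
    then show "c = d" using inj_on_image_eq_iff[OF inj sub[OF cd(1)] sub[OF cd(2)]] by blast
  qed
  show "(\<lambda>c. ?t ` c) ` homotopy_set X (vertex F) n = coll n // crel n"
  proof (intro equalityI subsetI)
    fix d assume "d \<in> (\<lambda>c. ?t ` c) ` homotopy_set X (vertex F) n"
    then obtain f where "f \<in> Sph n" "d = ?t ` (hrel n `` {f})" by (auto simp: homotopy_set_def elim!: quotientE)
    then show "d \<in> coll n // crel n"
      using top_component_class[OF n] im by (auto intro: quotientI)
  next
    fix d assume "d \<in> coll n // crel n"
    then obtain G where G: "G \<in> coll n" "d = crel n `` {G}" by (rule quotientE)
    obtain f where "f \<in> Sph n" "G = ?t f" using G(1) unfolding im[symmetric] by blast
    then have f: "f \<in> Sph n" "d = crel n `` {?t f}" using G(2) by simp_all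
    have "hrel n `` {f} \<in> homotopy_set X (vertex F) n"
      unfolding homotopy_set_def by (rule quotientI[OF f(1)])
    moreover have "d = ?t ` (hrel n `` {f})" using f top_component_class[OF n] by simp
    ultimately show "d \<in> (\<lambda>c. ?t ` c) ` homotopy_set X (vertex F) n" by blast
  qed
qed

text \<open>
  Representatives and fillers may vary; by \<open>horn_filler_face\<close> and \<open>product_rel\<close> the class of the missing
  face does not.
\<close>

lemma composite_classes:
  assumes n: "n \<ge> 1" and p: "p \<in> homotopy_set X (vertex F) n" and q: "q \<in> homotopy_set X (vertex F) n"
    and Fn: "Fn \<in> top_component n ` p" and Gn: "Gn \<in> top_component n ` q"
  shows "\<exists>!r. is_composite X (vertex F) n q p r"
    "top_component n ` composite X (vertex F) n q p = crel n `` {product n Gn Fn}"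
    "Fn \<in> coll n" "Gn \<in> coll n"
proof -
  note E = equiv_homotopy_rel[OF n]
  have sub: "x \<in> Sph n" if "c \<in> homotopy_set X (vertex F) n" "x \<in> c" for c x
    using that in_quotient_imp_subset[OF E] by (auto simp: homotopy_set_def)
  have rel: "(top_component n x, top_component n y) \<in> crel n"
    if "c \<in> homotopy_set X (vertex F) n" "x \<in> c" "y \<in> c" for c x y
    using quotient_eq_iff[OF E, of c c x y] that homotopy_rel_iff[OF n] by (auto simp: homotopy_set_def)
  obtain g where g: "g \<in> p" "Fn = top_component n g" using Fn by blast
  obtain f where f: "f \<in> q" "Gn = top_component n f" using Gn by blast
  note fS = sub[OF q f(1)] and gS = sub[OF p g(1)]
  show "Fn \<in> coll n" "Gn \<in> coll n"
    unfolding f(2) g(2) by (rule sphere_eq_sphere_map(1)[OF gS n], rule sphere_eq_sphere_map(1)[OF fS n])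
  obtain w where w: "horn_filler X (vertex F) n f g w" using horn_filler_exists[OF fS gS n] by blast
  let ?r = "hrel n `` {map_face n n w}"
  have ic: "is_composite X (vertex F) n q p ?r" unfolding is_composite_def using f(1) g(1) w by blast
  note mw = horn_filler_face[OF fS gS n w]
  have uniq: "r = ?r" if r: "is_composite X (vertex F) n q p r" for r
  proof -
    obtain f' g' w' where r': "f' \<in> q" "g' \<in> p" "horn_filler X (vertex F) n f' g' w'" "r = hrel n `` {map_face n n w'}"
      using r unfolding is_composite_def by blast
    note mw' = horn_filler_face[OF sub[OF q r'(1)] sub[OF p r'(2)] n r'(3)]
    have "(product n (top_component n f') (top_component n g'), product n (top_component n f) (top_component n g)) \<in> crel n"
      by (rule product_rel[OF rel[OF q r'(1) f(1)] rel[OF p r'(2) g(1)]])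
    then have "(top_component n (map_face n n w'), top_component n (map_face n n w)) \<in> crel n"
      using mw(2) mw'(2) equiv_coll_rel[of n] unfolding equiv_def by (meson symD transD)
    then have "(map_face n n w', map_face n n w) \<in> hrel n"
      unfolding homotopy_rel_iff[OF n] using mw(1) mw'(1) by blast
    then show ?thesis unfolding r'(4) by (rule equiv_class_eq[OF E])
  qed
  show "\<exists>!r. is_composite X (vertex F) n q p r" using ic uniq by blast
  have "composite X (vertex F) n q p = ?r"
    unfolding composite_def by (rule the_equality, rule ic, rule uniq)
  then show "top_component n ` composite X (vertex F) n q p = crel n `` {product n Gn Fn}"
    using top_component_class[OF n mw(1)] equiv_class_eq[OF equiv_coll_rel mw(2)] unfolding f(2) g(2) by simp
qed

end

theorem theorem2:
  fixes A :: "'a::ab_group_add ainf" and B :: "'b::ab_group_add ainf" and F :: "'a list \<Rightarrow> 'b"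
  assumes "ainf_algebra A" and "ainf_algebra B" and "ainf_morphism A B F"
  shows
    "(\<forall>n\<ge>1. equiv (collections A B F n) (coll_rel A B F n) \<and>
        bij_betw (\<lambda>c. top_component n ` c)
          (homotopy_set (HOM A B) (vertex F) n) (collections A B F n // coll_rel A B F n))
   \<and> (\<forall>p\<in>homotopy_set (HOM A B) (vertex F) 1. \<forall>q\<in>homotopy_set (HOM A B) (vertex F) 1.
        \<forall>F1\<in>top_component 1 ` p. \<forall>G1\<in>top_component 1 ` q.
          (\<exists>!r. is_composite (HOM A B) (vertex F) 1 q p r) \<and>
          (\<exists>P\<in>collections A B F 1.
             (\<forall>es xs. xs \<noteq> [] \<longrightarrow> homog (susp (comps A)) es xs \<longrightarrow>
                P xs = G1 xs + F1 xs - two_sum B F F1 G1 es xs) \<and>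
             top_component 1 ` composite (HOM A B) (vertex F) 1 q p = coll_rel A B F 1 `` {P}))
   \<and> (\<forall>n\<ge>2. \<forall>p\<in>homotopy_set (HOM A B) (vertex F) n. \<forall>q\<in>homotopy_set (HOM A B) (vertex F) n.
        \<forall>Fn\<in>top_component n ` p. \<forall>Gn\<in>top_component n ` q.
          (\<exists>!r. is_composite (HOM A B) (vertex F) n q p r) \<and>
          (\<lambda>xs. Gn xs + Fn xs) \<in> collections A B F n \<and>
          top_component n ` composite (HOM A B) (vertex F) n q p
            = coll_rel A B F n `` {\<lambda>xs. Gn xs + Fn xs})"
proof -
  interpret hom_data A B F by unfold_locales (rule assms)+
  have one: "P \<in> coll 1 \<and> (\<forall>es xs. xs \<noteq> [] \<longrightarrow> homog SA es xs \<longrightarrow> P xs = G1 xs + F1 xs - two_sum B F F1 G1 es xs)"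
    if "F1 \<in> coll 1" "G1 \<in> coll 1" "P = product 1 G1 F1" for F1 G1 P
  proof (intro conjI allI impI)
    show "P \<in> coll 1" unfolding that(3) by (rule product_in_collections[OF that(2,1)])
    have "multiadditive F1" "multiadditive G1" using that(1,2) multimapD(2) unfolding in_collections by blast+
    then show "P xs = G1 xs + F1 xs - two_sum B F F1 G1 es xs" if "homog SA es xs" for es xs
      using cup_homog[of F1 G1 es xs] that \<open>P = product 1 G1 F1\<close> by (simp add: product_def concat_coll_def)
  qed
  have two: "product n Gn Fn = (\<lambda>xs. Gn xs + Fn xs)" if "n \<ge> 2" for n Fn Gn
    using that by (simp add: product_def)
  show ?thesis
  proof (intro conjI ballI allI impI)
    show "equiv (coll n) (crel n)" for n by (rule equiv_coll_rel)
    show "bij_betw (\<lambda>c. top_component n ` c) (homotopy_set X (vertex F) n) (coll n // crel n)" if "n \<ge> 1" for n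
      by (rule bij_betw_classes[OF that])
    fix p q F1 G1
    assume "p \<in> homotopy_set X (vertex F) 1" "q \<in> homotopy_set X (vertex F) 1"
      "F1 \<in> top_component 1 ` p" "G1 \<in> top_component 1 ` q"
    note c = composite_classes[OF order_refl this]
    show "\<exists>!r. is_composite X (vertex F) 1 q p r" by (rule c(1))
    show "\<exists>P\<in>coll 1. (\<forall>es xs. xs \<noteq> [] \<longrightarrow> homog SA es xs \<longrightarrow> P xs = G1 xs + F1 xs - two_sum B F F1 G1 es xs) \<and>
       top_component 1 ` composite X (vertex F) 1 q p = crel 1 `` {P}"
      using one[OF c(3,4) refl] c(2) by blast
  next
    fix n :: nat and p q Fn Gn
    assume n: "2 \<le> n" and pq: "p \<in> homotopy_set X (vertex F) n" "q \<in> homotopy_set X (vertex F) n"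
      "Fn \<in> top_component n ` p" "Gn \<in> top_component n ` q"
    have "1 \<le> n" using n by simp
    note c = composite_classes[OF this pq]
    show "\<exists>!r. is_composite X (vertex F) n q p r" by (rule c(1))
    show "(\<lambda>xs. Gn xs + Fn xs) \<in> coll n"
      by (rule add_in_collections[OF c(4,3)])
    show "top_component n ` composite X (vertex F) n q p = crel n `` {\<lambda>xs. Gn xs + Fn xs}"
      using c(2) unfolding two[OF n] .
  qed
qed

end
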